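(* For every $1<s<2$ there exists a constant $C_s>0$ (depending only on $s$) such that for every integer $N\ge4$ the set $\mathcal P_N\subset\mathbb S^2$ of $N$ deterministic Diamond points satisfies $$\sup_{\|f\|_{\mathbb H^s(\mathbb S^2)}\le1}\left|\frac1N\sum_{x\in\mathcal P_N}f(x)-\int_{\mathbb S^2}f(x)\,d\sigma(x)\right|\le C_s N^{-s/2}.$$
   Context: $\mathbb S^2$ is the unit sphere in $\mathbb R^3$ and $\sigma$ is the surface area measure on $\mathbb S^2$ normalized to be a probability measure. $L^2(\mathbb S^2)$ is the Hilbert space of real square integrable functions with $\langle f,g\rangle=\int_{\mathbb S^2}fg\,d\sigma$. For $\ell\ge0$ let $\mathcal H_\ell$ be the $(2\ell+1)$-dimensional space of spherical harmonics of degree $\ell$, i.e. eigenfunctions of the Laplace–Beltrami operator, $-\Delta Y=\lambda_\ell Y$ with $\lambda_\ell=\ell(\ell+1)$, and let $\{Y_{\ell,k}\}_{k=-\ell}^{\ell}$ be an orthonormal basis of $\mathcal H_\ell$. For $f\in L^2(\mathbb S^2)$ put $f_{\ell,k}=\langle f,Y_{\ell,k}\rangle$. The Sobolev space is $$\mathbb H^s(\mathbb S^2)=\Big\{f\in L^2(\mathbb S^2):\ \sum_{\ell=0}^\infty\sum_{k=-\ell}^{\ell}(1+\lambda_\ell)^s|f_{\ell,k}|^2<\infty\Big\},\qquad \|f\|_{\mathbb H^s(\mathbb S^2)}=\Big(\sum_{\ell=0}^\infty\sum_{k=-\ell}^{\ell}(1+\lambda_\ell)^s|f_{\ell,k}|^2\Big)^{1/2}.$$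 For $s>1$ this space embeds continuously in the continuous functions on $\mathbb S^2$, and $f(x)$ refers to the values of the continuous representative. Deterministic Diamond points $\mathcal P_N$, for an integer $N\ge4$: put $M=\lfloor\sqrt{N/4}\rfloor$, $r_j=4j$ for $1\le j<M$, $r_M=N-2\sum_{j=1}^{M-1}r_j$, and $r_{M+j}=r_{M-j}$ for $1\le j<M$ (so $r_1,\dots,r_{2M-1}$ are positive integers with sum $N$). For $1\le j\le 2M-1$ let $$h_j=1-\frac2N\sum_{k=1}^{j-1}r_k-\frac{r_j}{N},\qquad \rho_j=\sqrt{1-h_j^2}.$$ Then $$\mathcal P_N=\Big\{\big(\rho_j\cos\tfrac{2\pi\ell}{r_j},\ \rho_j\sin\tfrac{2\pi\ell}{r_j},\ h_j\big):\ 1\le j\le 2M-1,\ 0\le \ell\le r_j-1\Big\},$$ i.e. on the parallel at height $h_j$ one places $r_j$ equally spaced points, one of which has positive first coordinate and zero second coordinate. *)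

theory Defs
  imports "HOL-Analysis.Analysis"
begin

abbreviation S2 :: "(real^3) set" where
  "S2 \<equiv> sphere 0 1"

definition sphere_param :: "real \<times> real \<Rightarrow> real^3" where
  "sphere_param = (\<lambda>(\<theta>, \<phi>). vector [sin \<theta> * cos \<phi>, sin \<theta> * sin \<phi>, cos \<theta>])"

text \<open>
  The area element of the parametrization (norm of the cross product of the two partial
  derivatives) is \<open>sin \<theta>\<close>, and the total area is \<open>4\<pi>\<close>.
  The carrier of the measure is the sphere itself, so measurability and integrability of a
  function on \<^typ>\<open>real^3\<close> depend only on its values on the sphere.
\<close>
definition sphere_measure :: "(real^3) measure" where
  "sphere_measure =
     distr
       (density lborel
         (\<lambda>p. ennreal (indicator ({0..pi} \<times> {0..2 * pi}) p * (sin (fst p) / (4 * pi)))))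
       (restrict_space borel S2)
       sphere_param"

definition L2_sphere :: "(real^3 \<Rightarrow> real) set" where
  "L2_sphere = {f. f \<in> borel_measurable sphere_measure \<and> integrable sphere_measure (\<lambda>x. (f x)\<^sup>2)}"

definition L2_inner :: "(real^3 \<Rightarrow> real) \<Rightarrow> (real^3 \<Rightarrow> real) \<Rightarrow> real" where
  "L2_inner f g = (LINT x|sphere_measure. f x * g x)"

definition partial_deriv :: "3 \<Rightarrow> (real^3 \<Rightarrow> real) \<Rightarrow> real^3 \<Rightarrow> real" where
  "partial_deriv i F x = deriv (\<lambda>t. F (x + t *\<^sub>R axis i 1)) 0"

definition partially_differentiable_on :: "(real^3) set \<Rightarrow> 3 \<Rightarrow> (real^3 \<Rightarrow> real) \<Rightarrow> bool" where
  "partially_differentiable_on S i F \<longleftrightarrow>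
     (\<forall>x\<in>S. (\<lambda>t. F (x + t *\<^sub>R axis i 1)) differentiable (at 0))"

definition C2_on :: "(real^3) set \<Rightarrow> (real^3 \<Rightarrow> real) \<Rightarrow> bool" where
  "C2_on S F \<longleftrightarrow>
     continuous_on S F \<and>
     (\<forall>i. partially_differentiable_on S i F \<and> continuous_on S (partial_deriv i F)) \<and>
     (\<forall>i j. partially_differentiable_on S j (partial_deriv i F) \<and>
            continuous_on S (partial_deriv j (partial_deriv i F)))"

definition radial_extension :: "(real^3 \<Rightarrow> real) \<Rightarrow> real^3 \<Rightarrow> real" where
  "radial_extension f x = f (x /\<^sub>R norm x)"

definition C2_sphere :: "(real^3 \<Rightarrow> real) set" where
  "C2_sphere = {f. C2_on (- {0}) (radial_extension f)}"

text \<open>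
  On the unit sphere, the Laplace--Beltrami operator is the Euclidean Laplacian applied to
  the extension that is constant along rays.
\<close>
definition laplace_beltrami :: "(real^3 \<Rightarrow> real) \<Rightarrow> real^3 \<Rightarrow> real" where
  "laplace_beltrami f x =
     (\<Sum>i\<in>UNIV. partial_deriv i (partial_deriv i (radial_extension f)) x)"

definition eigenvalue :: "nat \<Rightarrow> real" where
  "eigenvalue l = real l * (real l + 1)"

text \<open>Values off the sphere are irrelevant, so equality of functions below means equality on
  the sphere.\<close>
definition spherical_harmonics :: "nat \<Rightarrow> (real^3 \<Rightarrow> real) set" where
  "spherical_harmonics l =
     {Y \<in> C2_sphere. \<forall>x\<in>S2. - laplace_beltrami Y x = eigenvalue l * Y x}"

definition harmonic_basis :: "(nat \<Rightarrow> int \<Rightarrow> real^3 \<Rightarrow> real) \<Rightarrow> bool" where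
  "harmonic_basis Y \<longleftrightarrow>
     (\<forall>l. (\<forall>k\<in>{- int l..int l}. Y l k \<in> spherical_harmonics l) \<and>
          (\<forall>j\<in>{- int l..int l}. \<forall>k\<in>{- int l..int l}.
             L2_inner (Y l j) (Y l k) = (if j = k then 1 else 0)) \<and>
          (\<forall>f\<in>spherical_harmonics l. \<exists>c. \<forall>x\<in>S2.
             f x = (\<Sum>k = - int l..int l. c k * Y l k x)))"

definition sobolev_term ::
    "(nat \<Rightarrow> int \<Rightarrow> real^3 \<Rightarrow> real) \<Rightarrow> real \<Rightarrow> (real^3 \<Rightarrow> real) \<Rightarrow> nat \<Rightarrow> real" where
  "sobolev_term Y s f l =
     (\<Sum>k = - int l..int l. (1 + eigenvalue l) powr s * \<bar>L2_inner f (Y l k)\<bar>\<^sup>2)"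

definition sobolev_space ::
    "(nat \<Rightarrow> int \<Rightarrow> real^3 \<Rightarrow> real) \<Rightarrow> real \<Rightarrow> (real^3 \<Rightarrow> real) set" where
  "sobolev_space Y s = {f \<in> L2_sphere. summable (sobolev_term Y s f)}"

definition sobolev_norm ::
    "(nat \<Rightarrow> int \<Rightarrow> real^3 \<Rightarrow> real) \<Rightarrow> real \<Rightarrow> (real^3 \<Rightarrow> real) \<Rightarrow> real" where
  "sobolev_norm Y s f = sqrt (\<Sum>l. sobolev_term Y s f l)"

text \<open>A continuous function on the sphere is determined by its almost-everywhere class, so the
  choice below is unique on the sphere whenever a continuous representative exists.\<close>
definition continuous_rep :: "(real^3 \<Rightarrow> real) \<Rightarrow> real^3 \<Rightarrow> real" where
  "continuous_rep f = (SOME g. continuous_on S2 g \<and> (AE x in sphere_measure. g x = f x))"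

definition diamond_M :: "nat \<Rightarrow> nat" where
  "diamond_M N = nat \<lfloor>sqrt (real N / 4)\<rfloor>"

text \<open>The last case is the symmetry \<open>r (M + j) = r (M - j)\<close>. The truncated subtraction in the
  middle case is exact because \<open>4 * M * (M - 1) < 4 * M\<^sup>2 \<le> N\<close> for \<open>M \<ge> 1\<close>.\<close>
definition diamond_r :: "nat \<Rightarrow> nat \<Rightarrow> nat" where
  "diamond_r N j =
     (let M = diamond_M N in
      if j < M then 4 * j
      else if j = M then N - 2 * (\<Sum>i = 1..<M. 4 * i)
      else 4 * (2 * M - j))"

definition diamond_h :: "nat \<Rightarrow> nat \<Rightarrow> real" where
  "diamond_h N j =
     1 - 2 / real N * (\<Sum>k = 1..<j. real (diamond_r N k)) - real (diamond_r N j) / real N"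

definition diamond_rho :: "nat \<Rightarrow> nat \<Rightarrow> real" where
  "diamond_rho N j = sqrt (1 - (diamond_h N j)\<^sup>2)"

definition diamond_point :: "nat \<Rightarrow> nat \<Rightarrow> nat \<Rightarrow> real^3" where
  "diamond_point N j l =
     vector [diamond_rho N j * cos (2 * pi * real l / real (diamond_r N j)),
             diamond_rho N j * sin (2 * pi * real l / real (diamond_r N j)),
             diamond_h N j]"

definition diamond :: "nat \<Rightarrow> (real^3) set" where
  "diamond N =
     {diamond_point N j l | j l. 1 \<le> j \<and> j \<le> 2 * diamond_M N - 1 \<and> l < diamond_r N j}"

end

theory Submission
  imports Defs "HOL-Computational_Algebra.Polynomial"
begin

text \<open>
  Everything is derived from the Poisson kernel
  \<open>K r t = (1 - r\<^sup>2) / (1 - 2 r t + r\<^sup>2) powr (3 / 2)\<close>, which is the sum of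
  \<open>(2 l + 1) r ^ l P l t\<close> over \<open>l\<close>. A maximum principle shows that the Poisson integral of an
  eigenfunction \<open>Y\<close> of degree \<open>l\<close> is \<open>r ^ l Y\<close>; comparing coefficients of \<open>r\<close> gives the addition
  theorem and the orthogonality of different degrees, and the approximate identity property gives
  completeness.

  By Cauchy--Schwarz, the square of the worst-case error is at most the sum of
  \<open>A l / (1 + eigenvalue l) powr s\<close> over \<open>l \<ge> 1\<close>, where \<open>A l\<close> is the sum over \<open>k\<close> of the squared
  means of \<open>Y l k\<close> over the points. Bessel's inequality for \<open>G r z\<close>, the mean of
  \<open>K r (x \<bullet> z) - 1\<close> over the points \<open>x\<close>, bounds the sum of \<open>r ^ (2 l) A l\<close> by \<open>B min(B, 2)\<close> with
  \<open>B = sup \<bar>G r\<bar>\<close>. Finally \<open>B \<le> D / (N (1 - r)\<^sup>2)\<close>: each Diamond point is the midpoint, in height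
  and longitude, of a cell of area \<open>1 / N\<close> and diameter of order \<open>N powr (- 1 / 2)\<close>, so that
  second-order Taylor expansion of the kernel on the cells applies if
  \<open>1 - r \<ge> N powr (- 1 / 2)\<close>, and smaller \<open>1 - r\<close> reduce to this case by monotonicity. Summing over
  the dyadic values \<open>1 - r = 1 / 2 ^ (j + 1)\<close> yields \<open>N powr (- s)\<close> because \<open>1 < s < 2\<close>.
\<close>

section \<open>Legendre polynomials and the Poisson kernel\<close>

text \<open>Spherical harmonics enter only as twice continuously differentiable eigenfunctions with
  a given basis, and the measure only through a parametrization. Rotation invariance of the measure
  and self-adjointness of the Laplacian are bypassed: an integral formula for zonal functions
  replaces the one, the maximum principle the other. The bound B min(B, 2) is sup norm times L1
  norm; the kernel is nonnegative with mean 1, so the L1 norm of \<open>G r\<close> is at most 2. On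
  degrees near 2 ^ j the energy is thus of order u min(u, 1) with u = 4 ^ j / N. Against the weight
  4 powr (- j s), the part u <= 1 converges because s < 2 and the part u > 1 because s > 1. In the
  Taylor step the first-order terms in height and longitude integrate to zero over a cell centred at
  its point, as area is uniform in both coordinates. What resists is the second-order change of the
  horizontal radius: on a parallel of radius \<rho> its coefficient is of order 1 / (N \<rho>), too
  large near the poles. A discrete cancellation, the vanishing sum of equally spaced directions,
  gives back the factor \<rho>. All numerical constants are generous.\<close>

fun legendre :: "nat \<Rightarrow> real poly" where
  "legendre 0 = 1"
| "legendre (Suc 0) = [:0, 1:]"
| "legendre (Suc (Suc n)) =
     smult ((2 * real n + 3) / (real n + 2)) ([:0, 1:] * legendre (Suc n))
     - smult ((real n + 1) / (real n + 2)) (legendre n)"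

abbreviation legendre' :: "nat \<Rightarrow> real poly" where
  "legendre' n \<equiv> pderiv (legendre n)"

lemma legendre_recurrence:
  "(real n + 2) * poly (legendre (Suc (Suc n))) t =
     (2 * real n + 3) * t * poly (legendre (Suc n)) t - (real n + 1) * poly (legendre n) t"
proof -
  have "real n + 2 \<noteq> 0" by linarith
  then show ?thesis by (simp add: right_diff_distrib)
qed

lemma legendre_deriv_recurrence:
  "(real n + 2) * poly (legendre' (Suc (Suc n))) t =
     (2 * real n + 3) * (poly (legendre (Suc n)) t + t * poly (legendre' (Suc n)) t)
     - (real n + 1) * poly (legendre' n) t"
proof -
  have cancel: "k * (a / k * u - b / k * v) = a * u - b * v" if "k \<noteq> 0" for k a b u v :: real
    using that by (simp add: right_diff_distrib)
  have "poly (legendre' (Suc (Suc n))) t = (2 * real n + 3) / (real n + 2) *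
      (poly (legendre (Suc n)) t + t * poly (legendre' (Suc n)) t)
      - (real n + 1) / (real n + 2) * poly (legendre' n) t"
    by (simp add: pderiv_diff pderiv_smult pderiv_mult pderiv_pCons add_divide_distrib distrib_left)
  then show ?thesis by (simp only: cancel)
qed

lemma legendre_at_one: "poly (legendre n) 1 = 1"
proof (induction n rule: legendre.induct)
  case (3 n)
  then have "(real n + 2) * poly (legendre (Suc (Suc n))) 1 = real n + 2"
    by (subst legendre_recurrence) simp
  moreover have "real n + 2 \<noteq> 0" by linarith
  ultimately show ?case by (simp only: mult_cancel_left2) blast
qed simp_all

lemma legendre_at_minus_one: "(poly (legendre n) (- 1))\<^sup>2 = 1"
proof -
  have "poly (legendre n) (- 1) = (- 1) ^ n"
  proof (induction n rule: legendre.induct)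
    case (3 n)
    then have "(real n + 2) * poly (legendre (Suc (Suc n))) (- 1) = (real n + 2) * (- 1) ^ Suc (Suc n)"
      by (subst legendre_recurrence) (simp add: algebra_simps)
    moreover have "real n + 2 \<noteq> 0" by linarith
    ultimately show ?case by (simp only: mult_cancel_left) blast
  qed simp_all
  then show ?thesis by (simp add: power_mult[symmetric] mult.commute)
qed

text \<open>The two identities need a joint induction: the first at \<open>Suc n\<close> comes from
  the differentiated recurrence and the second at \<open>n\<close>, while the second at
  \<open>Suc n\<close> uses both at \<open>n\<close>.\<close>

lemma legendre_deriv_identities:
  "poly (legendre' (Suc n)) t = t * poly (legendre' n) t + (real n + 1) * poly (legendre n) t \<and>
   t * poly (legendre' (Suc n)) t - poly (legendre' n) t = (real n + 1) * poly (legendre (Suc n)) t"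
proof (induction n)
  case 0
  then show ?case by (simp add: pderiv_pCons)
next
  case (Suc n)
  define a b c a' b' c' where d: "a = poly (legendre n) t" "b = poly (legendre (Suc n)) t"
     "c = poly (legendre (Suc (Suc n))) t" "a' = poly (legendre' n) t"
     "b' = poly (legendre' (Suc n)) t" "c' = poly (legendre' (Suc (Suc n))) t"
  define k where "k = real n + 2"
  have k: "k > 0" "real n = k - 2" by (auto simp: k_def)
  have 1: "b' = t * a' + (k - 1) * a" "t * b' - a' = (k - 1) * b"
    using conjunct1[OF Suc] conjunct2[OF Suc] by (simp_all only: d k) auto
  have 2: "k * c = (2 * k - 1) * t * b - (k - 1) * a"
    using legendre_recurrence[of n t] unfolding d k by (simp add: algebra_simps)
  have 3: "k * c' = (2 * k - 1) * (b + t * b') - (k - 1) * a'"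
    using legendre_deriv_recurrence[of n t] unfolding d k by (simp add: algebra_simps)
  have "k * c' = k * (t * b' + k * b)"
    using 1 3 by algebra
  then have c': "c' = t * b' + k * b" using k by simp
  have "t * c' - b' = k * c"
    using 1 2 c' by algebra
  then show ?case using c' by (simp add: d k)
qed

text \<open>Legendre's equation by elimination: the two identities relating degrees \<open>m\<close>
  and \<open>Suc m\<close>, together with their derivatives, are linear relations from which
  everything of degree \<open>m\<close> drops out.\<close>

lemma legendre_ode:
  "(1 - t\<^sup>2) * poly (pderiv (legendre' n)) t - 2 * t * poly (legendre' n) t
     + real n * (real n + 1) * poly (legendre n) t = 0"
proof (cases n)
  case 0
  then show ?thesis by simp
next
  case (Suc m)
  let ?X = "[:0, 1:] :: real poly"
  have e1: "legendre' (Suc m) = ?X * legendre' m + smult (real m + 1) (legendre m)"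
    by (intro poly_eq_poly_eq_iff[THEN iffD1] ext) (use legendre_deriv_identities[of m] in simp)
  have e2: "?X * legendre' (Suc m) - legendre' m = smult (real m + 1) (legendre (Suc m))"
    by (intro poly_eq_poly_eq_iff[THEN iffD1] ext)
      (use conjunct2[OF legendre_deriv_identities[of m]] in simp)
  have f1: "poly (pderiv (legendre' (Suc m))) t =
      poly (legendre' m) t + t * poly (pderiv (legendre' m)) t + (real m + 1) * poly (legendre' m) t"
    by (subst e1) (simp add: pderiv_add pderiv_mult pderiv_smult pderiv_pCons algebra_simps)
  have "pderiv (?X * legendre' (Suc m) - legendre' m) = pderiv (smult (real m + 1) (legendre (Suc m)))"
    by (simp only: e2)
  then have "poly (pderiv (?X * legendre' (Suc m) - legendre' m)) t = (real m + 1) * poly (legendre' (Suc m)) t"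
    by (simp add: pderiv_smult)
  then have f2: "poly (legendre' (Suc m)) t + t * poly (pderiv (legendre' (Suc m))) t - poly (pderiv (legendre' m)) t
       = (real m + 1) * poly (legendre' (Suc m)) t"
    by (simp add: pderiv_diff pderiv_mult pderiv_pCons algebra_simps)
  have g: "poly (legendre' (Suc m)) t = t * poly (legendre' m) t + (real m + 1) * poly (legendre m) t"
    "t * poly (legendre' (Suc m)) t - poly (legendre' m) t = (real m + 1) * poly (legendre (Suc m)) t"
    using legendre_deriv_identities[of m t] by auto
  define q where q: "q = real m" 
  have "(1 - t\<^sup>2) * poly (pderiv (legendre' (Suc m))) t - 2 * t * poly (legendre' (Suc m)) t
     + (q + 1) * (q + 2) * poly (legendre (Suc m)) t = 0"
    using f1 f2 g unfolding q[symmetric] by algebra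
  then show ?thesis by (simp add: Suc q algebra_simps)
qed

text \<open>Sonin's energy argument: with L = n (n + 1), the function L P^2 + (1 - t^2) P'^2 has
  derivative 2 t P'^2 by the differential equation. It therefore increases away from 0 and is
  largest at the endpoints, where it equals L.\<close>

lemma abs_legendre_le_1:
  assumes "\<bar>t\<bar> \<le> 1"
  shows "\<bar>poly (legendre n) t\<bar> \<le> 1"
proof (cases "n = 0")
  case False
  define L where "L = real n * (real n + 1)"
  have L: "L > 0" using False by (simp add: L_def)
  define h where "h = (\<lambda>t. L * (poly (legendre n) t)\<^sup>2 + (1 - t\<^sup>2) * (poly (legendre' n) t)\<^sup>2)"
  have h': "(h has_real_derivative 2 * x * (poly (legendre' n) x)\<^sup>2) (at x)" for x
  proof -
    define p p' p'' where p: "p = poly (legendre n) x" "p' = poly (legendre' n) x"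
      "p'' = poly (pderiv (legendre' n)) x"
    have ode: "(1 - x\<^sup>2) * p'' - 2 * x * p' + L * p = 0"
      using legendre_ode[of x n] by (simp add: p L_def)
    have "(h has_real_derivative L * (2 * p * p') + ((- (2 * x)) * p'\<^sup>2 + (1 - x\<^sup>2) * (2 * p' * p''))) (at x)"
      unfolding h_def p
      by (auto intro!: derivative_eq_intros poly_DERIV simp: power2_eq_square algebra_simps)
    moreover have "L * (2 * p * p') + ((- (2 * x)) * p'\<^sup>2 + (1 - x\<^sup>2) * (2 * p' * p'')) = 2 * x * p'\<^sup>2"
      using ode by algebra
    ultimately show ?thesis by (simp only: p)
  qed
  have "h t \<le> L"
  proof (cases "t \<ge> 0")
    case True
    have "h t \<le> h 1"
    proof (rule DERIV_nonneg_imp_nondecreasing[where f = h])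
      show "t \<le> 1" using assms by simp
      show "\<exists>y. (h has_real_derivative y) (at x) \<and> 0 \<le> y" if "t \<le> x" for x
        using that True by (intro exI[of _ "2 * x * (poly (legendre' n) x)\<^sup>2"] conjI h') auto
    qed
    then show ?thesis by (simp add: h_def legendre_at_one)
  next
    case False
    have "h t \<le> h (- 1)"
    proof (rule DERIV_nonpos_imp_nonincreasing[where f = h])
      show "- 1 \<le> t" using assms by simp
      show "\<exists>y. (h has_real_derivative y) (at x) \<and> y \<le> 0" if "x \<le> t" for x
        using that False
        by (intro exI[of _ "2 * x * (poly (legendre' n) x)\<^sup>2"] conjI h') (auto intro!: mult_nonpos_nonneg)
    qed
    then show ?thesis by (simp add: h_def legendre_at_minus_one)
  qed
  moreover have "L * (poly (legendre n) t)\<^sup>2 \<le> h t"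
    using assms by (simp add: h_def abs_square_le_1)
  ultimately have "(poly (legendre n) t)\<^sup>2 \<le> 1" using L by (smt (verit) mult_le_cancel_left2)
  then show ?thesis by (simp add: abs_square_le_1)
qed auto

text \<open>The exponent 3 / 2 is encoded as the cube of a square root, so that derivatives and
  estimates need only integer powers.\<close>

definition poisson :: "real \<Rightarrow> real \<Rightarrow> real" where
  "poisson r t = (1 - r\<^sup>2) / (sqrt (1 - 2 * r * t + r\<^sup>2)) ^ 3"

lemma poisson_denom_pos:
  fixes r t :: real
  assumes "\<bar>r\<bar> < 1" "\<bar>t\<bar> \<le> 1"
  shows "0 < 1 - 2 * r * t + r\<^sup>2"
proof -
  have "\<bar>r * t\<bar> \<le> \<bar>r\<bar> * 1" unfolding abs_mult by (rule mult_left_mono) (use assms in auto)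
  moreover have "(1 - \<bar>r\<bar>)\<^sup>2 > 0" using assms by simp
  ultimately show ?thesis
    by (auto simp: power2_eq_square algebra_simps abs_if split: if_splits)
qed

text \<open>The recurrence becomes a first-order differential equation for the generating function
  \<open>g\<close> of the Legendre polynomials; it forces \<open>g\<close> to be 1 / sqrt D, with D
  the quadratic under the root. The Poisson kernel is then 2 r g' + g, which is where the factor 2 n
  + 1 comes from.\<close>

lemma legendre_sums:
  fixes r t :: real
  assumes r: "\<bar>r\<bar> < 1" and t: "\<bar>t\<bar> \<le> 1"
  shows "(\<lambda>n. (2 * real n + 1) * r ^ n * poly (legendre n) t) sums poisson r t"
proof -
  define c where "c = (\<lambda>n. poly (legendre n) t)"
  define g where "g = (\<lambda>r. \<Sum>n. c n * r ^ n)"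
  have sm: "summable (\<lambda>n. c n * x ^ n)" if "\<bar>x\<bar> < 1" for x
  proof (rule summable_comparison_test')
    show "summable (\<lambda>n. \<bar>x\<bar> ^ n)" using that by (simp add: summable_geometric)
    show "norm (c n * x ^ n) \<le> \<bar>x\<bar> ^ n" if "n \<ge> 0" for n
      using abs_legendre_le_1[OF t, of n] by (simp add: c_def abs_mult power_abs mult_left_le_one_le)
  qed
  define g' where "g' = (\<lambda>r. \<Sum>n. diffs c n * r ^ n)"
  have sm': "summable (\<lambda>n. diffs c n * x ^ n)" if "\<bar>x\<bar> < 1" for x
    using termdiff_converges[of x 1 c] that sm by simp
  have dg: "(g has_real_derivative g' x) (at x)" if "\<bar>x\<bar> < 1" for x
    unfolding g_def g'_def
    by (rule termdiffs_strong'[of 1]) (use that sm in auto)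
  have ode: "(1 - 2 * x * t + x\<^sup>2) * g' x = (t - x) * g x" if x: "\<bar>x\<bar> < 1" for x
  proof -
    let ?d = "\<lambda>n. diffs c n * x ^ n" and ?c = "\<lambda>n. c n * x ^ n"
    have s: "?d sums g' x" "?c sums g x"
      using sm[OF x] sm'[OF x] by (simp_all add: summable_sums g_def g'_def)
    have 1: "(\<lambda>n. real n * c n * x ^ n) sums (x * g' x)"
    proof -
      have "(\<lambda>n. real (Suc n) * c (Suc n) * x ^ Suc n) sums (x * g' x)"
        using sums_mult[OF s(1), of x] by (simp add: diffs_def algebra_simps)
      then show ?thesis by (subst (asm) sums_Suc_iff) simp
    qed
    have c01: "c 0 = 1" "c (Suc 0) = t" by (simp_all add: c_def)
    have "(\<lambda>n. ?d (Suc n)) sums (g' x - t)"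
      using s(1) c01 by (subst sums_Suc_iff) (simp add: diffs_def)
    moreover have "(\<lambda>n. 2 * t * x * ?d n + t * ?c (Suc n) - x * (real n * c n * x ^ n) - x * ?c n)
        sums (2 * t * x * g' x + t * (g x - 1) - x * (x * g' x) - x * g x)"
    proof (intro sums_add sums_diff sums_mult s 1)
      show "(\<lambda>n. ?c (Suc n)) sums (g x - 1)"
        using s(2) c01 by (subst sums_Suc_iff) simp
    qed
    \<comment> \<open>The recurrence multiplied by \<open>x ^ Suc n\<close>. Its lowest-order
      instance, the coefficient of x ^ 0, is the term \<open>t\<close> split off above.\<close>
    moreover have "?d (Suc n) = 2 * t * x * ?d n + t * ?c (Suc n) - x * (real n * c n * x ^ n) - x * ?c n" for n
    proof -
      have "(real n + 2) * c (Suc (Suc n)) = (2 * real n + 3) * t * c (Suc n) - (real n + 1) * c n"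
        unfolding c_def by (rule legendre_recurrence)
      then have "(real n + 2) * c (Suc (Suc n)) * x ^ Suc n
          = ((2 * real n + 3) * t * c (Suc n) - (real n + 1) * c n) * x ^ Suc n"
        by simp
      then show ?thesis by (simp add: diffs_def algebra_simps)
    qed
    ultimately have "g' x - t = 2 * t * x * g' x + t * (g x - 1) - x * (x * g' x) - x * g x"
      by (simp add: sums_unique2)
    then show ?thesis by (simp add: algebra_simps power2_eq_square)
  qed
  define D where "D = (\<lambda>x. 1 - 2 * x * t + x\<^sup>2)"
  have Dpos: "D x > 0" if "\<bar>x\<bar> < 1" for x
    using poisson_denom_pos[OF that t] by (simp add: D_def)
  have "g r * sqrt (D r) = g 0 * sqrt (D 0)"
  proof (rule DERIV_isconst3[where f = "\<lambda>r. g r * sqrt (D r)"])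
    show "- 1 < (1::real)" "r \<in> {- 1<..<1}" "0 \<in> {- 1<..<(1::real)}" using r by auto
  next
    fix x :: real assume "x \<in> {- 1<..<1}"
    then have x: "\<bar>x\<bar> < 1" by auto
    have "((\<lambda>x. g x * sqrt (D x)) has_real_derivative
        g' x * sqrt (D x) + g x * ((2 * x - 2 * t) * (inverse (sqrt (D x)) / 2))) (at x)"
      unfolding D_def using dg[OF x] Dpos[OF x]
      by (auto intro!: derivative_eq_intros simp: D_def)
    moreover have "g' x * sqrt (D x) + g x * ((2 * x - 2 * t) * (inverse (sqrt (D x)) / 2)) = 0"
    proof -
      have "(g' x * sqrt (D x) + g x * ((2 * x - 2 * t) * (inverse (sqrt (D x)) / 2))) * sqrt (D x)
         = g' x * D x + g x * (x - t)"
        using Dpos[OF x] by (simp add: field_simps)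
      also have "\<dots> = 0" using ode[OF x] by (simp add: D_def algebra_simps)
      finally show ?thesis using Dpos[OF x] by simp
    qed
    ultimately show "((\<lambda>x. g x * sqrt (D x)) has_real_derivative 0) (at x)" by simp
  qed
  also have "\<dots> = 1" by (simp add: D_def g_def c_def powser_zero)
  finally have g: "g r = 1 / sqrt (D r)" using Dpos[OF r] by (simp add: field_simps)
  have "(\<lambda>n. real (Suc n) * c (Suc n) * r ^ Suc n) sums (r * g' r)"
    using sums_mult[OF summable_sums[OF sm'[OF r]], of r] by (simp add: diffs_def g'_def algebra_simps)
  then have "(\<lambda>n. real n * c n * r ^ n) sums (r * g' r)"
    by (subst (asm) sums_Suc_iff) simp
  from sums_add[OF sums_mult[OF this, of 2] summable_sums[OF sm[OF r]]]
  have "(\<lambda>n. (2 * real n + 1) * r ^ n * c n) sums (2 * (r * g' r) + g r)"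
    by (simp add: g_def algebra_simps)
  moreover have "2 * (r * g' r) + g r = poisson r t"
  proof -
    have "D r * (2 * (r * g' r) + g r) = (2 * r * (t - r) + D r) * g r"
      using ode[OF r] unfolding D_def by algebra
    also have "\<dots> = (1 - r\<^sup>2) / sqrt (D r)"
      by (simp add: g) (simp add: D_def power2_eq_square algebra_simps)
    finally have "2 * (r * g' r) + g r = (1 - r\<^sup>2) / (D r * sqrt (D r))"
      using Dpos[OF r] by (simp add: field_simps)
    also have "D r * sqrt (D r) = sqrt (D r) ^ 3"
      using Dpos[OF r] by (simp add: power3_eq_cube)
    finally show ?thesis by (simp add: poisson_def D_def)
  qed
  ultimately show ?thesis by (simp add: c_def)
qed

section \<open>Integration over the sphere\<close>

lemma norm_vector_3: "norm (vector [a, b, c] :: real^3) = sqrt (a\<^sup>2 + b\<^sup>2 + c\<^sup>2)"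
  by (simp add: norm_vec_def L2_set_def sum_3)

lemma inner_vector_3: "x \<bullet> (vector [a, b, c] :: real^3) = x $ 1 * a + x $ 2 * b + x $ 3 * c"
  by (simp add: inner_vec_def sum_3)

lemma sphere_param_eq:
  "sphere_param (\<theta>, \<phi>) = vector [sin \<theta> * cos \<phi>, sin \<theta> * sin \<phi>, cos \<theta>]"
  by (simp add: sphere_param_def)

lemma sphere_param_in_sphere: "sphere_param p \<in> S2"
proof (cases p)
  case (Pair \<theta> \<phi>)
  have "(sin \<theta> * cos \<phi>)\<^sup>2 + (sin \<theta> * sin \<phi>)\<^sup>2 + (cos \<theta>)\<^sup>2
    = (sin \<theta>)\<^sup>2 * ((cos \<phi>)\<^sup>2 + (sin \<phi>)\<^sup>2) + (cos \<theta>)\<^sup>2"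
    by (simp only: power_mult_distrib distrib_left)
  also have "\<dots> = 1" by simp
  finally show ?thesis by (simp add: Pair sphere_param_eq norm_vector_3)
qed

lemma sphere_param_surj:
  assumes "x \<in> S2"
  obtains \<theta> \<phi> where "0 \<le> \<theta>" "\<theta> \<le> pi" "x = sphere_param (\<theta>, \<phi>)"
proof -
  have n: "(x $ 1)\<^sup>2 + (x $ 2)\<^sup>2 + (x $ 3)\<^sup>2 = 1"
    using assms by (simp add: norm_vec_def L2_set_def sum_3)
  have "(x $ 3)\<^sup>2 \<le> 1" using n by (smt (verit) zero_le_power2)
  then have x3: "\<bar>x $ 3\<bar> \<le> 1" by (simp add: abs_square_le_1)
  define \<theta> where "\<theta> = arccos (x $ 3)"
  have \<theta>: "0 \<le> \<theta>" "\<theta> \<le> pi" "cos \<theta> = x $ 3"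
    using x3 by (auto simp: \<theta>_def arccos_lbound arccos_ubound cos_arccos_abs)
  have s2: "(sin \<theta>)\<^sup>2 = (x $ 1)\<^sup>2 + (x $ 2)\<^sup>2"
    using n by (simp add: sin_squared_eq \<theta>)
  obtain \<phi> where "x $ 1 = sin \<theta> * cos \<phi>" "x $ 2 = sin \<theta> * sin \<phi>"
  proof -
    obtain r a where ra: "x $ 1 = r * cos a" "x $ 2 = r * sin a"
      using polar_Ex[of "x $ 1" "x $ 2"] by blast
    have "r\<^sup>2 = (sin \<theta>)\<^sup>2"
      by (simp add: s2 ra power_mult_distrib distrib_left[symmetric])
    then consider "r = sin \<theta>" | "r = - sin \<theta>" by (auto simp: power2_eq_iff)
    then show thesis
    proof cases
      case 1
      show ?thesis by (rule that[of a]) (simp_all add: ra 1)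
    next
      case 2
      show ?thesis by (rule that[of "a + pi"]) (simp_all add: ra 2)
    qed
  qed
  then have "x = sphere_param (\<theta>, \<phi>)"
    by (simp add: sphere_param_eq vec_eq_iff forall_3 \<theta>)
  with \<theta> that show ?thesis by blast
qed

lemma continuous_on_vector_3:
  assumes "continuous_on A f" "continuous_on A g" "continuous_on A h"
  shows "continuous_on A (\<lambda>x. vector [f x, g x, h x] :: real^3)"
proof -
  have "(\<lambda>x. vector [f x, g x, h x] :: real^3) = (\<lambda>x. \<chi> i. if i = 1 then f x else if i = 2 then g x else h x)"
    by (rule ext) (simp add: vec_eq_iff forall_3)
  moreover have "continuous_on A (\<lambda>x. \<chi> i::3. if i = 1 then f x else if i = 2 then g x else h x)"
  proof (rule continuous_on_vec_lambda)
    fix i :: 3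
    show "continuous_on A (\<lambda>x. if i = 1 then f x else if i = 2 then g x else h x)"
      using assms by (cases "i = 1"; cases "i = 2") auto
  qed
  ultimately show ?thesis by (simp only:)
qed

lemma continuous_on_sphere_param: "continuous_on A sphere_param"
  unfolding sphere_param_def case_prod_unfold
  by (intro continuous_on_vector_3 continuous_intros)

lemma sphere_param_measurable [measurable]:
  "sphere_param \<in> borel \<rightarrow>\<^sub>M restrict_space borel S2"
proof (rule measurable_restrict_space2)
  show "sphere_param \<in> space borel \<rightarrow> S2" using sphere_param_in_sphere by auto
  show "sphere_param \<in> borel_measurable borel"
    by (rule borel_measurable_continuous_onI) (rule continuous_on_sphere_param)
qed

abbreviation \<sigma> :: "(real^3) measure" where "\<sigma> \<equiv> sphere_measure"

abbreviation sphere_box :: "(real \<times> real) set" where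
  "sphere_box \<equiv> {0..pi} \<times> {0..2 * pi}"

abbreviation sphere_density :: "real \<times> real \<Rightarrow> real" where
  "sphere_density p \<equiv> indicator sphere_box p * (sin (fst p) / (4 * pi))"

lemma sphere_density_nonneg: "sphere_density p \<ge> 0"
  by (auto simp: indicator_def sin_ge_zero)

lemma sphere_density_measurable [measurable]: "sphere_density \<in> borel_measurable borel"
proof -
  have "sphere_box \<in> sets borel" by (intro borel_closed closed_Times) auto
  then show ?thesis
    by (intro borel_measurable_times borel_measurable_indicator borel_measurable_continuous_onI
        continuous_intros) auto
qed

lemma sets_sphere_measure [measurable_cong]: "sets \<sigma> = sets (restrict_space borel S2)"
  by (simp add: sphere_measure_def)

lemma space_sphere_measure [simp]: "space \<sigma> = S2"
  by (simp add: sphere_measure_def space_restrict_space)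

lemma borel_measurable_sphere_continuous:
  "continuous_on S2 f \<Longrightarrow> f \<in> borel_measurable \<sigma>"
  by (simp add: measurable_cong_sets[OF sets_sphere_measure refl] borel_measurable_continuous_on_restrict)

lemma sphere_integral_eq_lborel:
  assumes "f \<in> borel_measurable \<sigma>"
  shows "(LINT x|\<sigma>. f x) = (LINT p|lborel. sphere_density p * f (sphere_param p))"
proof -
  have [measurable]: "f \<in> borel_measurable (restrict_space borel S2)"
    using assms by (simp add: measurable_cong_sets[OF sets_sphere_measure refl])
  have m: "(\<lambda>p. f (sphere_param p)) \<in> borel_measurable lborel"
    by measurable
  show ?thesis
    unfolding sphere_measure_def
    by (subst integral_distr)
      (use m sphere_density_measurable in \<open>auto simp: integral_density sphere_density_nonneg simp del: times_divide_eq_right\<close>)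
qed

lemma sphere_integral_continuous:
  assumes "continuous_on S2 f"
  shows "(LINT x|\<sigma>. f x) =
     integral {0..pi} (\<lambda>\<theta>. integral {0..2 * pi} (\<lambda>\<phi>. sin \<theta> / (4 * pi) * f (sphere_param (\<theta>, \<phi>))))"
proof -
  let ?g = "\<lambda>p. sin (fst p) / (4 * pi) * f (sphere_param p)"
  have cf: "continuous_on UNIV (\<lambda>p. f (sphere_param p))"
    by (rule continuous_on_compose2[OF assms continuous_on_sphere_param]) (use sphere_param_in_sphere in auto)
  then have cg: "continuous_on A ?g" for A
    by (intro continuous_intros) (auto intro: continuous_on_subset)
  have box: "sphere_box = cbox (0, 0) (pi, 2 * pi)"
    by (simp add: cbox_Pair_eq)
  have "(LINT x|\<sigma>. f x) = (LINT p|lborel. sphere_density p * f (sphere_param p))"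
    by (rule sphere_integral_eq_lborel) (rule borel_measurable_sphere_continuous[OF assms])
  also have "\<dots> = (LINT p:cbox (0, 0) (pi, 2 * pi)|lborel. ?g p)"
    unfolding set_lebesgue_integral_def box by (intro Bochner_Integration.integral_cong) (auto simp: indicator_def)
  also have "\<dots> = integral (cbox (0, 0) (pi, 2 * pi)) ?g"
    by (intro set_borel_integral_eq_integral(2)) (simp only: set_integrable_def, intro borel_integrable_compact cg, simp)
  also have "\<dots> = integral (cbox 0 pi) (\<lambda>\<theta>. integral (cbox 0 (2 * pi)) (\<lambda>\<phi>. ?g (\<theta>, \<phi>)))"
    by (rule integral_prod_continuous) (rule cg)
  finally show ?thesis by simp
qed

lemma emeasure_sphere_measure: "emeasure \<sigma> S2 = 1"
proof -
  have cg: "continuous_on A (\<lambda>p. sin (fst p) / (4 * pi))" for A :: "(real \<times> real) set"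
    by (intro continuous_intros) auto
  have box: "sphere_box = cbox (0, 0) (pi, 2 * pi)"
    by (simp add: cbox_Pair_eq)
  have i: "set_integrable lborel (cbox (0, 0) (pi, 2 * pi)) (\<lambda>p. sin (fst p) / (4 * pi))"
    unfolding set_integrable_def by (intro borel_integrable_compact cg compact_cbox)
  have si: "integral {0..pi} sin = 2"
  proof -
    have "(sin has_integral (- cos pi - - cos 0)) {0..pi}"
      by (rule fundamental_theorem_of_calculus)
        (auto intro!: derivative_eq_intros simp: has_real_derivative_iff_has_vector_derivative[symmetric])
    then show ?thesis by (simp add: integral_unique)
  qed
  have "emeasure \<sigma> (space \<sigma>)
      = emeasure (density lborel (\<lambda>p. ennreal (sphere_density p))) (sphere_param -` S2)"
    unfolding sphere_measure_def by (subst emeasure_distr) (auto simp: space_restrict_space sets_restrict_space)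
  also have "sphere_param -` S2 = UNIV" using sphere_param_in_sphere by auto
  also have "emeasure (density lborel (\<lambda>p. ennreal (sphere_density p))) UNIV = (\<integral>\<^sup>+p. ennreal (sphere_density p) \<partial>lborel)"
    using sphere_density_measurable
    by (subst emeasure_density) (auto simp del: times_divide_eq_right)
  also have "\<dots> = ennreal (LINT p|lborel. sphere_density p)"
    using i sphere_density_nonneg
    by (intro nn_integral_eq_integral) (auto simp: set_integrable_def box simp del: times_divide_eq_right)
  also have "(LINT p|lborel. sphere_density p) = (LINT p:cbox (0, 0) (pi, 2 * pi)|lborel. sin (fst p) / (4 * pi))"
    unfolding set_lebesgue_integral_def box by simp
  also have "\<dots> = integral (cbox (0, 0) (pi, 2 * pi)) (\<lambda>p. sin (fst p) / (4 * pi))"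
    by (rule set_borel_integral_eq_integral(2)[OF i])
  also have "\<dots> = integral (cbox 0 pi) (\<lambda>\<theta>. integral (cbox 0 (2 * pi)) (\<lambda>\<phi>. sin (fst (\<theta>, \<phi>)) / (4 * pi)))"
    by (rule integral_prod_continuous) (rule cg)
  also have "\<dots> = 1"
    using si by (simp add: integral_divide)
  finally show ?thesis by simp
qed

interpretation sphere: finite_measure \<sigma>
  by standard (simp add: emeasure_sphere_measure)

lemma sphere_integral_const [simp]: "(LINT x|\<sigma>. c) = (c :: real)"
  by (simp add: measure_def emeasure_sphere_measure)

lemma sphere_integrable_continuous:
  fixes f :: "real^3 \<Rightarrow> real"
  assumes "continuous_on S2 f"
  shows "integrable \<sigma> f"
proof -
  have "compact (f ` S2)" by (rule compact_continuous_image[OF assms]) simp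
  then obtain B where "\<forall>x\<in>S2. norm (f x) \<le> B"
    by (metis bounded_pos compact_imp_bounded imageI)
  then have "AE x in \<sigma>. norm (f x) \<le> B" by (intro AE_I2) simp
  then show ?thesis
    by (rule sphere.integrable_const_bound) (rule borel_measurable_sphere_continuous[OF assms])
qed

section \<open>Integrals of zonal functions and the total mass of the Poisson kernel\<close>

lemma integral_periodic_shift:
  fixes f :: "real \<Rightarrow> real"
  assumes cf: "continuous_on UNIV f" and per: "\<And>x. f (x + c) = f x" and c: "0 \<le> c"
  shows "integral {a..a + c} f = integral {0..c} f"
proof -
  define A B where "A = - \<bar>a\<bar> - 1" and "B = \<bar>a\<bar> + c + 1"
  define g where "g = (\<lambda>u. integral {A..u} f)"
  have dg: "(g has_real_derivative f u) (at u)" if "u \<in> {A<..<B}" for u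
  proof -
    have "(g has_vector_derivative f u) (at u within {A..B})"
      unfolding g_def
      by (rule integral_has_vector_derivative) (use that cf in \<open>auto intro: continuous_on_subset\<close>)
    then show ?thesis
      using that at_within_interior[of u "{A..B}"]
      by (simp add: has_real_derivative_iff_has_vector_derivative)
  qed
  have I: "integral {u..u + c} f = g (u + c) - g u" if "u \<in> {A..B - c}" for u
  proof -
    have "integral {A..u} f + integral {u..u + c} f = integral {A..u + c} f"
      using that c cf
      by (intro Henstock_Kurzweil_Integration.integral_combine integrable_continuous_real)
        (auto intro: continuous_on_subset)
    then show ?thesis by (simp add: g_def)
  qed
  have "g (a + c) - g a = g (0 + c) - g 0"
  proof (rule DERIV_isconst3[where f = "\<lambda>u. g (u + c) - g u" and a = A and b = "B - c"])
    fix x assume x: "x \<in> {A<..<B - c}"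
    have "((\<lambda>u. g (u + c)) has_real_derivative f (x + c)) (at x)"
      using dg[of "x + c"] x c by (simp add: DERIV_shift)
    from DERIV_diff[OF this dg[of x]] show "((\<lambda>u. g (u + c) - g u) has_real_derivative 0) (at x)"
      using x c per by simp
  qed (use c in \<open>auto simp: A_def B_def\<close>)
  moreover have "a \<in> {A..B - c}" "0 \<in> {A..B - c}" using c by (auto simp: A_def B_def)
  ultimately show ?thesis using I[of a] I[of 0] by simp
qed

text \<open>Stands in for rotation invariance. The integral depends only on the colatitude \<alpha>
  of \<open>x\<close>, and its derivative in \<alpha> is the integral of a divergence in (\<theta>,
  \<phi>) without boundary contribution. Hence \<open>x\<close> may be moved to the north pole,
  where the integral is one-dimensional.\<close>

lemma sphere_integral_zonal:
  fixes p p' q :: "real \<Rightarrow> real"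
  assumes dp: "\<And>t. \<bar>t\<bar> \<le> 1 \<Longrightarrow> (p has_real_derivative p' t) (at t)"
    and cp': "continuous_on {- 1..1} p'"
    and dq: "\<And>t. \<bar>t\<bar> \<le> 1 \<Longrightarrow> (q has_real_derivative p t) (at t)"
    and x: "x \<in> S2"
  shows "(LINT y|\<sigma>. p (x \<bullet> y)) = (q 1 - q (- 1)) / 2"
proof -
  define T where "T = (\<lambda>\<alpha> \<theta> \<phi> :: real. sin \<alpha> * (sin \<theta> * cos \<phi>) + cos \<alpha> * cos \<theta>)"
  have T_inner: "T \<alpha> \<theta> (\<phi> - \<beta>) = sphere_param (\<alpha>, \<beta>) \<bullet> sphere_param (\<theta>, \<phi>)" for \<alpha> \<beta> \<theta> \<phi>
    by (simp add: T_def sphere_param_eq inner_vector_3 cos_diff algebra_simps)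
  have T1: "\<bar>T \<alpha> \<theta> \<phi>\<bar> \<le> 1" for \<alpha> \<theta> \<phi>
    using T_inner[of \<alpha> \<theta> \<phi> 0] Cauchy_Schwarz_ineq2[of "sphere_param (\<alpha>, 0)" "sphere_param (\<theta>, \<phi>)"]
      sphere_param_in_sphere[of "(\<alpha>, 0)"] sphere_param_in_sphere[of "(\<theta>, \<phi>)"] by simp
  have cp: "continuous_on {- 1..1} p"
    using dp by (intro DERIV_continuous_on[of _ p p']) (auto intro: has_field_derivative_at_within)
  have cpT: "continuous_on A (\<lambda>z. p (T (f z) (g z) (h z)))"
    if "continuous_on A f" "continuous_on A g" "continuous_on A h"
    for A :: "'a::t2_space set" and f g h
  proof (rule continuous_on_compose2[OF cp])
    show "continuous_on A (\<lambda>z. T (f z) (g z) (h z))"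
      unfolding T_def by (intro continuous_intros that)
    show "(\<lambda>z. T (f z) (g z) (h z)) ` A \<subseteq> {- 1..1}" using T1 by (auto simp: abs_le_iff minus_le_iff)
  qed
  have cp'T: "continuous_on A (\<lambda>z. p' (T (f z) (g z) (h z)))"
    if "continuous_on A f" "continuous_on A g" "continuous_on A h"
    for A :: "'a::t2_space set" and f g h
  proof (rule continuous_on_compose2[OF cp'])
    show "continuous_on A (\<lambda>z. T (f z) (g z) (h z))"
      unfolding T_def by (intro continuous_intros that)
    show "(\<lambda>z. T (f z) (g z) (h z)) ` A \<subseteq> {- 1..1}" using T1 by (auto simp: abs_le_iff minus_le_iff)
  qed
  let ?B = "cbox (0, 0) (pi, 2 * pi) :: (real \<times> real) set"
  define J where "J = (\<lambda>\<alpha>. integral ?B (\<lambda>z. sin (fst z) * p (T \<alpha> (fst z) (snd z))))"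
  define T' where "T' = (\<lambda>\<alpha> \<theta> \<phi> :: real. cos \<alpha> * (sin \<theta> * cos \<phi>) - sin \<alpha> * cos \<theta>)"
  define G1 where "G1 = (\<lambda>\<alpha> \<theta> \<phi>. cos \<phi> * (cos \<theta> * p (T \<alpha> \<theta> \<phi>)
      + sin \<theta> * (p' (T \<alpha> \<theta> \<phi>) * (sin \<alpha> * (cos \<theta> * cos \<phi>) - cos \<alpha> * sin \<theta>))))"
  define G2 where "G2 = (\<lambda>\<alpha> \<theta> \<phi>. cos \<theta> * (cos \<phi> * p (T \<alpha> \<theta> \<phi>)
      + sin \<phi> * (p' (T \<alpha> \<theta> \<phi>) * (- (sin \<alpha> * (sin \<theta> * sin \<phi>))))))"
  \<comment> \<open>The \<alpha>-derivative of the integrand is an exact divergence.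
    \<open>G1\<close> is a \<theta>-derivative whose primitive carries the factor sin \<theta>, and
    \<open>G2\<close> is a \<phi>-derivative whose primitive carries the factor sin \<phi>, so both
    primitives vanish at the ends of their intervals.\<close>
  have key: "sin \<theta> * (p' (T \<alpha> \<theta> \<phi>) * T' \<alpha> \<theta> \<phi>) = G2 \<alpha> \<theta> \<phi> - G1 \<alpha> \<theta> \<phi>" for \<alpha> \<theta> \<phi>
  proof -
    have "(sin \<phi>)\<^sup>2 = 1 - (cos \<phi>)\<^sup>2" by (simp add: sin_squared_eq)
    then show ?thesis unfolding G1_def G2_def T'_def by algebra
  qed
  have cG1: "continuous_on A (\<lambda>z. G1 \<alpha> (f z) (g z))" and cG2: "continuous_on A (\<lambda>z. G2 \<alpha> (f z) (g z))"
    if "continuous_on A f" "continuous_on A g" for A :: "'a::t2_space set" and f g \<alpha>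
    unfolding G1_def G2_def by (intro continuous_intros cpT cp'T that)+
  have dG1: "((\<lambda>\<theta>. cos \<phi> * (sin \<theta> * p (T \<alpha> \<theta> \<phi>))) has_real_derivative G1 \<alpha> \<theta> \<phi>) (at \<theta>)" for \<alpha> \<theta> \<phi>
  proof -
    have "((\<lambda>\<theta>. T \<alpha> \<theta> \<phi>) has_real_derivative sin \<alpha> * (cos \<theta> * cos \<phi>) - cos \<alpha> * sin \<theta>) (at \<theta>)"
      unfolding T_def by (auto intro!: derivative_eq_intros)
    from DERIV_chain2[OF dp[OF T1] this] show ?thesis
      unfolding G1_def by (auto intro!: derivative_eq_intros simp: algebra_simps)
  qed
  have dG2: "((\<lambda>\<phi>. cos \<theta> * (sin \<phi> * p (T \<alpha> \<theta> \<phi>))) has_real_derivative G2 \<alpha> \<theta> \<phi>) (at \<phi>)" for \<alpha> \<theta> \<phi>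
  proof -
    have "((\<lambda>\<phi>. T \<alpha> \<theta> \<phi>) has_real_derivative - (sin \<alpha> * (sin \<theta> * sin \<phi>))) (at \<phi>)"
      unfolding T_def by (auto intro!: derivative_eq_intros)
    from DERIV_chain2[OF dp[OF T1] this] show ?thesis
      unfolding G2_def by (auto intro!: derivative_eq_intros simp: algebra_simps)
  qed
  have iG1: "integral ?B (\<lambda>z. G1 \<alpha> (fst z) (snd z)) = 0" for \<alpha>
  proof -
    have "integral {0..pi} (\<lambda>\<theta>. G1 \<alpha> \<theta> \<phi>) = 0" for \<phi>
    proof -
      have "((\<lambda>\<theta>. G1 \<alpha> \<theta> \<phi>) has_integral (cos \<phi> * (sin pi * p (T \<alpha> pi \<phi>)) - cos \<phi> * (sin 0 * p (T \<alpha> 0 \<phi>)))) {0..pi}"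
        by (rule fundamental_theorem_of_calculus)
          (use dG1 in \<open>auto simp: has_real_derivative_iff_has_vector_derivative[symmetric] intro: has_field_derivative_at_within\<close>)
      then show ?thesis by (simp add: integral_unique)
    qed
    moreover have "integral ?B (\<lambda>z. G1 \<alpha> (fst z) (snd z)) = integral (cbox 0 (2 * pi)) (\<lambda>\<phi>. integral (cbox 0 pi) (\<lambda>\<theta>. G1 \<alpha> \<theta> \<phi>))"
    proof -
      have "integral ?B (\<lambda>z. G1 \<alpha> (fst z) (snd z)) = integral (cbox 0 pi) (\<lambda>\<theta>. integral (cbox 0 (2 * pi)) (\<lambda>\<phi>. G1 \<alpha> \<theta> \<phi>))"
        by (subst integral_prod_continuous) (auto intro!: cG1 continuous_intros)
      also have "\<dots> = integral (cbox 0 (2 * pi)) (\<lambda>\<phi>. integral (cbox 0 pi) (\<lambda>\<theta>. G1 \<alpha> \<theta> \<phi>))"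
        by (rule integral_swap_continuous) (auto simp: case_prod_unfold intro!: cG1 continuous_intros)
      finally show ?thesis .
    qed
    ultimately show ?thesis by simp
  qed
  have iG2: "integral ?B (\<lambda>z. G2 \<alpha> (fst z) (snd z)) = 0" for \<alpha>
  proof -
    have "integral {0..2 * pi} (\<lambda>\<phi>. G2 \<alpha> \<theta> \<phi>) = 0" for \<theta>
    proof -
      have "((\<lambda>\<phi>. G2 \<alpha> \<theta> \<phi>) has_integral (cos \<theta> * (sin (2 * pi) * p (T \<alpha> \<theta> (2 * pi))) - cos \<theta> * (sin 0 * p (T \<alpha> \<theta> 0)))) {0..2 * pi}"
        by (rule fundamental_theorem_of_calculus)
          (use dG2 in \<open>auto simp: has_real_derivative_iff_has_vector_derivative[symmetric] intro: has_field_derivative_at_within\<close>)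
      then show ?thesis by (simp add: integral_unique)
    qed
    moreover have "integral ?B (\<lambda>z. G2 \<alpha> (fst z) (snd z)) = integral (cbox 0 pi) (\<lambda>\<theta>. integral (cbox 0 (2 * pi)) (\<lambda>\<phi>. G2 \<alpha> \<theta> \<phi>))"
      by (subst integral_prod_continuous) (auto intro!: cG2 continuous_intros)
    ultimately show ?thesis by simp
  qed
  have dJ: "(J has_real_derivative 0) (at \<alpha>)" for \<alpha>
  proof -
    have "(J has_real_derivative integral ?B (\<lambda>z. sin (fst z) * (p' (T \<alpha> (fst z) (snd z)) * T' \<alpha> (fst z) (snd z)))) (at \<alpha> within UNIV)"
      unfolding J_def
    proof (rule leibniz_rule_field_derivative)
      fix \<alpha> :: real and z :: "real \<times> real"
      have "((\<lambda>\<alpha>. T \<alpha> (fst z) (snd z)) has_real_derivative T' \<alpha> (fst z) (snd z)) (at \<alpha>)"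
        unfolding T_def T'_def by (auto intro!: derivative_eq_intros)
      from DERIV_cmult[OF DERIV_chain2[OF dp[OF T1] this]]
      show "((\<lambda>\<alpha>. sin (fst z) * p (T \<alpha> (fst z) (snd z))) has_real_derivative
          sin (fst z) * (p' (T \<alpha> (fst z) (snd z)) * T' \<alpha> (fst z) (snd z))) (at \<alpha> within UNIV)"
        by simp
    next
      fix \<alpha> :: real
      show "(\<lambda>z. sin (fst z) * p (T \<alpha> (fst z) (snd z))) integrable_on ?B"
        by (intro integrable_continuous continuous_intros cpT)
    next
      show "continuous_on (UNIV \<times> ?B) (\<lambda>(\<alpha>, z). sin (fst z) * (p' (T \<alpha> (fst z) (snd z)) * T' \<alpha> (fst z) (snd z)))"
        unfolding T'_def case_prod_unfold by (intro continuous_intros cp'T)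
    qed auto
    also have "integral ?B (\<lambda>z. sin (fst z) * (p' (T \<alpha> (fst z) (snd z)) * T' \<alpha> (fst z) (snd z)))
        = integral ?B (\<lambda>z. G2 \<alpha> (fst z) (snd z)) - integral ?B (\<lambda>z. G1 \<alpha> (fst z) (snd z))"
      unfolding key by (intro integral_diff integrable_continuous cG1 cG2 continuous_intros)
    finally show ?thesis by (simp add: iG1 iG2)
  qed
  have J0: "J \<alpha> = 2 * pi * (q 1 - q (- 1))" for \<alpha>
  proof -
    \<comment> \<open>For \<alpha> = 0 the inner product is cos \<theta>, so the longitude
      integrates to 2 pi and the substitution t = cos \<theta> finishes.\<close>
    have "J \<alpha> = J 0" using dJ by (intro DERIV_isconst_all) auto
    also have "J 0 = integral (cbox 0 pi) (\<lambda>\<theta>. integral (cbox 0 (2 * pi)) (\<lambda>\<phi>. sin \<theta> * p (T 0 \<theta> \<phi>)))"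
      unfolding J_def by (subst integral_prod_continuous) (auto intro!: cpT continuous_intros)
    also have "\<dots> = integral {0..pi} (\<lambda>\<theta>. 2 * pi * (sin \<theta> * p (cos \<theta>)))"
      by (simp add: T_def mult_ac)
    also have "\<dots> = 2 * pi * integral {0..pi} (\<lambda>\<theta>. sin \<theta> * p (cos \<theta>))"
      by (rule integral_mult_right)
    also have "integral {0..pi} (\<lambda>\<theta>. sin \<theta> * p (cos \<theta>)) = - q (cos pi) - - q (cos 0)"
    proof (rule integral_unique, rule fundamental_theorem_of_calculus)
      fix \<theta> :: real
      have "((\<lambda>\<theta>. - q (cos \<theta>)) has_real_derivative - (p (cos \<theta>) * - sin \<theta>)) (at \<theta>)"
        by (intro DERIV_minus DERIV_chain2[OF dq DERIV_cos]) simp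
      then show "((\<lambda>\<theta>. - q (cos \<theta>)) has_vector_derivative sin \<theta> * p (cos \<theta>)) (at \<theta> within {0..pi})"
        by (simp add: has_real_derivative_iff_has_vector_derivative has_vector_derivative_at_within mult.commute)
    qed simp
    finally show ?thesis by simp
  qed
  obtain \<alpha> \<beta> where x_eq: "x = sphere_param (\<alpha>, \<beta>)"
    using sphere_param_surj[OF x] by blast
  have "(LINT y|\<sigma>. p (x \<bullet> y)) =
      integral {0..pi} (\<lambda>\<theta>. integral {0..2 * pi} (\<lambda>\<phi>. sin \<theta> / (4 * pi) * p (x \<bullet> sphere_param (\<theta>, \<phi>))))"
  proof (rule sphere_integral_continuous)
    have "\<bar>x \<bullet> y\<bar> \<le> 1" if "y \<in> S2" for y
      using Cauchy_Schwarz_ineq2[of x y] x that by simp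
    then show "continuous_on S2 (\<lambda>y. p (x \<bullet> y))"
      by (intro continuous_on_compose2[OF cp] continuous_intros) (auto simp: abs_le_iff minus_le_iff)
  qed
  also have "\<dots> = integral {0..pi} (\<lambda>\<theta>. integral {0..2 * pi} (\<lambda>\<phi>. sin \<theta> / (4 * pi) * p (T \<alpha> \<theta> \<phi>)))"
  proof (rule integral_cong)
    fix \<theta> :: real
    let ?f = "\<lambda>\<phi>. sin \<theta> / (4 * pi) * p (T \<alpha> \<theta> \<phi>)"
    have c: "continuous_on UNIV ?f" by (intro continuous_intros cpT) auto
    have "integral {0..2 * pi} (\<lambda>\<phi>. sin \<theta> / (4 * pi) * p (x \<bullet> sphere_param (\<theta>, \<phi>))) = integral {0..2 * pi} (\<lambda>\<phi>. ?f (\<phi> - \<beta>))"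
      by (simp add: x_eq T_inner)
    also have "\<dots> = integral {- \<beta>..- \<beta> + 2 * pi} ?f"
      using integral_shift_Icc_real[of 0 "2 * pi" ?f "- \<beta>"] by (simp add: o_def)
    also have "\<dots> = integral {0..2 * pi} ?f"
      by (rule integral_periodic_shift[OF c]) (auto simp: T_def)
    finally show "integral {0..2 * pi} (\<lambda>\<phi>. sin \<theta> / (4 * pi) * p (x \<bullet> sphere_param (\<theta>, \<phi>))) = integral {0..2 * pi} ?f" .
  qed
  also have "\<dots> = integral {0..pi} (\<lambda>\<theta>. integral {0..2 * pi} (\<lambda>\<phi>. sin \<theta> * p (T \<alpha> \<theta> \<phi>)) / (4 * pi))"
    by (simp add: integral_divide)
  also have "\<dots> = J \<alpha> / (4 * pi)"
    unfolding J_def by (subst integral_prod_continuous) (auto intro!: cpT continuous_intros simp: integral_divide)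
  finally show ?thesis by (simp add: J0)
qed

lemma poisson_has_antiderivative:
  fixes r t :: real
  assumes "0 < r" "r < 1" "\<bar>t\<bar> \<le> 1"
  shows "((\<lambda>t. (1 - r\<^sup>2) / r / sqrt (1 - 2 * r * t + r\<^sup>2)) has_real_derivative poisson r t) (at t)"
proof -
  let ?D = "\<lambda>t. 1 - 2 * r * t + r\<^sup>2"
  have D: "?D t > 0" using poisson_denom_pos[of r t] assms by simp
  have "((\<lambda>t. (1 - r\<^sup>2) / r / sqrt (?D t)) has_real_derivative
      - ((1 - r\<^sup>2) / r * (- (2 * r) * (inverse (sqrt (?D t)) / 2))) / (sqrt (?D t) * sqrt (?D t))) (at t)"
    using D by (auto intro!: derivative_eq_intros)
  moreover have "- ((1 - r\<^sup>2) / r * (- (2 * r) * (inverse v / 2))) / (v * v) = (1 - r\<^sup>2) / v ^ 3"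
    if "v > 0" for v
    using assms that by (simp add: power3_eq_cube field_simps)
  from this[of "sqrt (?D t)"] have "- ((1 - r\<^sup>2) / r * (- (2 * r) * (inverse (sqrt (?D t)) / 2))) / (sqrt (?D t) * sqrt (?D t)) = poisson r t"
    unfolding poisson_def using D by simp
  ultimately show ?thesis by simp
qed

lemma poisson_has_derivative:
  fixes r t :: real
  assumes "\<bar>r\<bar> < 1" "\<bar>t\<bar> \<le> 1"
  shows "(poisson r has_real_derivative 3 * r * poisson r t / (1 - 2 * r * t + r\<^sup>2)) (at t)"
proof -
  let ?D = "\<lambda>t. 1 - 2 * r * t + r\<^sup>2"
  have D: "?D t > 0" using poisson_denom_pos[of r t] assms by simp
  define s where "s = sqrt (?D t)"
  have s: "s > 0" "?D t = s\<^sup>2" using D by (auto simp: s_def)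
  have "((\<lambda>t. (1 - r\<^sup>2) / (sqrt (?D t)) ^ 3) has_real_derivative
      - ((1 - r\<^sup>2) * (3 * s\<^sup>2 * (- (2 * r) * (inverse s / 2)))) / (s ^ 3 * s ^ 3)) (at t)"
  proof -
    have "((\<lambda>t. sqrt (?D t)) has_real_derivative (- (2 * r) * (inverse s / 2))) (at t)"
      unfolding s_def using D by (auto intro!: derivative_eq_intros)
    from DERIV_power[OF this, of 3]
    have d: "((\<lambda>t. sqrt (?D t) ^ 3) has_real_derivative 3 * s\<^sup>2 * (- (2 * r) * (inverse s / 2))) (at t)"
      by (simp add: s_def numeral_2_eq_2 mult_ac)
    have "sqrt (?D t) ^ 3 \<noteq> 0" using D by simp
    from DERIV_divide[OF DERIV_const[of "1 - r\<^sup>2"] d this] show ?thesis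
      by (simp add: s_def)
  qed
  moreover have "- ((1 - r\<^sup>2) * (3 * s\<^sup>2 * (- (2 * r) * (inverse s / 2)))) / (s ^ 3 * s ^ 3)
       = 3 * r * poisson r t / ?D t"
    unfolding poisson_def s_def[symmetric] unfolding s(2) using s(1)
    by (simp add: field_simps power2_eq_square power3_eq_cube)
  ultimately show ?thesis by (simp add: poisson_def[abs_def])
qed

lemma continuous_on_poisson:
  assumes "\<bar>r\<bar> < 1" shows "continuous_on {- 1..1} (poisson r)"
proof (rule DERIV_continuous_on)
  fix t :: real assume "t \<in> {- 1..1}"
  then have "\<bar>t\<bar> \<le> 1" by auto
  from poisson_has_derivative[OF assms this]
  show "(poisson r has_real_derivative 3 * r * poisson r t / (1 - 2 * r * t + r\<^sup>2)) (at t within {- 1..1})"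
    by (rule has_field_derivative_at_within)
qed

lemma sphere_integral_poisson:
  assumes r: "0 < r" "r < 1" and x: "x \<in> S2"
  shows "(LINT y|\<sigma>. poisson r (x \<bullet> y)) = 1"
proof -
  let ?q = "\<lambda>t. (1 - r\<^sup>2) / r / sqrt (1 - 2 * r * t + r\<^sup>2)"
  have "(LINT y|\<sigma>. poisson r (x \<bullet> y)) = (?q 1 - ?q (- 1)) / 2"
  proof (rule sphere_integral_zonal[OF poisson_has_derivative _ poisson_has_antiderivative x])
    show "continuous_on {- 1..1} (\<lambda>t. 3 * r * poisson r t / (1 - 2 * r * t + r\<^sup>2))"
    proof (intro continuous_intros continuous_on_poisson ballI)
      show "1 - 2 * r * t + r\<^sup>2 \<noteq> 0" if "t \<in> {- 1..1}" for t
        using poisson_denom_pos[of r t] r that by (auto simp: abs_le_iff)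
    qed (use r in auto)
  qed (use r in auto)
  also have "sqrt (1 - 2 * r * 1 + r\<^sup>2) = 1 - r"
  proof -
    have "1 - 2 * r * 1 + r\<^sup>2 = (1 - r)\<^sup>2" by (simp add: power2_eq_square algebra_simps)
    then show ?thesis using r by simp
  qed
  also have "sqrt (1 - 2 * r * (- 1) + r\<^sup>2) = 1 + r"
  proof -
    have "1 - 2 * r * (- 1) + r\<^sup>2 = (1 + r)\<^sup>2" by (simp add: power2_eq_square algebra_simps)
    then show ?thesis using r by simp
  qed
  also have "((1 - r\<^sup>2) / r / (1 - r) - (1 - r\<^sup>2) / r / (1 + r)) / 2 = 1"
  proof -
    have "1 - r\<^sup>2 = (1 - r) * (1 + r)" by (simp add: power2_eq_square algebra_simps)
    then have "(1 - r\<^sup>2) / r / (1 - r) = (1 + r) / r" "(1 - r\<^sup>2) / r / (1 + r) = (1 - r) / r"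
      using r by simp_all
    then show ?thesis using r by (simp add: diff_divide_distrib[symmetric])
  qed
  finally show ?thesis .
qed

section \<open>Zonal harmonics\<close>

lemma eventually_axis_line_nonzero:
  fixes y :: "real^3"
  assumes "y \<noteq> 0"
  shows "eventually (\<lambda>t. y + t *\<^sub>R axis i 1 \<noteq> 0) (at (0::real))"
proof -
  have "((\<lambda>t. y + t *\<^sub>R axis i 1) \<longlongrightarrow> y + 0 *\<^sub>R axis i 1) (at (0::real))"
    by (intro tendsto_intros)
  then show ?thesis using assms by (intro tendsto_imp_eventually_ne) auto
qed

lemma partial_deriv_eqI:
  assumes "((\<lambda>t. F (y + t *\<^sub>R axis i 1)) has_real_derivative D) (at 0)"
  shows "partial_deriv i F y = D"
  unfolding partial_deriv_def by (rule DERIV_imp_deriv) (rule assms)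

text \<open>\<open>partial_deriv\<close> is a total function known to agree with \<open>F1\<close>
  only off the origin. Near t = 0 the line through \<open>y\<close> avoids the origin, so the
  derivative can be transferred.\<close>

lemma has_derivative_partial_deriv:
  fixes F :: "real^3 \<Rightarrow> real"
  assumes F1: "\<And>y. y \<noteq> 0 \<Longrightarrow> ((\<lambda>t. F (y + t *\<^sub>R axis i 1)) has_real_derivative F1 y) (at 0)"
    and F2: "((\<lambda>t. F1 (y + t *\<^sub>R axis j 1)) has_real_derivative D) (at 0)" and y: "y \<noteq> 0"
  shows "((\<lambda>t. partial_deriv i F (y + t *\<^sub>R axis j 1)) has_real_derivative D) (at 0)"
proof -
  have "eventually (\<lambda>t. partial_deriv i F (y + t *\<^sub>R axis j 1) = F1 (y + t *\<^sub>R axis j 1)) (at 0)"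
    using eventually_axis_line_nonzero[OF y, of j]
    by eventually_elim (rule partial_deriv_eqI[OF F1])
  moreover have "partial_deriv i F y = F1 y"
    by (rule partial_deriv_eqI[OF F1[OF y]])
  ultimately show ?thesis
    using F2 has_field_derivative_cong_eventually[of "\<lambda>t. partial_deriv i F (y + t *\<^sub>R axis j 1)" "\<lambda>t. F1 (y + t *\<^sub>R axis j 1)" 0 UNIV D]
    by simp
qed

lemma C2_onI:
  fixes F :: "real^3 \<Rightarrow> real"
  assumes F1: "\<And>i y. y \<noteq> 0 \<Longrightarrow> ((\<lambda>t. F (y + t *\<^sub>R axis i 1)) has_real_derivative F1 i y) (at 0)"
    and F2: "\<And>i j y. y \<noteq> 0 \<Longrightarrow> ((\<lambda>t. F1 i (y + t *\<^sub>R axis j 1)) has_real_derivative F2 i j y) (at 0)"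
    and c: "continuous_on (- {0}) F" "\<And>i. continuous_on (- {0}) (F1 i)" "\<And>i j. continuous_on (- {0}) (F2 i j)"
  shows "C2_on (- {0}) F" and "\<And>i j y. y \<noteq> 0 \<Longrightarrow> partial_deriv j (partial_deriv i F) y = F2 i j y"
proof -
  have 1: "partial_deriv i F y = F1 i y" if "y \<noteq> 0" for i y
    using partial_deriv_eqI[OF F1] that by blast
  have d2: "((\<lambda>t. partial_deriv i F (y + t *\<^sub>R axis j 1)) has_real_derivative F2 i j y) (at 0)" if "y \<noteq> 0" for i j y
    using has_derivative_partial_deriv[OF F1 F2] that by blast
  have 2: "partial_deriv j (partial_deriv i F) y = F2 i j y" if "y \<noteq> 0" for i j y
    using partial_deriv_eqI[OF d2] that by blast
  then show "\<And>i j y. y \<noteq> 0 \<Longrightarrow> partial_deriv j (partial_deriv i F) y = F2 i j y" .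
  show "C2_on (- {0}) F"
    unfolding C2_on_def partially_differentiable_on_def
  proof (intro conjI allI ballI c)
    fix i j and y :: "real^3" assume "y \<in> - {0}"
    then have y: "y \<noteq> 0" by simp
    show "(\<lambda>t. F (y + t *\<^sub>R axis i 1)) differentiable at 0"
      "(\<lambda>t. partial_deriv i F (y + t *\<^sub>R axis j 1)) differentiable at 0"
      using F1[OF y] d2[OF y] real_differentiable_def by blast+
  next
    fix i j
    show "continuous_on (- {0}) (partial_deriv i F)"
      using c(2)[of i] by (rule continuous_on_eq) (simp add: 1)
    show "continuous_on (- {0}) (partial_deriv j (partial_deriv i F))"
      using c(3)[of i j] by (rule continuous_on_eq) (simp add: 2)
  qed
qed

lemma norm_axis_line_has_derivative:
  fixes y :: "real^3"
  assumes "y \<noteq> 0"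
  shows "((\<lambda>t. norm (y + t *\<^sub>R axis i 1)) has_real_derivative y $ i / norm y) (at 0)"
proof -
  have "((\<lambda>t. y + t *\<^sub>R axis i 1) has_derivative (\<lambda>t. t *\<^sub>R axis i 1)) (at (0::real))"
    by (auto intro!: derivative_eq_intros)
  moreover have "(norm has_derivative (\<lambda>h. h \<bullet> sgn (y + 0 *\<^sub>R axis i 1))) (at (y + 0 *\<^sub>R axis i 1))"
    using assms by (intro has_derivative_norm) auto
  ultimately have "((\<lambda>t. norm (y + t *\<^sub>R axis i 1)) has_derivative (\<lambda>t. (t *\<^sub>R axis i 1) \<bullet> sgn (y + 0 *\<^sub>R axis i 1))) (at (0::real))"
    by (rule has_derivative_compose)
  moreover have "(\<lambda>t. (t *\<^sub>R axis i 1) \<bullet> sgn (y + 0 *\<^sub>R axis i 1)) = (*) (y $ i / norm y)"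
    by (rule ext) (simp add: sgn_div_norm inner_axis' divide_inverse mult_ac)
  ultimately show ?thesis by (simp add: has_field_derivative_def)
qed

text \<open>The radial extension is p(U) with U = (a . y) / |y|. On the sphere the gradient of U has
  squared norm 1 - u^2 and its Laplacian is - 2 u, where u = a . x; the chain rule then yields the
  operator of Legendre's equation.\<close>

lemma zonal_eigenfunction:
  fixes p :: "real poly" and a :: "real^3" and L :: real
  assumes a: "a \<in> S2"
    and ode: "\<And>t. (1 - t\<^sup>2) * poly (pderiv (pderiv p)) t - 2 * t * poly (pderiv p) t + L * poly p t = 0"
  shows "(\<lambda>y. poly p (a \<bullet> y)) \<in> C2_sphere"
    and "x \<in> S2 \<Longrightarrow> - laplace_beltrami (\<lambda>y. poly p (a \<bullet> y)) x = L * poly p (a \<bullet> x)"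
proof -
  define U where "U = (\<lambda>y. (a \<bullet> y) / norm y)"
  define U1 where "U1 = (\<lambda>i y. a $ i / norm y - (a \<bullet> y) * (y $ i) / norm y ^ 3)"
  define \<delta> where "\<delta> = (\<lambda>i j :: 3. if i = j then 1 else 0 :: real)"
  define U2 where "U2 = (\<lambda>i j y. - (a $ i * y $ j) / norm y ^ 3 - (a $ j * y $ i) / norm y ^ 3
      - (a \<bullet> y) * \<delta> i j / norm y ^ 3 + 3 * (a \<bullet> y) * (y $ i) * (y $ j) / norm y ^ 5)"
  have dn: "((\<lambda>t. norm (y + t *\<^sub>R axis i 1)) has_real_derivative y $ i / norm y) (at 0)" if "y \<noteq> 0" for y :: "real^3" and i
    by (rule norm_axis_line_has_derivative[OF that])
  have di: "((\<lambda>t. a \<bullet> (y + t *\<^sub>R axis i 1)) has_real_derivative a $ i) (at 0)" for y i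
    by (auto intro!: derivative_eq_intros simp: inner_add_right inner_axis)
  have dc: "((\<lambda>t. (y + t *\<^sub>R axis j 1) $ i) has_real_derivative \<delta> i j) (at 0)" for y i j
    by (auto intro!: derivative_eq_intros simp: axis_def \<delta>_def)
  have dU: "((\<lambda>t. U (y + t *\<^sub>R axis i 1)) has_real_derivative U1 i y) (at 0)" if y: "y \<noteq> 0" for y i
  proof -
    from DERIV_divide[OF di[where y = y and i = i] dn[OF y, where i = i]]
    have "((\<lambda>t. U (y + t *\<^sub>R axis i 1)) has_real_derivative
       (a $ i * norm y - a \<bullet> y * (y $ i / norm y)) / (norm y * norm y)) (at 0)"
      using y by (simp add: U_def)
    also have "(a $ i * norm y - a \<bullet> y * (y $ i / norm y)) / (norm y * norm y) = U1 i y"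
      using y by (simp add: U1_def field_simps power3_eq_cube)
    finally show ?thesis .
  qed
  have dU1: "((\<lambda>t. U1 i (y + t *\<^sub>R axis j 1)) has_real_derivative U2 i j y) (at 0)" if y: "y \<noteq> 0" for y i j
  proof -
    have n3: "((\<lambda>t. norm (y + t *\<^sub>R axis j 1) ^ 3) has_real_derivative 3 * norm y * y $ j) (at 0)"
      using DERIV_power[OF dn[OF y, where i = j], of 3] y by (simp add: numeral_2_eq_2 mult_ac)
    have "((\<lambda>t. a $ i / norm (y + t *\<^sub>R axis j 1)) has_real_derivative
        (0 * norm y - a $ i * (y $ j / norm y)) / (norm y * norm y)) (at 0)"
      using DERIV_divide[OF DERIV_const[of "a $ i"] dn[OF y, where i = j]] y by simp
    moreover have "((\<lambda>t. (a \<bullet> (y + t *\<^sub>R axis j 1)) * ((y + t *\<^sub>R axis j 1) $ i) / norm (y + t *\<^sub>R axis j 1) ^ 3) has_real_derivative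
        ((a $ j * y $ i + \<delta> i j * (a \<bullet> y)) * norm y ^ 3 - ((a \<bullet> y) * y $ i) * (3 * norm y * y $ j)) / (norm y ^ 3 * norm y ^ 3)) (at 0)"
      using DERIV_divide[OF DERIV_mult[OF di[where y = y and i = j] dc[where y = y and i = i and j = j]] n3] y by simp
    ultimately have "((\<lambda>t. U1 i (y + t *\<^sub>R axis j 1)) has_real_derivative
        (0 * norm y - a $ i * (y $ j / norm y)) / (norm y * norm y) -
        ((a $ j * y $ i + \<delta> i j * (a \<bullet> y)) * norm y ^ 3 - ((a \<bullet> y) * y $ i) * (3 * norm y * y $ j)) / (norm y ^ 3 * norm y ^ 3)) (at 0)"
      unfolding U1_def by (rule DERIV_diff)
    also have "(0 * norm y - a $ i * (y $ j / norm y)) / (norm y * norm y) -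
        ((a $ j * y $ i + \<delta> i j * (a \<bullet> y)) * norm y ^ 3 - ((a \<bullet> y) * y $ i) * (3 * norm y * y $ j)) / (norm y ^ 3 * norm y ^ 3) = U2 i j y"
    proof -
      have gen: "(0 * n - ai * (yj / n)) / (n * n) - ((aj * yi + d * u) * n ^ 3 - (u * yi) * (3 * n * yj)) / (n ^ 3 * n ^ 3)
         = - (ai * yj) / n ^ 3 - (aj * yi) / n ^ 3 - u * d / n ^ 3 + 3 * u * yi * yj / n ^ 5"
        if "n \<noteq> 0" for n ai aj yi yj u d :: real
        using that by (simp add: field_simps eval_nat_numeral)
      show ?thesis unfolding U2_def by (rule gen) (use y in simp)
    qed
    finally show ?thesis .
  qed
  define F where "F = (\<lambda>y. poly p (U y))"
  define F1 where "F1 = (\<lambda>i y. poly (pderiv p) (U y) * U1 i y)"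
  define F2 where "F2 = (\<lambda>i j y. poly (pderiv (pderiv p)) (U y) * U1 j y * U1 i y + U2 i j y * poly (pderiv p) (U y))"
  have dF: "((\<lambda>t. F (y + t *\<^sub>R axis i 1)) has_real_derivative F1 i y) (at 0)" if y: "y \<noteq> 0" for y i
    using DERIV_chain2[OF poly_DERIV dU[OF y], of p] by (simp add: F_def F1_def)
  have dF1: "((\<lambda>t. F1 i (y + t *\<^sub>R axis j 1)) has_real_derivative F2 i j y) (at 0)" if y: "y \<noteq> 0" for y i j
    using DERIV_mult[OF DERIV_chain2[OF poly_DERIV dU[OF y, where i = j], of "pderiv p"] dU1[OF y, where i = i and j = j]]
    by (simp add: F1_def F2_def)
  have cU: "continuous_on (- {0}) U" "continuous_on (- {0}) (U1 i)" "continuous_on (- {0}) (U2 i j)" for i j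
    unfolding U_def U1_def U2_def by (intro continuous_intros; auto)+
  have cF: "continuous_on (- {0}) F" "continuous_on (- {0}) (F1 i)" "continuous_on (- {0}) (F2 i j)" for i j
    unfolding F_def F1_def F2_def by (intro continuous_intros cU)+
  have re: "radial_extension (\<lambda>y. poly p (a \<bullet> y)) = F"
    by (rule ext) (simp add: radial_extension_def F_def U_def divide_inverse mult.commute)
  have C: "C2_on (- {0}) F" "\<And>i j y. y \<noteq> 0 \<Longrightarrow> partial_deriv j (partial_deriv i F) y = F2 i j y"
    using C2_onI[of F F1 F2] dF dF1 cF by blast+
  show "(\<lambda>y. poly p (a \<bullet> y)) \<in> C2_sphere"
    using C(1) by (simp add: C2_sphere_def re)
  assume x: "x \<in> S2"
  then have x0: "x \<noteq> 0" and nx: "norm x = 1" by auto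
  have "laplace_beltrami (\<lambda>y. poly p (a \<bullet> y)) x = (\<Sum>i\<in>UNIV. F2 i i x)"
    unfolding laplace_beltrami_def re using C(2)[OF x0] by simp
  also have "\<dots> = (1 - (a \<bullet> x)\<^sup>2) * poly (pderiv (pderiv p)) (a \<bullet> x) - 2 * (a \<bullet> x) * poly (pderiv p) (a \<bullet> x)"
  proof -
    have xx: "x $ 1 * x $ 1 + x $ 2 * x $ 2 + x $ 3 * x $ 3 = 1"
      using x by (simp add: norm_eq_1 inner_vec_def sum_3)
    have aa: "a $ 1 * a $ 1 + a $ 2 * a $ 2 + a $ 3 * a $ 3 = 1"
      using a by (simp add: norm_eq_1 inner_vec_def sum_3)
    have ax: "a \<bullet> x = a $ 1 * x $ 1 + a $ 2 * x $ 2 + a $ 3 * x $ 3"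
      by (simp add: inner_vec_def sum_3)
    define u p1 p2 where "u = a \<bullet> x" and "p1 = poly (pderiv p) u" and "p2 = poly (pderiv (pderiv p)) u"
    have "U x = u" by (simp add: U_def nx u_def)
    then have "(\<Sum>i\<in>UNIV. F2 i i x) = p2 * (U1 1 x * U1 1 x + U1 2 x * U1 2 x + U1 3 x * U1 3 x) + (U2 1 1 x + U2 2 2 x + U2 3 3 x) * p1"
      by (simp add: sum_3 F2_def p1_def p2_def algebra_simps)
    also have "U1 1 x * U1 1 x + U1 2 x * U1 2 x + U1 3 x * U1 3 x = 1 - u\<^sup>2"
      unfolding U1_def nx u_def[symmetric] using xx aa ax[folded u_def] by simp algebra
    also have "U2 1 1 x + U2 2 2 x + U2 3 3 x = - 2 * u"
      unfolding U2_def nx u_def[symmetric] \<delta>_def using xx aa ax[folded u_def] by simp algebra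
    finally show ?thesis by (simp add: u_def p1_def p2_def algebra_simps)
  qed
  finally show "- laplace_beltrami (\<lambda>y. poly p (a \<bullet> y)) x = L * poly p (a \<bullet> x)"
    using ode[of "a \<bullet> x"] by linarith
qed

text \<open>The factor 2 l + 1, the dimension of the space of degree \<open>l\<close>, makes this
  its reproducing kernel; see \<open>zonal_reproducing\<close>.\<close>

definition zonal :: "nat \<Rightarrow> real \<Rightarrow> real" where
  "zonal l t = (2 * real l + 1) * poly (legendre l) t"

lemma zonal_in_spherical_harmonics:
  assumes "a \<in> S2"
  shows "(\<lambda>y. zonal l (a \<bullet> y)) \<in> spherical_harmonics l"
proof -
  let ?p = "smult (2 * real l + 1) (legendre l)"
  have ode: "(1 - t\<^sup>2) * poly (pderiv (pderiv ?p)) t - 2 * t * poly (pderiv ?p) t + eigenvalue l * poly ?p t = 0" for t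
  proof -
    have "(2 * real l + 1) * ((1 - t\<^sup>2) * poly (pderiv (legendre' l)) t - 2 * t * poly (legendre' l) t
     + real l * (real l + 1) * poly (legendre l) t) = 0" by (simp add: legendre_ode)
    then show ?thesis by (simp add: pderiv_smult eigenvalue_def algebra_simps)
  qed
  have "(\<lambda>y. zonal l (a \<bullet> y)) = (\<lambda>y. poly ?p (a \<bullet> y))" by (simp add: zonal_def)
  then show ?thesis
    unfolding spherical_harmonics_def using zonal_eigenfunction[OF assms ode] by simp
qed

lemma zonal_sums:
  "\<bar>r\<bar> < 1 \<Longrightarrow> \<bar>t\<bar> \<le> 1 \<Longrightarrow> (\<lambda>n. r ^ n * zonal n t) sums poisson r t"
  using legendre_sums[of r t] by (simp add: zonal_def mult_ac)

lemma abs_zonal_le: "\<bar>t\<bar> \<le> 1 \<Longrightarrow> \<bar>zonal n t\<bar> \<le> 2 * real n + 1"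
  using abs_legendre_le_1[of t n] by (simp add: zonal_def abs_mult mult_left_le)

lemma zonal_one: "zonal n 1 = 2 * real n + 1"
  by (simp add: zonal_def legendre_at_one)

lemma continuous_on_zonal [continuous_intros]:
  "continuous_on A f \<Longrightarrow> continuous_on A (\<lambda>x. zonal n (f x))"
  unfolding zonal_def by (intro continuous_intros)

lemma measure_sphere_measure [simp]: "Sigma_Algebra.measure \<sigma> S2 = 1"
  by (simp add: Sigma_Algebra.measure_def emeasure_sphere_measure)

section \<open>The Poisson kernel as an approximate identity on the sphere\<close>

lemma abs_inner_sphere_le_1: "x \<in> S2 \<Longrightarrow> y \<in> S2 \<Longrightarrow> \<bar>x \<bullet> y\<bar> \<le> 1" for x y :: "real^3"
  using Cauchy_Schwarz_ineq2[of x y] by simp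

lemma poisson_nonneg: "\<bar>r\<bar> < 1 \<Longrightarrow> \<bar>t\<bar> \<le> 1 \<Longrightarrow> 0 \<le> poisson r t"
  using poisson_denom_pos[of r t] by (auto simp: poisson_def abs_square_le_1)

lemma poisson_denom_sphere:
  fixes x y :: "real^3"
  assumes "x \<in> S2" "y \<in> S2"
  shows "1 - 2 * r * (x \<bullet> y) + r\<^sup>2 = (1 - r)\<^sup>2 + r * (dist x y)\<^sup>2"
proof -
  have "x \<bullet> x = 1" "y \<bullet> y = 1" using assms by (simp_all add: norm_eq_1)
  then have "(dist x y)\<^sup>2 = 2 - 2 * (x \<bullet> y)"
    by (simp add: dist_norm power2_norm_eq_inner inner_diff_left inner_diff_right inner_commute)
  then show ?thesis by (simp only:) (simp add: power2_eq_square algebra_simps)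
qed

lemma continuous_on_poisson_inner:
  fixes x :: "real^3"
  assumes "\<bar>r\<bar> < 1" "x \<in> S2"
  shows "continuous_on S2 (\<lambda>y. poisson r (x \<bullet> y))"
proof (rule continuous_on_compose2[OF continuous_on_poisson[OF assms(1)]])
  show "(\<lambda>y. x \<bullet> y) ` S2 \<subseteq> {- 1..1}"
    using abs_inner_sphere_le_1[OF assms(2)] by (auto simp: abs_le_iff minus_le_iff)
qed (intro continuous_intros)

lemma poisson_integral_approx:
  fixes f :: "real^3 \<Rightarrow> real"
  assumes f: "continuous_on S2 f" and e: "0 < e"
  obtains r0 where "1 / 2 \<le> r0" "r0 < 1"
    "\<And>r x. r0 \<le> r \<Longrightarrow> r < 1 \<Longrightarrow> x \<in> S2 \<Longrightarrow> \<bar>(LINT y|\<sigma>. poisson r (x \<bullet> y) * f y) - f x\<bar> \<le> e"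
proof -
  have "compact (f ` S2)" by (rule compact_continuous_image[OF f]) simp
  then obtain B where B: "B > 0" "\<And>x. x \<in> S2 \<Longrightarrow> \<bar>f x\<bar> \<le> B"
    by (auto simp: bounded_pos dest!: compact_imp_bounded)
  have "uniformly_continuous_on S2 f" by (rule compact_uniformly_continuous[OF f]) simp
  then obtain \<delta> where \<delta>: "\<delta> > 0" "\<And>x y. x \<in> S2 \<Longrightarrow> y \<in> S2 \<Longrightarrow> dist y x < \<delta> \<Longrightarrow> dist (f y) (f x) < e / 2"
    using e unfolding uniformly_continuous_on_def by (metis half_gt_zero)
  define c where "c = sqrt (\<delta>\<^sup>2 / 2) ^ 3"
  have c: "c > 0" using \<delta> by (simp add: c_def)
  \<comment> \<open>For r >= 1 / 2 and points at distance at least \<delta>, \<open>c\<close> bounds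
    the denominator of the kernel from below. The kernel is then at most 2 (1 - r) / c there, and
    the choice of \<open>r0\<close> makes this times 2 B at most e / 2.\<close>
  define r0 where "r0 = max (1 / 2) (1 - e * c / (8 * B))"
  show thesis
  proof (rule that[of r0])
    show "1 / 2 \<le> r0" by (simp add: r0_def)
    show "r0 < 1" using e c B by (simp add: r0_def)
    fix r and x :: "real^3" assume r: "r0 \<le> r" "r < 1" and x: "x \<in> S2"
    have r2: "1 / 2 \<le> r" "1 - r \<le> e * c / (8 * B)" "\<bar>r\<bar> < 1" using r by (auto simp: r0_def)
    let ?P = "\<lambda>y. poisson r (x \<bullet> y)"
    have cP: "continuous_on S2 ?P" by (rule continuous_on_poisson_inner[OF r2(3) x])
    have iP: "(LINT y|\<sigma>. ?P y) = 1" by (rule sphere_integral_poisson) (use r r2 x in auto)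
    have bound: "\<bar>?P y * f y - ?P y * f x\<bar> \<le> e / 2 * ?P y + e / 2" if y: "y \<in> S2" for y
    proof -
      have P0: "?P y \<ge> 0" by (rule poisson_nonneg[OF r2(3) abs_inner_sphere_le_1[OF x y]])
      have eq: "\<bar>?P y * f y - ?P y * f x\<bar> = ?P y * \<bar>f y - f x\<bar>"
        using P0 by (simp add: abs_mult right_diff_distrib[symmetric])
      show ?thesis
      proof (cases "dist y x < \<delta>")
        case True
        then have "\<bar>f y - f x\<bar> \<le> e / 2" using \<delta>(2)[OF x y] by (simp add: dist_real_def)
        then have "?P y * \<bar>f y - f x\<bar> \<le> ?P y * (e / 2)" using P0 by (rule mult_left_mono)
        then show ?thesis using eq e by (simp add: mult.commute)
      next
        case False
        then have "\<delta>\<^sup>2 \<le> (dist x y)\<^sup>2" using \<delta>(1) by (simp add: dist_commute)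
        then have "\<delta>\<^sup>2 / 2 \<le> r * (dist x y)\<^sup>2" using r2(1) mult_mono[of "1/2" r "\<delta>\<^sup>2" "(dist x y)\<^sup>2"] by simp
        also have "\<dots> \<le> 1 - 2 * r * (x \<bullet> y) + r\<^sup>2" unfolding poisson_denom_sphere[OF x y] by simp
        finally have "c \<le> sqrt (1 - 2 * r * (x \<bullet> y) + r\<^sup>2) ^ 3"
          unfolding c_def by (intro power_mono) auto
        then have "?P y \<le> (1 - r\<^sup>2) / c"
          unfolding poisson_def using c r2 by (intro frac_le) (auto simp: abs_square_le_1)
        also have "\<dots> \<le> 2 * (1 - r) / c"
        proof -
          have "1 - r\<^sup>2 = (1 - r) * (1 + r)" by (simp add: power2_eq_square algebra_simps)
          also have "\<dots> \<le> (1 - r) * 2" using r by (intro mult_left_mono) auto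
          finally show ?thesis using c by (intro divide_right_mono) auto
        qed
        also have "\<dots> \<le> 2 * (e * c / (8 * B)) / c"
          using r2 c by (intro divide_right_mono mult_left_mono) auto
        also have "\<dots> = e / (4 * B)" using c by simp
        finally have "?P y * \<bar>f y - f x\<bar> \<le> e / (4 * B) * (2 * B)"
          using B(2)[OF x] B(2)[OF y] P0 by (intro mult_mono) auto
        also have "\<dots> = e / 2" using B by simp
        finally show ?thesis using eq P0 e by (smt (verit) mult_nonneg_nonneg)
      qed
    qed
    have i1: "integrable \<sigma> (\<lambda>y. ?P y * f y)" "integrable \<sigma> ?P"
      by (intro sphere_integrable_continuous continuous_intros cP f)+
    have "\<bar>(LINT y|\<sigma>. ?P y * f y) - f x\<bar> = \<bar>LINT y|\<sigma>. ?P y * f y - ?P y * f x\<bar>"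
      using i1 iP by simp
    also have "\<dots> \<le> (LINT y|\<sigma>. \<bar>?P y * f y - ?P y * f x\<bar>)" by (rule integral_abs_bound)
    also have "\<dots> \<le> (LINT y|\<sigma>. e / 2 * ?P y + e / 2)"
      using bound i1 by (intro integral_mono) auto
    also have "\<dots> = e" using i1 iP by simp
    finally show "\<bar>(LINT y|\<sigma>. ?P y * f y) - f x\<bar> \<le> e" .
  qed
qed

section \<open>The maximum principle for harmonic expansions\<close>

lemma second_derivative_test_max:
  fixes f f' :: "real \<Rightarrow> real"
  assumes d: "0 < d" and f: "\<And>t. \<bar>t\<bar> < d \<Longrightarrow> (f has_real_derivative f' t) (at t)"
    and f': "(f' has_real_derivative D) (at 0)" and max: "\<And>t. \<bar>t\<bar> < d \<Longrightarrow> f t \<le> f 0"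
  shows "f' 0 = 0" "D \<le> 0"
proof -
  show 0: "f' 0 = 0"
    by (rule DERIV_local_max[OF f d]) (use d max in auto)
  show "D \<le> 0"
  proof (rule ccontr)
    assume "\<not> D \<le> 0"
    then obtain e where e: "e > 0" "\<And>h. 0 < h \<Longrightarrow> h < e \<Longrightarrow> f' 0 < f' (0 + h)"
      using DERIV_pos_inc_right[OF f'] by auto
    define h where "h = min d e / 2"
    have h: "0 < h" "h < d" "h < e" using d e by (auto simp: h_def)
    obtain z where z: "0 < z" "z < h" "f h - f 0 = (h - 0) * f' z"
      using MVT2[OF h(1), of f f'] f h by auto
    have "f' z > 0" using e(2)[of z] z h 0 by auto
    then have "f h > f 0" using z h by (smt (verit) mult_pos_pos)
    then show False using max[of h] h by auto
  qed
qed

lemma C2_sphere_partial_derivatives: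
  assumes Y: "Y \<in> C2_sphere" and x: "x \<noteq> 0"
  shows "((\<lambda>t. radial_extension Y (x + t *\<^sub>R axis i 1)) has_real_derivative
           partial_deriv i (radial_extension Y) x) (at 0)"
    and "((\<lambda>t. partial_deriv i (radial_extension Y) (x + t *\<^sub>R axis j 1)) has_real_derivative
           partial_deriv j (partial_deriv i (radial_extension Y)) x) (at 0)"
proof -
  have 1: "(f has_real_derivative deriv f 0) (at 0)" if "f differentiable (at 0)" for f :: "real \<Rightarrow> real"
    using that by (metis DERIV_imp_deriv real_differentiable_def)
  show "((\<lambda>t. radial_extension Y (x + t *\<^sub>R axis i 1)) has_real_derivative
           partial_deriv i (radial_extension Y) x) (at 0)"
    unfolding partial_deriv_def
    by (rule 1) (use Y x in \<open>auto simp: C2_sphere_def C2_on_def partially_differentiable_on_def\<close>)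
  show "((\<lambda>t. partial_deriv i (radial_extension Y) (x + t *\<^sub>R axis j 1)) has_real_derivative
           partial_deriv j (partial_deriv i (radial_extension Y)) x) (at 0)"
    unfolding partial_deriv_def[of j]
    by (rule 1) (use Y x in \<open>auto simp: C2_sphere_def C2_on_def partially_differentiable_on_def\<close>)
qed

lemma radial_extension_sphere: "x \<in> S2 \<Longrightarrow> radial_extension Y x = Y x"
  by (simp add: radial_extension_def)

lemma continuous_on_C2_sphere: "Y \<in> C2_sphere \<Longrightarrow> continuous_on S2 Y"
proof -
  assume Y: "Y \<in> C2_sphere"
  have "continuous_on S2 (radial_extension Y)"
    by (rule continuous_on_subset[of "- {0}" "radial_extension Y"]) (use Y in \<open>auto simp: C2_sphere_def C2_on_def\<close>)
  then show ?thesis by (rule continuous_on_eq) (simp add: radial_extension_sphere)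
qed

lemma continuous_on_spherical_harmonics: "Y \<in> spherical_harmonics l \<Longrightarrow> continuous_on S2 Y"
  by (simp add: spherical_harmonics_def continuous_on_C2_sphere)

text \<open>The function \<open>\<tau>, x \<mapsto> \<Sum>i. c i * exp (- deg i * \<tau>) * y i x\<close> solves
  \<open>\<partial>\<tau>\<partial>\<tau> u - \<partial>\<tau> u + \<Delta> u = 0\<close> on the cylinder \<open>[0, \<infinity>) \<times> S2\<close>; the perturbation
  \<open>\<kappa> (exp (- \<tau>) - exp \<tau>)\<close> makes it a strict subsolution that is negative at the far end.\<close>
lemma harmonic_maximum_principle:
  fixes y :: "'i \<Rightarrow> real^3 \<Rightarrow> real" and deg :: "'i \<Rightarrow> nat" and c :: "'i \<Rightarrow> real"
  assumes A: "finite A" and y: "\<And>i. i \<in> A \<Longrightarrow> y i \<in> spherical_harmonics (deg i)"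
    and e: "0 \<le> e" "\<And>x. x \<in> S2 \<Longrightarrow> (\<Sum>i\<in>A. c i * y i x) \<le> e"
    and \<tau>: "0 \<le> \<tau>" and x: "x \<in> S2"
  shows "(\<Sum>i\<in>A. c i * exp (- (real (deg i) * \<tau>)) * y i x) \<le> e"
proof -
  define F where "F = (\<lambda>\<tau> x. \<Sum>i\<in>A. c i * exp (- (real (deg i) * \<tau>)) * y i x)"
  have cy: "continuous_on S2 (y i)" if "i \<in> A" for i
    using continuous_on_spherical_harmonics[OF y[OF that]] .
  have "\<exists>B. \<forall>x\<in>S2. \<bar>y i x\<bar> \<le> B" if "i \<in> A" for i
  proof -
    have "compact (y i ` S2)" by (rule compact_continuous_image[OF cy[OF that]]) simp
    then have "bounded (y i ` S2)" by (rule compact_imp_bounded)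
    then show ?thesis by (auto simp: bounded_iff)
  qed
  then have "\<exists>b. \<forall>i\<in>A. \<forall>x\<in>S2. \<bar>y i x\<bar> \<le> b i" by (intro bchoice ballI)
  then obtain b where b: "\<And>i x. i \<in> A \<Longrightarrow> x \<in> S2 \<Longrightarrow> \<bar>y i x\<bar> \<le> b i" by blast
  define B where "B = (\<Sum>i\<in>A. \<bar>c i\<bar> * b i)"
  have FB: "F \<tau> x \<le> B" if "0 \<le> \<tau>" "x \<in> S2" for \<tau> x
    unfolding F_def B_def
  proof (rule sum_mono)
    fix i assume i: "i \<in> A"
    have "c i * exp (- (real (deg i) * \<tau>)) * y i x \<le> \<bar>c i\<bar> * exp (- (real (deg i) * \<tau>)) * \<bar>y i x\<bar>"
      by (metis abs_exp_cancel abs_ge_self abs_mult)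
    also have "\<dots> \<le> \<bar>c i\<bar> * 1 * b i"
      using b[OF i that(2)] that by (intro mult_mono) auto
    finally show "c i * exp (- (real (deg i) * \<tau>)) * y i x \<le> \<bar>c i\<bar> * b i" by simp
  qed
  have step: "F \<tau> x \<le> e + \<kappa> * (exp \<tau> - exp (- \<tau>))" if \<kappa>: "0 < \<kappa>" for \<kappa>
  proof -
    \<comment> \<open>At this height exp T >= |B| / \<kappa> + 1, so the perturbation pushes
      \<open>W\<close> below 0 at the far end; the maximum with \<tau> keeps the point of interest
      inside the cylinder.\<close>
    define T where "T = max \<tau> (\<bar>B\<bar> / \<kappa> + 1)"
    have "\<bar>B\<bar> / \<kappa> + 1 > 0" using \<kappa> by (intro add_nonneg_pos) auto
    then have T: "T > 0" "\<tau> \<le> T" "\<bar>B\<bar> / \<kappa> + 1 \<le> T" by (auto simp: T_def)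
    have expT: "\<bar>B\<bar> + \<kappa> \<le> \<kappa> * exp T"
    proof -
      have "\<bar>B\<bar> / \<kappa> + 1 \<le> exp T" using exp_ge_add_one_self[of T] T(3) by linarith
      then have "\<kappa> * (\<bar>B\<bar> / \<kappa> + 1) \<le> \<kappa> * exp T" using \<kappa> by (intro mult_left_mono) auto
      then show ?thesis using \<kappa> by (simp add: distrib_left)
    qed
    define W where "W = (\<lambda>\<tau> x. F \<tau> x + \<kappa> * exp (- \<tau>) - \<kappa> * exp \<tau>)"
    have "continuous_on ({0..T} \<times> S2) (\<lambda>z. W (fst z) (snd z))"
      unfolding W_def F_def
      by (intro continuous_intros continuous_on_compose2[OF cy]) auto
    moreover have "compact ({0..T} \<times> S2 :: (real \<times> (real^3)) set)" by (intro compact_Times) auto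
    moreover have "(0, x) \<in> {0..T} \<times> S2" using T x by auto
    ultimately obtain \<tau>0 x0 where p: "\<tau>0 \<in> {0..T}" "x0 \<in> S2"
      and mx: "\<And>\<tau> x. \<tau> \<in> {0..T} \<Longrightarrow> x \<in> S2 \<Longrightarrow> W \<tau> x \<le> W \<tau>0 x0"
      using continuous_attains_sup[of "{0..T} \<times> S2" "\<lambda>z. W (fst z) (snd z)"] by fastforce
    have "W \<tau>0 x0 \<le> e"
    proof -
      consider "\<tau>0 = 0" | "\<tau>0 = T" | "0 < \<tau>0" "\<tau>0 < T" using p by force
      then show ?thesis
      proof cases
        case 1
        then show ?thesis using e(2)[OF p(2)] by (simp add: W_def F_def)
      next
        case 2
        have "W \<tau>0 x0 \<le> B + \<kappa> * 1 - \<kappa> * exp T"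
          unfolding W_def 2 using FB[of T x0] T p \<kappa> by (intro diff_mono add_mono mult_left_mono) auto
        then show ?thesis using expT e by linarith
      next
        case 3
        define w where "w = (\<lambda>i. c i * exp (- (real (deg i) * \<tau>0)))"
        define d where "d = min \<tau>0 (T - \<tau>0)"
        define g' where "g' = (\<lambda>t. (\<Sum>i\<in>A. c i * (exp (- (real (deg i) * (\<tau>0 + t))) * - real (deg i)) * y i x0)
            + \<kappa> * (- exp (- (\<tau>0 + t))) - \<kappa> * exp (\<tau>0 + t))"
        define D where "D = (\<Sum>i\<in>A. w i * (real (deg i))\<^sup>2 * y i x0) + \<kappa> * exp (- \<tau>0) - \<kappa> * exp \<tau>0"
        have d1: "((\<lambda>t. W (\<tau>0 + t) x0) has_real_derivative g' t) (at t)" for t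
          unfolding W_def F_def g'_def by (auto intro!: derivative_eq_intros simp: mult_ac)
        have d2: "(g' has_real_derivative D) (at 0)"
          unfolding g'_def D_def w_def by (auto intro!: derivative_eq_intros sum.cong simp: mult_ac power2_eq_square)
        have t1: "g' 0 = 0" "D \<le> 0"
        proof -
          have d: "0 < d" using 3 by (simp add: d_def)
          have "W (\<tau>0 + t) x0 \<le> W (\<tau>0 + 0) x0" if "\<bar>t\<bar> < d" for t
            using mx[of "\<tau>0 + t" x0] that p(2) by (auto simp: d_def abs_less_iff)
          note m = second_derivative_test_max[OF d d1 d2 this]
          show "g' 0 = 0" "D \<le> 0" using m by auto
        qed
        have x0: "norm x0 = 1" using p by simp
        have lap: "(\<Sum>i\<in>A. w i * partial_deriv k (partial_deriv k (radial_extension (y i))) x0) \<le> 0" for k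
        proof -
          have nz: "x0 + t *\<^sub>R axis k 1 \<noteq> 0" if "\<bar>t\<bar> < 1" for t
          proof
            assume "x0 + t *\<^sub>R axis k 1 = 0"
            then have "x0 = - (t *\<^sub>R axis k 1)" by (simp add: add_eq_0_iff2)
            then have "norm x0 = \<bar>t\<bar>" by (simp add: norm_axis_1)
            then show False using x0 that by simp
          qed
          define f where "f = (\<lambda>t. \<Sum>i\<in>A. w i * radial_extension (y i) (x0 + t *\<^sub>R axis k 1))"
          define f' where "f' = (\<lambda>t. \<Sum>i\<in>A. w i * partial_deriv k (radial_extension (y i)) (x0 + t *\<^sub>R axis k 1))"
          have C2: "y i \<in> C2_sphere" if "i \<in> A" for i using y[OF that] by (simp add: spherical_harmonics_def)
          show ?thesis
          proof (rule second_derivative_test_max(2)[of 1 f f'])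
            fix t :: real assume t: "\<bar>t\<bar> < 1"
            show "(f has_real_derivative f' t) (at t)"
              unfolding f_def f'_def
            proof (intro DERIV_sum DERIV_cmult)
              fix i assume "i \<in> A"
              from C2_sphere_partial_derivatives(1)[OF C2[OF this] nz[OF t], of k]
              have "((\<lambda>s. radial_extension (y i) (x0 + (s + t) *\<^sub>R axis k 1)) has_real_derivative
                 partial_deriv k (radial_extension (y i)) (x0 + t *\<^sub>R axis k 1)) (at 0)"
                by (simp add: scaleR_add_left add_ac)
              then show "((\<lambda>t. radial_extension (y i) (x0 + t *\<^sub>R axis k 1)) has_real_derivative
                 partial_deriv k (radial_extension (y i)) (x0 + t *\<^sub>R axis k 1)) (at t)"
                using DERIV_shift[of "\<lambda>t. radial_extension (y i) (x0 + t *\<^sub>R axis k 1)" _ 0 t] by simp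
            qed
            \<comment> \<open>A radial extension is constant on rays, so the maximum of
              \<open>W \<tau>0\<close> over the sphere at \<open>x0\<close> is also one along every
              coordinate line through \<open>x0\<close>. Parameters below 1 in absolute value keep
              the line off the origin.\<close>
            define v where "v = (x0 + t *\<^sub>R axis k 1) /\<^sub>R norm (x0 + t *\<^sub>R axis k 1)"
            have v: "v \<in> S2" using nz[OF t] by (simp add: v_def)
            have "W \<tau>0 v \<le> W \<tau>0 x0" by (rule mx[OF p(1) v])
            then show "f t \<le> f 0"
              by (simp add: W_def F_def f_def w_def radial_extension_def v_def x0)
          next
            show "(f' has_real_derivative (\<Sum>i\<in>A. w i * partial_deriv k (partial_deriv k (radial_extension (y i))) x0)) (at 0)"
              unfolding f'_def
              by (intro DERIV_sum DERIV_cmult C2_sphere_partial_derivatives(2) C2) (use x0 in auto)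
          qed simp
        qed
        have "(\<Sum>i\<in>A. w i * laplace_beltrami (y i) x0) =
            (\<Sum>k\<in>UNIV. \<Sum>i\<in>A. w i * partial_deriv k (partial_deriv k (radial_extension (y i))) x0)"
          unfolding laplace_beltrami_def sum_distrib_left by (rule sum.swap)
        also have "\<dots> \<le> 0" by (intro sum_nonpos lap)
        finally have t2: "(\<Sum>i\<in>A. w i * laplace_beltrami (y i) x0) \<le> 0" .
        \<comment> \<open>Every harmonic term cancels because its eigenvalue is deg^2 + deg. The
          operator also annihilates exp \<tau>, whose role is to make the far end negative; exp (-
          \<tau>) leaves the strictly positive remainder, against the signs of \<open>t1\<close> and
          \<open>t2\<close>.\<close>
        have "D - g' 0 + (\<Sum>i\<in>A. w i * laplace_beltrami (y i) x0) = 2 * \<kappa> * exp (- \<tau>0)"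
        proof -
          have "(\<Sum>i\<in>A. w i * laplace_beltrami (y i) x0) = (\<Sum>i\<in>A. - (w i * (real (deg i))\<^sup>2 * y i x0) - w i * real (deg i) * y i x0)"
          proof (rule sum.cong[OF refl])
            fix i assume "i \<in> A"
            then have "- laplace_beltrami (y i) x0 = eigenvalue (deg i) * y i x0"
              using y[of i] p(2) unfolding spherical_harmonics_def by blast
            then have "laplace_beltrami (y i) x0 = - (eigenvalue (deg i) * y i x0)" by linarith
            then show "w i * laplace_beltrami (y i) x0 = - (w i * (real (deg i))\<^sup>2 * y i x0) - w i * real (deg i) * y i x0"
              unfolding eigenvalue_def by algebra
          qed
          also have "\<dots> = - (\<Sum>i\<in>A. w i * (real (deg i))\<^sup>2 * y i x0) - (\<Sum>i\<in>A. w i * real (deg i) * y i x0)"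
            by (simp add: sum_subtractf sum_negf)
          moreover have "g' 0 = - (\<Sum>i\<in>A. w i * real (deg i) * y i x0) - \<kappa> * exp (- \<tau>0) - \<kappa> * exp \<tau>0"
            by (simp add: g'_def w_def sum_negf[symmetric] mult_ac)
          ultimately show ?thesis by (simp add: D_def)
        qed
        moreover have "2 * \<kappa> * exp (- \<tau>0) > 0" using \<kappa> by simp
        ultimately show ?thesis using t1 t2 by linarith
      qed
    qed
    then have "W \<tau> x \<le> e" using mx[of \<tau> x] \<tau> T x by auto
    then show ?thesis by (simp add: W_def algebra_simps)
  qed
  have "F \<tau> x \<le> e"
  proof (rule field_le_epsilon)
    fix \<epsilon> :: real assume \<epsilon>: "0 < \<epsilon>"
    define q where "q = exp \<tau> - exp (- \<tau>) + 1"
    have q: "q > 0" using \<tau> by (simp add: q_def add_nonneg_pos)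
    have "F \<tau> x \<le> e + \<epsilon> / q * (exp \<tau> - exp (- \<tau>))" by (rule step) (use \<epsilon> q in auto)
    also have "\<dots> \<le> e + \<epsilon> / q * q" using \<epsilon> q by (intro add_left_mono mult_left_mono) (auto simp: q_def)
    finally show "F \<tau> x \<le> e + \<epsilon>" using q by simp
  qed
  then show ?thesis by (simp add: F_def)
qed

text \<open>With r = exp (- \<tau>) the sum on the left is the harmonic extension into the ball
  evaluated at radius r. Applying the one-sided principle to \<open>c\<close> and to
  \<open>- c\<close> gives the absolute value.\<close>

lemma harmonic_maximum_principle_abs:
  fixes y :: "'i \<Rightarrow> real^3 \<Rightarrow> real" and deg :: "'i \<Rightarrow> nat" and c :: "'i \<Rightarrow> real"
  assumes A: "finite A" and y: "\<And>i. i \<in> A \<Longrightarrow> y i \<in> spherical_harmonics (deg i)"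
    and e: "\<And>x. x \<in> S2 \<Longrightarrow> \<bar>\<Sum>i\<in>A. c i * y i x\<bar> \<le> e"
    and r: "0 < r" "r \<le> 1" and x: "x \<in> S2"
  shows "\<bar>\<Sum>i\<in>A. c i * r ^ deg i * y i x\<bar> \<le> e"
proof -
  define \<tau> where "\<tau> = - ln r"
  have \<tau>: "\<tau> \<ge> 0" using r by (simp add: \<tau>_def)
  have re: "exp (- (real n * \<tau>)) = r ^ n" for n
    using r by (simp add: \<tau>_def exp_of_nat_mult)
  have e0: "0 \<le> e" using e[OF x] by linarith
  have e1: "(\<Sum>i\<in>A. c i * y i x) \<le> e" and e2: "(\<Sum>i\<in>A. - c i * y i x) \<le> e" if "x \<in> S2" for x
    using e[OF that] by (simp_all add: sum_negf abs_le_iff)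
  have "(\<Sum>i\<in>A. c i * exp (- (real (deg i) * \<tau>)) * y i x) \<le> e"
    by (rule harmonic_maximum_principle[OF A y e0 e1 \<tau> x])
  moreover have "(\<Sum>i\<in>A. - c i * exp (- (real (deg i) * \<tau>)) * y i x) \<le> e"
    by (rule harmonic_maximum_principle[OF A y e0 e2 \<tau> x])
  ultimately show ?thesis by (simp add: re sum_negf abs_le_iff)
qed

section \<open>Zonal projections and the addition theorem\<close>

lemma continuous_on_bounded_sphere:
  fixes f :: "real^3 \<Rightarrow> real"
  assumes "continuous_on S2 f"
  obtains B where "B > 0" "\<And>x. x \<in> S2 \<Longrightarrow> \<bar>f x\<bar> \<le> B"
proof -
  have "compact (f ` S2)" by (rule compact_continuous_image[OF assms]) simp
  then show ?thesis using that by (auto simp: bounded_pos dest!: compact_imp_bounded)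
qed

lemma summable_zonal_majorant: "\<bar>r\<bar> < 1 \<Longrightarrow> summable (\<lambda>n. \<bar>r\<bar> ^ n * (2 * real n + 1))"
  using zonal_sums[of "\<bar>r\<bar>" 1] by (simp add: zonal_one sums_iff)

lemma integrable_zonal:
  fixes f :: "real^3 \<Rightarrow> real"
  assumes f: "integrable \<sigma> f" and x: "x \<in> S2"
  shows "integrable \<sigma> (\<lambda>y. zonal n (x \<bullet> y) * f y)"
    and "(LINT y|\<sigma>. \<bar>zonal n (x \<bullet> y) * f y\<bar>) \<le> (2 * real n + 1) * (LINT y|\<sigma>. \<bar>f y\<bar>)"
proof -
  have b: "\<bar>zonal n (x \<bullet> y) * f y\<bar> \<le> (2 * real n + 1) * \<bar>f y\<bar>" if "y \<in> S2" for y
    unfolding abs_mult by (intro mult_right_mono abs_zonal_le abs_inner_sphere_le_1 x that) auto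
  have i: "integrable \<sigma> (\<lambda>y. (2 * real n + 1) * \<bar>f y\<bar>)" using f by simp
  have m: "(\<lambda>y. zonal n (x \<bullet> y)) \<in> borel_measurable \<sigma>"
    by (intro borel_measurable_sphere_continuous continuous_intros)
  show "integrable \<sigma> (\<lambda>y. zonal n (x \<bullet> y) * f y)"
    by (rule Bochner_Integration.integrable_bound[OF i])
      (use b m f in \<open>auto intro!: borel_measurable_times AE_I2\<close>)
  then have "(LINT y|\<sigma>. \<bar>zonal n (x \<bullet> y) * f y\<bar>) \<le> (LINT y|\<sigma>. (2 * real n + 1) * \<bar>f y\<bar>)"
    using b i by (intro integral_mono) auto
  then show "(LINT y|\<sigma>. \<bar>zonal n (x \<bullet> y) * f y\<bar>) \<le> (2 * real n + 1) * (LINT y|\<sigma>. \<bar>f y\<bar>)"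
    by simp
qed

text \<open>So far only an integral operator. That it fixes harmonics of degree \<open>m\<close> and
  annihilates those of other degrees is \<open>zonal_reproducing\<close>.\<close>

definition zonal_projection :: "nat \<Rightarrow> (real^3 \<Rightarrow> real) \<Rightarrow> real^3 \<Rightarrow> real" where
  "zonal_projection m f x = (LINT y|\<sigma>. zonal m (x \<bullet> y) * f y)"

lemma abs_zonal_projection_le:
  fixes f :: "real^3 \<Rightarrow> real"
  assumes "integrable \<sigma> f" "x \<in> S2"
  shows "\<bar>zonal_projection m f x\<bar> \<le> (2 * real m + 1) * (LINT y|\<sigma>. \<bar>f y\<bar>)"
  unfolding zonal_projection_def
  using integral_abs_bound[of \<sigma> "\<lambda>y. zonal m (x \<bullet> y) * f y"] integrable_zonal(2)[OF assms, of m]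
  by linarith

lemma sums_zonal_projection:
  fixes f :: "real^3 \<Rightarrow> real"
  assumes f: "integrable \<sigma> f" and r: "\<bar>r\<bar> < 1" and x: "x \<in> S2"
  shows "(\<lambda>n. r ^ n * zonal_projection n f x) sums
    (LINT y|\<sigma>. poisson r (x \<bullet> y) * f y)"
proof -
  let ?h = "\<lambda>n y. r ^ n * (zonal n (x \<bullet> y) * f y)"
  have i: "integrable \<sigma> (?h n)" for n
    using integrable_zonal(1)[OF f x] by simp
  have "(\<lambda>n. integral\<^sup>L \<sigma> (?h n)) sums (LINT y|\<sigma>. (\<Sum>n. ?h n y))"
  proof (rule sums_integral[OF i])
    show "AE y in \<sigma>. summable (\<lambda>n. norm (?h n y))"
    proof (rule AE_I2)
      fix y assume "y \<in> space \<sigma>"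
      then have y: "y \<in> S2" by simp
      show "summable (\<lambda>n. norm (?h n y))"
      proof (rule summable_comparison_test')
        show "summable (\<lambda>n. \<bar>r\<bar> ^ n * (2 * real n + 1) * \<bar>f y\<bar>)"
          by (intro summable_mult2 summable_zonal_majorant r)
        show "norm (norm (?h n y)) \<le> \<bar>r\<bar> ^ n * (2 * real n + 1) * \<bar>f y\<bar>" if "n \<ge> 0" for n
          using abs_zonal_le[OF abs_inner_sphere_le_1[OF x y], of n]
          by (simp add: abs_mult power_abs mult.assoc mult_left_mono mult_right_mono)
      qed
    qed
    show "summable (\<lambda>n. LINT y|\<sigma>. norm (?h n y))"
    proof (rule summable_comparison_test')
      show "summable (\<lambda>n. \<bar>r\<bar> ^ n * (2 * real n + 1) * (LINT y|\<sigma>. \<bar>f y\<bar>))"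
        by (intro summable_mult2 summable_zonal_majorant r)
      fix n :: nat
      have "(LINT y|\<sigma>. norm (?h n y)) = \<bar>r\<bar> ^ n * (LINT y|\<sigma>. \<bar>zonal n (x \<bullet> y) * f y\<bar>)"
        by (simp add: abs_mult power_abs)
      also have "\<dots> \<le> \<bar>r\<bar> ^ n * ((2 * real n + 1) * (LINT y|\<sigma>. \<bar>f y\<bar>))"
        by (intro mult_left_mono integrable_zonal(2)[OF f x]) simp
      finally have le: "(LINT y|\<sigma>. norm (?h n y)) \<le> \<bar>r\<bar> ^ n * (2 * real n + 1) * (LINT y|\<sigma>. \<bar>f y\<bar>)"
        by (simp add: mult.assoc)
      have "0 \<le> (LINT y|\<sigma>. norm (?h n y))" by (intro integral_nonneg_AE AE_I2) simp
      with le show "norm (LINT y|\<sigma>. norm (?h n y)) \<le> \<bar>r\<bar> ^ n * (2 * real n + 1) * (LINT y|\<sigma>. \<bar>f y\<bar>)"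
        by simp
    qed
  qed
  also have "(LINT y|\<sigma>. (\<Sum>n. ?h n y)) = (LINT y|\<sigma>. poisson r (x \<bullet> y) * f y)"
  proof (rule Bochner_Integration.integral_cong[OF refl])
    fix y assume "y \<in> space \<sigma>"
    then have y: "y \<in> S2" by simp
    from sums_mult2[OF zonal_sums[OF r abs_inner_sphere_le_1[OF x y]], of "f y"]
    show "(\<Sum>n. ?h n y) = poisson r (x \<bullet> y) * f y"
      by (simp add: sums_iff mult.assoc)
  qed
  finally show ?thesis by (simp add: zonal_projection_def)
qed

text \<open>The vanishing is demanded for positive radii only, since that is where
  \<open>harmonic_radial_series\<close> applies. One-sided continuity at 0 gives the constant
  coefficient; dividing by r and inducting gives the others.\<close>

lemma powser_eq_zero_imp_coeff_zero:
  fixes a :: "nat \<Rightarrow> real"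
  assumes "\<And>r. 0 < r \<Longrightarrow> r < 1 \<Longrightarrow> (\<lambda>n. a n * r ^ n) sums 0"
    and "\<And>r. \<bar>r\<bar> < 1 \<Longrightarrow> summable (\<lambda>n. a n * r ^ n)"
  shows "a n = 0"
proof -
  have head: "a 0 = 0"
    if z: "\<And>r. 0 < r \<Longrightarrow> r < 1 \<Longrightarrow> (\<lambda>n. a n * r ^ n) sums 0"
      and s: "\<And>r. \<bar>r\<bar> < 1 \<Longrightarrow> summable (\<lambda>n. a n * r ^ n)" for a :: "nat \<Rightarrow> real"
  proof -
    have "((\<lambda>x. \<Sum>n. a n * x ^ n) \<longlongrightarrow> a 0) (at 0)"
      by (rule powser_limit_0[of 1]) (use s in \<open>auto intro: summable_sums\<close>)
    then have "((\<lambda>x. \<Sum>n. a n * x ^ n) \<longlongrightarrow> a 0) (at_right 0)"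
      by (rule tendsto_mono[OF at_le, rotated]) simp
    moreover have "eventually (\<lambda>x. (\<Sum>n. a n * x ^ n) = 0) (at_right (0::real))"
      by (intro eventually_at_rightI[of 0 1]) (use z in \<open>auto simp: sums_iff\<close>)
    ultimately have "((\<lambda>x. 0) \<longlongrightarrow> a 0) (at_right (0::real))"
      by (rule Lim_transform_eventually)
    then show "a 0 = 0" by (simp add: tendsto_const_iff)
  qed
  show ?thesis
    using assms
  proof (induction n arbitrary: a)
    case (0 a)
    then show ?case by (rule head)
  next
    case (Suc n a)
    have a0: "a 0 = 0" using Suc(2,3) by (rule head)
    show ?case
    proof (rule Suc.IH)
      fix r :: real assume r: "0 < r" "r < 1"
      have "(\<lambda>n. a (Suc n) * r ^ Suc n) sums 0"
        using Suc(2)[OF r] a0 by (subst sums_Suc_iff) simp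
      then have "(\<lambda>n. inverse r * (a (Suc n) * r ^ Suc n)) sums (inverse r * 0)" by (rule sums_mult)
      then show "(\<lambda>n. a (Suc n) * r ^ n) sums 0" using r by (simp add: field_simps)
    next
      fix r :: real assume r: "\<bar>r\<bar> < 1"
      show "summable (\<lambda>n. a (Suc n) * r ^ n)"
        by (cases "r = 0") (use powser_split_head(3)[OF Suc(3)[OF r]] in auto)
    qed
  qed
qed

text \<open>The maximum principle accepts only finite sums, so the Abel sums are truncated. A single
  \<open>M\<close> serves all points and all smaller radii \<open>q * r\<close>, because the tail at
  radius r dominates the tails there.\<close>

lemma poisson_partial_sums:
  fixes f :: "real^3 \<Rightarrow> real"
  assumes f: "continuous_on S2 f" and e: "0 < e"
  obtains r0 where "0 < r0" "r0 < 1"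
    "\<And>r. r0 \<le> r \<Longrightarrow> r < 1 \<Longrightarrow> \<exists>M. \<forall>x\<in>S2. \<bar>f x - (\<Sum>m<M. r ^ m * zonal_projection m f x)\<bar> \<le> e \<and>
        (\<forall>q. 0 < q \<longrightarrow> q \<le> 1 \<longrightarrow>
          \<bar>(\<Sum>m<M. (q * r) ^ m * zonal_projection m f x) - (\<Sum>m. (q * r) ^ m * zonal_projection m f x)\<bar> \<le> e)"
proof -
  obtain r0 where r0: "1 / 2 \<le> r0" "r0 < 1"
    "\<And>r x. r0 \<le> r \<Longrightarrow> r < 1 \<Longrightarrow> x \<in> S2 \<Longrightarrow> \<bar>(LINT y|\<sigma>. poisson r (x \<bullet> y) * f y) - f x\<bar> \<le> e / 2"
    by (rule poisson_integral_approx[OF f half_gt_zero[OF e]]) (rule that; blast)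
  have fi: "integrable \<sigma> f" by (rule sphere_integrable_continuous[OF f])
  define I where "I = (LINT y|\<sigma>. \<bar>f y\<bar>)"
  define g where "g = (\<lambda>m. zonal_projection m f)"
  show thesis
  proof (rule that[of r0])
    fix r :: real assume r: "r0 \<le> r" "r < 1"
    have rp: "0 < r" using r r0 by linarith
    have sI: "summable (\<lambda>m. r ^ m * (2 * real m + 1) * I)"
      using summable_mult2[OF summable_zonal_majorant[of r]] r rp by simp
    obtain M where M: "\<And>n. n \<ge> M \<Longrightarrow> norm (\<Sum>m. r ^ (m + n) * (2 * real (m + n) + 1) * I) < e / 2"
      using suminf_exist_split[OF _ sI, of "e / 2"] e by auto
    have tail: "\<bar>(\<Sum>m<M. (q * r) ^ m * g m x) - (\<Sum>m. (q * r) ^ m * g m x)\<bar> \<le> e / 2"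
      if q: "0 < q" "q \<le> 1" and x: "x \<in> S2" for q x
    proof -
      have bd: "norm ((q * r) ^ m * g m x) \<le> r ^ m * (2 * real m + 1) * I" for m
      proof -
        have "(q * r) ^ m \<le> r ^ m" using q rp by (intro power_mono) (auto simp: mult_left_le_one_le)
        then have "(q * r) ^ m * \<bar>g m x\<bar> \<le> r ^ m * ((2 * real m + 1) * I)"
          using abs_zonal_projection_le[OF fi x, of m] rp unfolding g_def I_def by (intro mult_mono) auto
        then show ?thesis using q rp by (simp add: abs_mult mult.assoc)
      qed
      have s: "summable (\<lambda>m. (q * r) ^ m * g m x)"
        by (rule summable_comparison_test'[OF sI]) (rule bd)
      have "(\<Sum>m. (q * r) ^ m * g m x) = (\<Sum>m. (q * r) ^ (m + M) * g (m + M) x) + (\<Sum>m<M. (q * r) ^ m * g m x)"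
        by (rule suminf_split_initial_segment[OF s])
      then have "\<bar>(\<Sum>m<M. (q * r) ^ m * g m x) - (\<Sum>m. (q * r) ^ m * g m x)\<bar> = norm (\<Sum>m. (q * r) ^ (m + M) * g (m + M) x)"
        by simp
      also have "\<dots> \<le> (\<Sum>m. r ^ (m + M) * (2 * real (m + M) + 1) * I)"
      proof (rule order_trans[OF summable_norm suminf_le])
        have sI': "summable (\<lambda>m. r ^ (m + M) * (2 * real (m + M) + 1) * I)"
          using sI by (subst summable_iff_shift)
        show "summable (\<lambda>m. norm ((q * r) ^ (m + M) * g (m + M) x))"
        proof (rule summable_comparison_test'[OF sI', of 0])
          show "norm (norm ((q * r) ^ (n + M) * g (n + M) x)) \<le> r ^ (n + M) * (2 * real (n + M) + 1) * I" for n
            using bd[of "n + M"] by simp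
        qed
        then show "summable (\<lambda>m. norm ((q * r) ^ (m + M) * g (m + M) x))" .
        show "summable (\<lambda>m. r ^ (m + M) * (2 * real (m + M) + 1) * I)" by (rule sI')
      qed (rule bd)
      also have "\<dots> \<le> e / 2" using M[of M] by (simp add: abs_less_iff)
      finally show ?thesis .
    qed
    show "\<exists>M. \<forall>x\<in>S2. \<bar>f x - (\<Sum>m<M. r ^ m * zonal_projection m f x)\<bar> \<le> e \<and>
        (\<forall>q. 0 < q \<longrightarrow> q \<le> 1 \<longrightarrow>
          \<bar>(\<Sum>m<M. (q * r) ^ m * zonal_projection m f x) - (\<Sum>m. (q * r) ^ m * zonal_projection m f x)\<bar> \<le> e)"
      unfolding g_def[symmetric, THEN fun_cong]
    proof (intro exI[of _ M] ballI conjI allI impI)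
      fix x assume x: "x \<in> S2"
      have "(\<Sum>m. (1 * r) ^ m * g m x) = (LINT y|\<sigma>. poisson r (x \<bullet> y) * f y)"
        using sums_zonal_projection[OF fi _ x, of r] r rp by (simp add: sums_iff g_def)
      then have "\<bar>(\<Sum>m<M. r ^ m * g m x) - (LINT y|\<sigma>. poisson r (x \<bullet> y) * f y)\<bar> \<le> e / 2"
        using tail[of 1 x] x by simp
      then show "\<bar>f x - (\<Sum>m<M. r ^ m * g m x)\<bar> \<le> e"
        using r0(3)[OF r x] by linarith
      show "\<bar>(\<Sum>m<M. (q * r) ^ m * g m x) - (\<Sum>m. (q * r) ^ m * g m x)\<bar> \<le> e" if "0 < q" "q \<le> 1" for q
        using tail[OF that x] e by linarith
    qed
  qed (use r0 in auto)
qed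

section \<open>Zonal kernels in terms of a given basis of spherical harmonics\<close>

locale spherical_harmonic_basis =
  fixes Y :: "nat \<Rightarrow> int \<Rightarrow> real^3 \<Rightarrow> real"
  assumes basis: "harmonic_basis Y"
begin

abbreviation orders :: "nat \<Rightarrow> int set" where "orders l \<equiv> {- int l..int l}"

lemma Y_harmonic: "k \<in> orders l \<Longrightarrow> Y l k \<in> spherical_harmonics l"
  using basis unfolding harmonic_basis_def by blast

lemma Y_continuous: "k \<in> orders l \<Longrightarrow> continuous_on S2 (Y l k)"
  using Y_harmonic continuous_on_spherical_harmonics by blast

lemma Y_orthonormal: "j \<in> orders l \<Longrightarrow> k \<in> orders l \<Longrightarrow> L2_inner (Y l j) (Y l k) = (if j = k then 1 else 0)"
  using basis unfolding harmonic_basis_def by blast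

lemma Y_span: "f \<in> spherical_harmonics l \<Longrightarrow> \<exists>c. \<forall>x\<in>S2. f x = (\<Sum>k\<in>orders l. c k * Y l k x)"
  using basis unfolding harmonic_basis_def by blast

lemma harmonic_expansion:
  assumes f: "f \<in> spherical_harmonics l" and x: "x \<in> S2"
  shows "f x = (\<Sum>k\<in>orders l. L2_inner f (Y l k) * Y l k x)"
proof -
  obtain c where "\<forall>x\<in>S2. f x = (\<Sum>k\<in>orders l. c k * Y l k x)" using Y_span[OF f] by blast
  then have c: "f x = (\<Sum>k\<in>orders l. c k * Y l k x)" if "x \<in> S2" for x using that by blast
  have "L2_inner f (Y l k) = c k" if k: "k \<in> orders l" for k
  proof -
    have "L2_inner f (Y l k) = (LINT x|\<sigma>. (\<Sum>j\<in>orders l. c j * (Y l j x * Y l k x)))"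
      unfolding L2_inner_def
      by (intro Bochner_Integration.integral_cong refl) (simp add: c sum_distrib_right mult.assoc)
    also have "\<dots> = (\<Sum>j\<in>orders l. c j * L2_inner (Y l j) (Y l k))"
      unfolding L2_inner_def
      by (subst Bochner_Integration.integral_sum)
        (use k in \<open>auto intro!: sphere_integrable_continuous continuous_intros Y_continuous\<close>)
    also have "\<dots> = (\<Sum>j\<in>orders l. if j = k then c j else 0)"
      by (intro sum.cong refl) (use k in \<open>auto simp: Y_orthonormal\<close>)
    also have "\<dots> = c k" using k by simp
    finally show ?thesis .
  qed
  then show ?thesis using c[OF x] by simp
qed

text \<open>For fixed \<open>y\<close> the kernel is itself a harmonic of degree \<open>l\<close> in
  \<open>x\<close>, so the spanning part of the basis hypothesis applies; its coefficients are
  projections of the basis functions at \<open>y\<close>.\<close>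

lemma zonal_expansion:
  assumes "x \<in> S2" "y \<in> S2"
  shows "zonal l (x \<bullet> y) = (\<Sum>k\<in>orders l. zonal_projection l (Y l k) y * Y l k x)"
  using harmonic_expansion[OF zonal_in_spherical_harmonics[OF assms(2), of l] assms(1)]
  by (simp add: zonal_projection_def L2_inner_def inner_commute[of x y])

lemma borel_measurable_zonal_projection:
  assumes k: "k \<in> orders l"
  shows "zonal_projection l (Y l k) \<in> borel_measurable \<sigma>"
proof -
  have id: "(\<lambda>x. x) \<in> \<sigma> \<rightarrow>\<^sub>M borel"
    by (rule borel_measurable_sphere_continuous) (rule continuous_on_id)
  have [measurable]: "Y l k \<in> borel_measurable \<sigma>"
    by (rule borel_measurable_sphere_continuous[OF Y_continuous[OF k]])
  have [measurable]: "zonal l \<in> borel_measurable borel"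
    by (rule borel_measurable_continuous_onI) (intro continuous_intros)
  have [measurable]: "fst \<in> \<sigma> \<Otimes>\<^sub>M \<sigma> \<rightarrow>\<^sub>M borel" "snd \<in> \<sigma> \<Otimes>\<^sub>M \<sigma> \<rightarrow>\<^sub>M borel"
    using measurable_compose[OF measurable_fst id, of \<sigma>] measurable_compose[OF measurable_snd id, of \<sigma>]
    by simp_all
  have "(\<lambda>(y, x). zonal l (y \<bullet> x) * Y l k x) \<in> borel_measurable (\<sigma> \<Otimes>\<^sub>M \<sigma>)"
    unfolding case_prod_unfold by measurable
  from sphere.borel_measurable_lebesgue_integral[OF this]
  show ?thesis by (simp add: zonal_projection_def[abs_def])
qed

text \<open>Expanding the kernel in \<open>x\<close> makes it a finite sum of products, so
  integration against \<open>f\<close> passes to the coefficients. These are measurable and bounded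
  in \<open>y\<close>, which makes every summand integrable.\<close>

lemma zonal_projection_in_span:
  assumes f: "integrable \<sigma> f"
  shows "\<exists>a. \<forall>x\<in>S2. zonal_projection l f x = (\<Sum>k\<in>orders l. a k * Y l k x)"
proof (intro exI ballI)
  fix x assume x: "x \<in> S2"
  have i: "integrable \<sigma> (\<lambda>y. zonal_projection l (Y l k) y * f y)" if k: "k \<in> orders l" for k
  proof (rule Bochner_Integration.integrable_bound)
    let ?c = "(2 * real l + 1) * (LINT x|\<sigma>. \<bar>Y l k x\<bar>)"
    show "integrable \<sigma> (\<lambda>y. ?c * f y)" using f by simp
    show "(\<lambda>y. zonal_projection l (Y l k) y * f y) \<in> borel_measurable \<sigma>"
      using borel_measurable_zonal_projection[OF k] f by auto
    show "AE y in \<sigma>. norm (zonal_projection l (Y l k) y * f y) \<le> norm (?c * f y)"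
    proof (rule AE_I2)
      fix y assume "y \<in> space \<sigma>"
      then have "\<bar>zonal_projection l (Y l k) y\<bar> \<le> ?c"
        using abs_zonal_projection_le[OF sphere_integrable_continuous[OF Y_continuous[OF k]], of y l] by simp
      then have "\<bar>zonal_projection l (Y l k) y\<bar> \<le> \<bar>?c\<bar>" by linarith
      then show "norm (zonal_projection l (Y l k) y * f y) \<le> norm (?c * f y)"
        unfolding real_norm_def abs_mult[of _ "f y"] by (intro mult_right_mono) auto
    qed
  qed
  have "zonal_projection l f x
      = (LINT y|\<sigma>. (\<Sum>k\<in>orders l. Y l k x * (zonal_projection l (Y l k) y * f y)))"
    unfolding zonal_projection_def[of l f]
    by (intro Bochner_Integration.integral_cong refl)
      (simp add: zonal_expansion[OF x] sum_distrib_left sum_distrib_right mult_ac)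
  also have "\<dots> = (\<Sum>k\<in>orders l. (LINT y|\<sigma>. zonal_projection l (Y l k) y * f y) * Y l k x)"
    by (subst Bochner_Integration.integral_sum) (auto intro!: i simp: mult.commute[of "Y _ _ _"])
  finally show "zonal_projection l f x =
      (\<Sum>k\<in>orders l. (LINT y|\<sigma>. zonal_projection l (Y l k) y * f y) * Y l k x)" .
qed

end

context spherical_harmonic_basis
begin

lemma zonal_projection_coeffs:
  "integrable \<sigma> f \<Longrightarrow>
    \<exists>b. \<forall>m. \<forall>x\<in>S2. zonal_projection m f x = (\<Sum>k\<in>orders m. b m k * Y m k x)"
  by (intro choice allI zonal_projection_in_span)

text \<open>Both sides are harmonic extensions of \<open>F\<close>, and uniqueness comes from the
  maximum principle. \<open>F\<close> minus a truncated Abel sum of radius r is a finite combination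
  of harmonics that is small on the sphere; contracting by q = s / r keeps it small and turns it
  into q ^ l F minus a partial sum of the series at radius s.\<close>

lemma harmonic_radial_series:
  assumes F: "F \<in> spherical_harmonics l" and x: "x \<in> S2" and s: "0 < s" "s < 1"
  shows "(\<Sum>m. s ^ m * zonal_projection m F x) = s ^ l * F x"
proof -
  define H where "H = (\<Sum>m. s ^ m * zonal_projection m F x)"
  have cF: "continuous_on S2 F" by (rule continuous_on_spherical_harmonics[OF F])
  obtain b where "\<forall>m. \<forall>x\<in>S2. zonal_projection m F x = (\<Sum>k\<in>orders m. b m k * Y m k x)"
    using zonal_projection_coeffs[OF sphere_integrable_continuous[OF cF]] by blast
  then have b: "zonal_projection m F x = (\<Sum>k\<in>orders m. b m k * Y m k x)" if "x \<in> S2" for m x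
    using that by blast
  have le: "\<bar>s ^ l * F x - H\<bar> \<le> e" if e: "0 < e" for e
  proof -
    obtain r0 where r0: "0 < r0" "r0 < 1"
      "\<And>r. r0 \<le> r \<Longrightarrow> r < 1 \<Longrightarrow> \<exists>M. \<forall>x\<in>S2. \<bar>F x - (\<Sum>m<M. r ^ m * zonal_projection m F x)\<bar> \<le> e / 2 \<and>
        (\<forall>q. 0 < q \<longrightarrow> q \<le> 1 \<longrightarrow>
          \<bar>(\<Sum>m<M. (q * r) ^ m * zonal_projection m F x) - (\<Sum>m. (q * r) ^ m * zonal_projection m F x)\<bar> \<le> e / 2)"
      by (rule poisson_partial_sums[OF cF half_gt_zero[OF e]]) (rule that; blast)
    have "\<bar>(s / r) ^ l * F x - H\<bar> \<le> e" if r: "max r0 s \<le> r" "r < 1" for r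
    proof -
      have rr: "r0 \<le> r" "s \<le> r" "0 < r" using r s by auto
      \<comment> \<open>Contracting the truncated sum of radius r by this factor lands on radius s
        whatever r is.\<close>
      define q where "q = s / r"
      have q: "0 < q" "q \<le> 1" "q * r = s" using rr s by (auto simp: q_def)
      from r0(3)[OF rr(1) r(2)] obtain M where M:
        "\<And>x. x \<in> S2 \<Longrightarrow> \<bar>F x - (\<Sum>m<M. r ^ m * zonal_projection m F x)\<bar> \<le> e / 2"
        "\<And>x q. x \<in> S2 \<Longrightarrow> 0 < q \<Longrightarrow> q \<le> 1 \<Longrightarrow>
          \<bar>(\<Sum>m<M. (q * r) ^ m * zonal_projection m F x) - (\<Sum>m. (q * r) ^ m * zonal_projection m F x)\<bar> \<le> e / 2"
        by blast
      define S where "S = (SIGMA m:{..<M}. orders m)"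
      \<comment> \<open>\<open>None\<close> indexes \<open>F\<close> itself and
        \<open>Some (m, k)\<close> the terms of its projections; the option type keeps
        \<open>F\<close> apart from the basis functions of the same degree.\<close>
      define A where "A = insert None (Some ` S)"
      define y where "y = (\<lambda>i. case i of None \<Rightarrow> F | Some z \<Rightarrow> Y (fst z) (snd z))"
      define deg where "deg = (\<lambda>i :: (nat \<times> int) option. case i of None \<Rightarrow> l | Some z \<Rightarrow> fst z)"
      define c where "c = (\<lambda>i. case i of None \<Rightarrow> 1 | Some z \<Rightarrow> - (r ^ fst z * b (fst z) (snd z)))"
      have fS: "finite S" by (auto simp: S_def)
      have sumA: "(\<Sum>i\<in>A. c i * u ^ deg i * y i x) = u ^ l * F x - (\<Sum>m<M. (u * r) ^ m * zonal_projection m F x)"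
        if x: "x \<in> S2" for u x
      proof -
        have "(\<Sum>i\<in>A. c i * u ^ deg i * y i x) = u ^ l * F x + (\<Sum>i\<in>Some ` S. c i * u ^ deg i * y i x)"
          unfolding A_def using fS by (subst sum.insert) (auto simp: c_def deg_def y_def)
        also have "(\<Sum>i\<in>Some ` S. c i * u ^ deg i * y i x) = (\<Sum>z\<in>S. - ((u * r) ^ fst z * (b (fst z) (snd z) * Y (fst z) (snd z) x)))"
          by (subst sum.reindex) (auto simp: c_def deg_def y_def power_mult_distrib mult_ac)
        also have "\<dots> = - (\<Sum>m<M. \<Sum>k\<in>orders m. (u * r) ^ m * (b m k * Y m k x))"
          unfolding S_def sum_negf by (subst sum.Sigma) (auto simp: case_prod_unfold)
        finally show ?thesis by (simp add: b[OF x] sum_distrib_left)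
      qed
      have "\<bar>\<Sum>i\<in>A. c i * q ^ deg i * y i x\<bar> \<le> e / 2"
      proof (rule harmonic_maximum_principle_abs)
        show "finite A" using fS by (simp add: A_def)
        show "y i \<in> spherical_harmonics (deg i)" if "i \<in> A" for i
          using that F Y_harmonic by (auto simp: A_def S_def y_def deg_def)
        show "\<bar>\<Sum>i\<in>A. c i * y i x\<bar> \<le> e / 2" if "x \<in> S2" for x
          using M(1)[OF that] sumA[OF that, of 1] by simp
      qed (use q x in auto)
      then have "\<bar>q ^ l * F x - (\<Sum>m<M. s ^ m * zonal_projection m F x)\<bar> \<le> e / 2"
        unfolding sumA[OF x] q(3) .
      moreover have "\<bar>(\<Sum>m<M. s ^ m * zonal_projection m F x) - H\<bar> \<le> e / 2"
        using M(2)[OF x q(1,2)] by (simp add: q(3) H_def)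
      ultimately show ?thesis unfolding q_def[symmetric] by linarith
    qed
    \<comment> \<open>The right-hand target s ^ l F appears only in the limit r -> 1 with s
      fixed.\<close>
    then have "eventually (\<lambda>r. \<bar>(s / r) ^ l * F x - H\<bar> \<le> e) (at_left 1)"
      using s r0 by (intro eventually_at_leftI[of "max r0 s"]) auto
    moreover have "((\<lambda>r. \<bar>(s / r) ^ l * F x - H\<bar>) \<longlongrightarrow> \<bar>(s / 1) ^ l * F x - H\<bar>) (at_left 1)"
      by (intro tendsto_intros) auto
    ultimately show ?thesis
      using tendsto_upperbound[of "\<lambda>r. \<bar>(s / r) ^ l * F x - H\<bar>" "\<bar>(s / 1) ^ l * F x - H\<bar>" "at_left 1" e] by simp
  qed
  have "\<bar>s ^ l * F x - H\<bar> \<le> 0"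
  proof (rule field_le_epsilon)
    fix e :: real assume "0 < e"
    from le[OF this] show "\<bar>s ^ l * F x - H\<bar> \<le> 0 + e" by simp
  qed
  then show ?thesis by (simp add: H_def)
qed

text \<open>Comparison of coefficients in \<open>harmonic_radial_series\<close>, both sides being
  power series in the radius. The case m \<noteq> l is the orthogonality of different degrees,
  obtained without Green's formula.\<close>

lemma zonal_reproducing:
  assumes F: "F \<in> spherical_harmonics l" and x: "x \<in> S2"
  shows "zonal_projection m F x = (if m = l then F x else 0)"
proof -
  define a where "a = (\<lambda>m. zonal_projection m F x - (if m = l then F x else 0))"
  have iF: "integrable \<sigma> F"
    by (rule sphere_integrable_continuous[OF continuous_on_spherical_harmonics[OF F]])
  have single: "(\<lambda>m. (if m = l then F x else 0) * r ^ m) sums (r ^ l * F x)" for r :: real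
  proof -
    have "(\<lambda>m. (if m = l then F x else 0) * r ^ m) = (\<lambda>m. if m = l then r ^ m * F x else 0)" by auto
    then show ?thesis using sums_single[of l "\<lambda>m. r ^ m * F x"] by (simp only:)
  qed
  have sg: "summable (\<lambda>m. zonal_projection m F x * r ^ m)" if "\<bar>r\<bar> < 1" for r
    using sums_zonal_projection[OF iF that x] by (simp add: sums_iff mult.commute)
  have "a m = 0"
  proof (rule powser_eq_zero_imp_coeff_zero)
    fix r :: real assume r: "0 < r" "r < 1"
    have "(\<lambda>m. zonal_projection m F x * r ^ m) sums (r ^ l * F x)"
      using harmonic_radial_series[OF F x r] sg[of r] r by (simp add: sums_iff mult.commute)
    from sums_diff[OF this single[of r]]
    show "(\<lambda>m. a m * r ^ m) sums 0" by (simp add: a_def left_diff_distrib)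
  next
    fix r :: real assume "\<bar>r\<bar> < 1"
    from summable_diff[OF sg[OF this] sums_summable[OF single[of r]]]
    show "summable (\<lambda>m. a m * r ^ m)" by (simp add: a_def left_diff_distrib)
  qed
  then show ?thesis by (simp add: a_def)
qed

text \<open>The coefficients in \<open>zonal_expansion\<close> are projections of basis functions of
  the same degree, hence the basis functions themselves.\<close>

lemma zonal_addition:
  assumes "x \<in> S2" "y \<in> S2"
  shows "zonal l (x \<bullet> y) = (\<Sum>k\<in>orders l. Y l k x * Y l k y)"
  using zonal_reproducing[OF Y_harmonic assms(2)] zonal_expansion[OF assms, of l] by (simp add: mult.commute)

lemma sum_Y_squares: "x \<in> S2 \<Longrightarrow> (\<Sum>k\<in>orders l. (Y l k x)\<^sup>2) = 2 * real l + 1"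
proof -
  assume x: "x \<in> S2"
  then have "x \<bullet> x = 1" by (simp add: norm_eq_1)
  then show ?thesis using zonal_addition[OF x x, of l] by (simp add: zonal_one power2_eq_square)
qed

lemma Y_integrable: "k \<in> orders l \<Longrightarrow> integrable \<sigma> (Y l k)"
  by (rule sphere_integrable_continuous[OF Y_continuous])

lemma Y_mult_integrable:
  "j \<in> orders l \<Longrightarrow> k \<in> orders m \<Longrightarrow> integrable \<sigma> (\<lambda>x. Y l j x * Y m k x)"
  by (intro sphere_integrable_continuous continuous_on_mult Y_continuous)

text \<open>For l \<noteq> m the kernel of degree \<open>l\<close> annihilates \<open>Y m k\<close>.
  By the addition theorem this is a linear relation among the functions \<open>Y l i\<close> whose
  coefficients are the inner products in question; pairing with \<open>Y l j\<close> isolates each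
  of them.\<close>

lemma Y_orthonormal_all:
  assumes j: "j \<in> orders l" and k: "k \<in> orders m"
  shows "L2_inner (Y l j) (Y m k) = (if l = m \<and> j = k then 1 else 0)"
proof (cases "l = m")
  case True
  then show ?thesis using j k by (simp add: Y_orthonormal)
next
  case False
  define c where "c = (\<lambda>i. L2_inner (Y l i) (Y m k))"
  have z: "(\<Sum>i\<in>orders l. c i * Y l i x) = 0" if x: "x \<in> S2" for x
  proof -
    have "0 = (LINT y|\<sigma>. zonal l (x \<bullet> y) * Y m k y)"
      using zonal_reproducing[OF Y_harmonic[OF k] x, of l] False by (simp add: zonal_projection_def)
    also have "\<dots> = (LINT y|\<sigma>. (\<Sum>i\<in>orders l. Y l i x * (Y l i y * Y m k y)))"
      by (intro Bochner_Integration.integral_cong refl) (simp add: zonal_addition[OF x] sum_distrib_right mult.assoc)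
    also have "\<dots> = (\<Sum>i\<in>orders l. c i * Y l i x)"
      by (subst Bochner_Integration.integral_sum)
        (use k in \<open>auto intro!: Y_mult_integrable integrable_mult_right simp: c_def L2_inner_def mult.commute\<close>)
    finally show ?thesis by simp
  qed
  have "0 = (LINT x|\<sigma>. (\<Sum>i\<in>orders l. c i * Y l i x) * Y l j x)"
    by (subst Bochner_Integration.integral_cong[OF refl, where g = "\<lambda>x. 0"]) (auto simp: z)
  also have "\<dots> = (LINT x|\<sigma>. (\<Sum>i\<in>orders l. c i * (Y l i x * Y l j x)))"
    by (simp add: sum_distrib_right mult.assoc)
  also have "\<dots> = (\<Sum>i\<in>orders l. c i * L2_inner (Y l i) (Y l j))"
    by (subst Bochner_Integration.integral_sum)
      (use j in \<open>auto intro!: Y_mult_integrable integrable_mult_right simp: L2_inner_def\<close>)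
  also have "\<dots> = (\<Sum>i\<in>orders l. if i = j then c i else 0)"
    by (intro sum.cong refl) (use j in \<open>auto simp: Y_orthonormal\<close>)
  also have "\<dots> = c j" using j by simp
  finally show ?thesis using False by (simp add: c_def)
qed

lemma poisson_coefficient:
  assumes k: "k \<in> orders l" and x: "x \<in> S2" and r: "0 < r" "r < 1"
  shows "(LINT y|\<sigma>. poisson r (x \<bullet> y) * Y l k y) = r ^ l * Y l k x"
  using sums_zonal_projection[OF Y_integrable[OF k] _ x, of r] harmonic_radial_series[OF Y_harmonic[OF k] x r] r
  by (simp add: sums_iff)

lemma bessel_inequality:
  fixes g :: "real^3 \<Rightarrow> real"
  assumes g: "continuous_on S2 g" and T: "finite T"
  shows "(\<Sum>l\<in>T. \<Sum>k\<in>orders l. (L2_inner g (Y l k))\<^sup>2) \<le> (LINT x|\<sigma>. (g x)\<^sup>2)"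
proof -
  define S where "S = (SIGMA l:T. orders l)"
  have fS: "finite S" using T by (auto simp: S_def)
  define c where "c = (\<lambda>z. L2_inner g (Y (fst z) (snd z)))"
  define y where "y = (\<lambda>z. Y (fst z) (snd z))"
  have cy: "continuous_on S2 (y z)" if "z \<in> S" for z using that by (auto simp: S_def y_def intro!: Y_continuous)
  define p where "p = (\<lambda>x. \<Sum>z\<in>S. c z * y z x)"
  have cp: "continuous_on S2 p" unfolding p_def by (intro continuous_intros cy)
  have ig: "integrable \<sigma> (\<lambda>x. g x * y z x)" "(LINT x|\<sigma>. g x * y z x) = c z" if "z \<in> S" for z
    by (intro sphere_integrable_continuous continuous_on_mult g cy that) (simp add: c_def y_def L2_inner_def)
  have iy: "integrable \<sigma> (\<lambda>x. y z x * y w x)" if "z \<in> S" "w \<in> S" for z w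
    by (intro sphere_integrable_continuous continuous_on_mult cy that)
  have ip: "integrable \<sigma> (\<lambda>x. y z x * p x)" if "z \<in> S" for z
    by (intro sphere_integrable_continuous continuous_on_mult cy cp that)
  have gp: "(LINT x|\<sigma>. g x * p x) = (\<Sum>z\<in>S. (c z)\<^sup>2)"
  proof -
    have "(LINT x|\<sigma>. g x * p x) = (LINT x|\<sigma>. (\<Sum>z\<in>S. c z * (g x * y z x)))"
      by (simp add: p_def sum_distrib_left mult_ac)
    also have "\<dots> = (\<Sum>z\<in>S. c z * c z)"
      by (subst Bochner_Integration.integral_sum)
        (simp_all add: ig)
    finally show ?thesis by (simp add: power2_eq_square)
  qed
  have yp: "(LINT x|\<sigma>. y z x * p x) = c z" if z: "z \<in> S" for z
  proof -
    have "(LINT x|\<sigma>. y z x * p x) = (LINT x|\<sigma>. (\<Sum>w\<in>S. c w * (y w x * y z x)))"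
      by (simp add: p_def sum_distrib_left mult_ac)
    also have "\<dots> = (\<Sum>w\<in>S. c w * L2_inner (y w) (y z))"
      by (subst Bochner_Integration.integral_sum)
        (simp_all add: iy z L2_inner_def)
    also have "\<dots> = (\<Sum>w\<in>S. if w = z then c w else 0)"
    proof (rule sum.cong[OF refl])
      fix w assume "w \<in> S"
      then have "L2_inner (y w) (y z) = (if w = z then 1 else 0)"
        using z Y_orthonormal_all[of "snd w" "fst w" "snd z" "fst z"] by (auto simp: S_def y_def prod_eq_iff)
      then show "c w * L2_inner (y w) (y z) = (if w = z then c w else 0)" by simp
    qed
    also have "\<dots> = c z" using z fS by simp
    finally show ?thesis .
  qed
  have pp: "(LINT x|\<sigma>. p x * p x) = (\<Sum>z\<in>S. (c z)\<^sup>2)"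
  proof -
    have "(LINT x|\<sigma>. p x * p x) = (LINT x|\<sigma>. (\<Sum>z\<in>S. c z * (y z x * p x)))"
      by (simp add: p_def sum_distrib_right mult_ac)
    also have "\<dots> = (\<Sum>z\<in>S. c z * c z)"
      by (subst Bochner_Integration.integral_sum)
        (simp_all add: ip yp)
    finally show ?thesis by (simp add: power2_eq_square)
  qed
  have "0 \<le> (LINT x|\<sigma>. (g x - p x)\<^sup>2)" by (intro integral_nonneg_AE AE_I2) simp
  also have "\<dots> = (LINT x|\<sigma>. (g x)\<^sup>2 - 2 * (g x * p x) + p x * p x)"
    by (simp add: power2_eq_square algebra_simps)
  also have "\<dots> = (LINT x|\<sigma>. (g x)\<^sup>2) - 2 * (LINT x|\<sigma>. g x * p x) + (LINT x|\<sigma>. p x * p x)"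
  proof -
    have "integrable \<sigma> (\<lambda>x. (g x)\<^sup>2)" "integrable \<sigma> (\<lambda>x. g x * p x)"
      "integrable \<sigma> (\<lambda>x. p x * p x)"
      by (intro sphere_integrable_continuous continuous_on_mult continuous_on_power g cp)+
    then show ?thesis by simp
  qed
  finally have "(\<Sum>z\<in>S. (c z)\<^sup>2) \<le> (LINT x|\<sigma>. (g x)\<^sup>2)" by (simp add: gp pp)
  also have "(\<Sum>z\<in>S. (c z)\<^sup>2) = (\<Sum>l\<in>T. \<Sum>k\<in>orders l. (L2_inner g (Y l k))\<^sup>2)"
    unfolding S_def c_def by (subst sum.Sigma) (use T in \<open>auto simp: case_prod_unfold\<close>)
  finally show ?thesis .
qed

end

section \<open>Expansion of Sobolev functions\<close>

lemma integrable_mult_continuous_sphere: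
  fixes d \<phi> :: "real^3 \<Rightarrow> real"
  assumes d: "integrable \<sigma> d" and \<phi>: "continuous_on S2 \<phi>"
  shows "integrable \<sigma> (\<lambda>x. d x * \<phi> x)"
proof -
  obtain B where B: "B > 0" "\<And>x. x \<in> S2 \<Longrightarrow> \<bar>\<phi> x\<bar> \<le> B"
    by (rule continuous_on_bounded_sphere[OF \<phi>]) (rule that; blast)
  show ?thesis
  proof (rule Bochner_Integration.integrable_bound)
    show "integrable \<sigma> (\<lambda>x. B * d x)" using d by simp
    show "(\<lambda>x. d x * \<phi> x) \<in> borel_measurable \<sigma>"
      by (intro borel_measurable_times borel_measurable_integrable[OF d] borel_measurable_sphere_continuous[OF \<phi>])
    show "AE x in \<sigma>. norm (d x * \<phi> x) \<le> norm (B * d x)"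
    proof (rule AE_I2)
      fix x assume "x \<in> space \<sigma>"
      then have "\<bar>\<phi> x\<bar> \<le> B" using B by simp
      then have "\<bar>d x\<bar> * \<bar>\<phi> x\<bar> \<le> \<bar>d x\<bar> * B" by (intro mult_left_mono) auto
      then show "norm (d x * \<phi> x) \<le> norm (B * d x)" using B by (simp add: abs_mult mult.commute)
    qed
  qed
qed

text \<open>Indicators of closed sets are bounded pointwise limits of continuous functions, and
  closed sets form an intersection-stable generator of the Borel sets. Dynkin's theorem extends the
  vanishing to all Borel sets, and a density with zero integral over every measurable set is
  null.\<close>

lemma AE_zero_if_orthogonal_to_continuous:
  fixes d :: "real^3 \<Rightarrow> real"
  assumes d: "integrable \<sigma> d"
    and z: "\<And>\<phi>. continuous_on S2 \<phi> \<Longrightarrow> (LINT x|\<sigma>. d x * \<phi> x) = 0"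
  shows "AE x in \<sigma>. d x = 0"
proof -
  let ?P = "\<lambda>B. (LINT x|\<sigma>. d x * indicator B x) = 0"
  have meas: "indicator B \<in> borel_measurable \<sigma>" if "B \<in> sets borel" for B :: "(real^3) set"
    using that by (intro borel_measurable_indicator') (auto simp: sets_sphere_measure sets_restrict_space)
  have int: "integrable \<sigma> (\<lambda>x. d x * indicator B x)" if "B \<in> sets borel" for B
  proof (rule Bochner_Integration.integrable_bound[OF d])
    show "(\<lambda>x. d x * indicator B x) \<in> borel_measurable \<sigma>"
      by (intro borel_measurable_times borel_measurable_integrable[OF d] meas that)
    show "AE x in \<sigma>. norm (d x * indicator B x) \<le> norm (d x)"
      by (auto simp: indicator_def)
  qed
  have borel_sigma: "sigma_sets UNIV (Collect closed) = sets (borel :: (real^3) measure)"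
    unfolding borel_eq_closed by simp
  have Int_stable_closed: "Int_stable (Collect closed :: (real^3) set set)"
    by (auto simp: Int_stable_def)
  have subset_Pow_UNIV: "Collect closed \<subseteq> Pow (UNIV :: (real^3) set)" by simp
  have P: "?P B" if "B \<in> sets borel" for B
  proof -
    have "B \<in> sigma_sets UNIV (Collect closed)" using that by (simp only: borel_sigma)
    then show ?thesis
    proof (induction rule: sigma_sets_induct_disjoint[OF Int_stable_closed subset_Pow_UNIV,
        consumes 1, case_names basic empty compl union])
      case (basic C)
      then have C: "closed C" by simp
      show ?case
      \<comment> \<open>The empty set is separated because \<open>infdist\<close> to it is 0 by
        convention, so the cut-off functions below would be constantly 1.\<close>
      proof (cases "C = {}")
        case False
        define \<phi> where "\<phi> = (\<lambda>n x. max 0 (1 - real n * infdist x C))"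
        have "(\<lambda>n. LINT x|\<sigma>. d x * \<phi> n x) \<longlonglongrightarrow> (LINT x|\<sigma>. d x * indicator C x)"
        proof (rule integral_dominated_convergence[where w = "\<lambda>x. \<bar>d x\<bar>"])
          show "(\<lambda>x. d x * indicator C x) \<in> borel_measurable \<sigma>"
            using int[of C] C by auto
          show "(\<lambda>x. d x * \<phi> n x) \<in> borel_measurable \<sigma>" for n
            unfolding \<phi>_def
            by (intro borel_measurable_times borel_measurable_integrable[OF d] borel_measurable_sphere_continuous continuous_intros)
          show "integrable \<sigma> (\<lambda>x. \<bar>d x\<bar>)" using d by simp
          show "AE x in \<sigma>. (\<lambda>n. d x * \<phi> n x) \<longlonglongrightarrow> d x * indicator C x"
          proof (intro AE_I2 tendsto_mult_left)
            fix x
            show "(\<lambda>n. \<phi> n x) \<longlonglongrightarrow> indicator C x"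
            proof (cases "x \<in> C")
              case True
              then show ?thesis by (simp add: \<phi>_def)
            next
              case x: False
              then have pos: "infdist x C > 0"
                using in_closed_iff_infdist_zero[OF C False, of x] infdist_nonneg[of x C] by linarith
              obtain n0 where n0: "real n0 * infdist x C > 1" using reals_Archimedean3[OF pos] by blast
              have "\<phi> n x = 0" if "n \<ge> n0" for n
              proof -
                have "real n0 * infdist x C \<le> real n * infdist x C" using that pos by (intro mult_right_mono) auto
                then show ?thesis using n0 by (simp add: \<phi>_def)
              qed
              then have "eventually (\<lambda>n. \<phi> n x = 0) sequentially" by (auto simp: eventually_sequentially)
              then show ?thesis using x by (simp add: tendsto_eventually)
            qed
          qed
          show "AE x in \<sigma>. norm (d x * \<phi> n x) \<le> \<bar>d x\<bar>" for n
          proof (rule AE_I2)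
            fix x
            have "\<bar>\<phi> n x\<bar> \<le> 1" using infdist_nonneg[of x C] by (simp add: \<phi>_def)
            then have "\<bar>d x\<bar> * \<bar>\<phi> n x\<bar> \<le> \<bar>d x\<bar> * 1" by (intro mult_left_mono) auto
            then show "norm (d x * \<phi> n x) \<le> \<bar>d x\<bar>" by (simp add: abs_mult)
          qed
        qed
        moreover have "(LINT x|\<sigma>. d x * \<phi> n x) = 0" for n
          by (rule z) (unfold \<phi>_def, intro continuous_intros)
        ultimately show ?thesis by (simp add: LIMSEQ_const_iff)
      qed simp
    next
      case empty
      then show ?case by simp
    next
      case (compl A)
      then have A: "A \<in> sets borel" by (simp only: borel_sigma)
      have "(LINT x|\<sigma>. d x * indicator (UNIV - A) x) = (LINT x|\<sigma>. d x * 1 - d x * indicator A x)"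
        by (intro Bochner_Integration.integral_cong) (auto simp: indicator_def)
      also have "\<dots> = (LINT x|\<sigma>. d x * 1) - (LINT x|\<sigma>. d x * indicator A x)"
        using d int[OF A] by simp
      also have "\<dots> = 0" using z[of "\<lambda>x. 1"] compl by simp
      finally show ?case .
    next
      case (union A)
      have A: "A i \<in> sets borel" for i using union(2) by (auto simp only: borel_sigma)
      have "(\<lambda>i. LINT x|\<sigma>. d x * indicator (\<Union>j<i. A j) x) \<longlonglongrightarrow> (LINT x|\<sigma>. d x * indicator (\<Union>i. A i) x)"
      proof (rule integral_dominated_convergence[where w = "\<lambda>x. \<bar>d x\<bar>"])
        show "(\<lambda>x. d x * indicator (\<Union>i. A i) x) \<in> borel_measurable \<sigma>"
          using int[of "\<Union>i. A i"] A by auto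
        show "(\<lambda>x. d x * indicator (\<Union>j<i. A j) x) \<in> borel_measurable \<sigma>" for i
          using int[of "\<Union>j<i. A j"] A by auto
        show "integrable \<sigma> (\<lambda>x. \<bar>d x\<bar>)" using d by simp
        show "AE x in \<sigma>. (\<lambda>i. d x * indicator (\<Union>j<i. A j) x) \<longlonglongrightarrow> d x * indicator (\<Union>i. A i) x"
        proof (intro AE_I2 tendsto_mult_left)
          fix x
          show "(\<lambda>i. indicator (\<Union>j<i. A j) x) \<longlonglongrightarrow> (indicator (\<Union>i. A i) x :: real)"
            by (rule LIMSEQ_indicator_UN)
        qed
        show "AE x in \<sigma>. norm (d x * indicator (\<Union>j<i. A j) x) \<le> \<bar>d x\<bar>" for i
          by (auto simp: indicator_def)
      qed
      moreover have "(LINT x|\<sigma>. d x * indicator (\<Union>j<i. A j) x) = 0" for i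
      proof -
        have "(LINT x|\<sigma>. d x * indicator (\<Union>j<i. A j) x) = (LINT x|\<sigma>. (\<Sum>j<i. d x * indicator (A j) x))"
        proof (rule Bochner_Integration.integral_cong[OF refl])
          fix x
          have "disjoint_family_on A {..<i}" using union(1) by (rule disjoint_family_on_mono[rotated]) simp
          then have "indicator (\<Union>j<i. A j) x = (\<Sum>j<i. indicator (A j) x :: real)"
            by (subst indicator_UN_disjoint) auto
          then show "d x * indicator (\<Union>j<i. A j) x = (\<Sum>j<i. d x * indicator (A j) x)"
            by (simp add: sum_distrib_left)
        qed
        also have "\<dots> = 0"
          by (subst Bochner_Integration.integral_sum) (use int[OF A] union(3) in simp_all)
        finally show ?thesis .
      qed
      ultimately show ?case by (simp add: LIMSEQ_const_iff)
    qed
  qed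
  show ?thesis
  proof (rule sphere.density_zero[OF d])
    fix A assume "A \<in> sets \<sigma>"
    then obtain B where B: "B \<in> sets borel" "A = S2 \<inter> B"
      by (auto simp: sets_sphere_measure sets_restrict_space)
    have "set_lebesgue_integral \<sigma> A d = (LINT x|\<sigma>. d x * indicator B x)"
      unfolding set_lebesgue_integral_def
      by (intro Bochner_Integration.integral_cong) (auto simp: B indicator_def)
    then show "set_lebesgue_integral \<sigma> A d = 0" using P[OF B(1)] by simp
  qed
qed

lemma L2_sphere_integrable:
  assumes "f \<in> L2_sphere" shows "integrable \<sigma> f"
proof (rule Bochner_Integration.integrable_bound)
  show "integrable \<sigma> (\<lambda>x. 1 + (f x)\<^sup>2)" using assms by (simp add: L2_sphere_def)
  show "f \<in> borel_measurable \<sigma>" using assms by (simp add: L2_sphere_def)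
  have "\<bar>t\<bar> \<le> 1 + t\<^sup>2" for t :: real
    using sum_squares_bound[of 1 "\<bar>t\<bar>"] by (simp add: power2_eq_square)
  then show "AE x in \<sigma>. norm (f x) \<le> norm (1 + (f x)\<^sup>2)" by simp
qed

text \<open>From (l + 1)^2 / 2 <= 1 + l (l + 1) the terms are of order (l + 1) powr (1 - 2 s). This
  is the condition s > 1 of the embedding into continuous functions.\<close>

lemma summable_sobolev_weight:
  assumes s: "1 < s"
  shows "summable (\<lambda>l. (2 * real l + 1) / (1 + eigenvalue l) powr s)"
proof (rule summable_comparison_test')
  have "summable (\<lambda>l. real (l + 1) powr (1 - 2 * s))"
    using s by (subst summable_iff_shift[of "\<lambda>l. real l powr (1 - 2 * s)" 1]) (simp add: summable_real_powr_iff)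
  then show "summable (\<lambda>l. 2 * 2 powr s * real (l + 1) powr (1 - 2 * s))" by (rule summable_mult)
  fix l :: nat
  define n where "n = real (l + 1)"
  have n: "n \<ge> 1" by (simp add: n_def)
  have "n\<^sup>2 / 2 \<le> 1 + eigenvalue l"
    by (simp add: n_def eigenvalue_def power2_eq_square field_simps)
  then have "(n\<^sup>2 / 2) powr s \<le> (1 + eigenvalue l) powr s" using s n by (intro powr_mono2) auto
  moreover have "(n\<^sup>2 / 2) powr s = n powr (2 * s) / 2 powr s"
    using n by (simp add: powr_divide powr_powr flip: powr_numeral)
  ultimately have le: "n powr (2 * s) / 2 powr s \<le> (1 + eigenvalue l) powr s" by simp
  have "(2 * real l + 1) / (1 + eigenvalue l) powr s \<le> 2 * n / (n powr (2 * s) / 2 powr s)"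
    by (rule frac_le) (use le n in \<open>auto simp: n_def\<close>)
  also have "\<dots> = 2 * 2 powr s * n powr (1 - 2 * s)"
    using n by (simp add: powr_diff)
  finally show "norm ((2 * real l + 1) / (1 + eigenvalue l) powr s) \<le> 2 * 2 powr s * real (l + 1) powr (1 - 2 * s)"
    by (simp add: n_def)
qed

lemma one_add_eigenvalue_pos: "0 < 1 + eigenvalue l"
  by (simp add: eigenvalue_def add_pos_nonneg)

context spherical_harmonic_basis
begin

text \<open>A continuous function is a uniform limit of truncated Abel sums, which lie in the span
  of the basis. Hence \<open>d\<close> is orthogonal to all continuous functions.\<close>

lemma orthogonal_to_basis_AE_zero:
  assumes d: "integrable \<sigma> d"
    and o: "\<And>l k. k \<in> orders l \<Longrightarrow> L2_inner d (Y l k) = 0"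
  shows "AE x in \<sigma>. d x = 0"
proof (rule AE_zero_if_orthogonal_to_continuous[OF d])
  fix \<phi> :: "real^3 \<Rightarrow> real" assume \<phi>: "continuous_on S2 \<phi>"
  obtain b where "\<forall>m. \<forall>x\<in>S2. zonal_projection m \<phi> x = (\<Sum>k\<in>orders m. b m k * Y m k x)"
    using zonal_projection_coeffs[OF sphere_integrable_continuous[OF \<phi>]] by blast
  then have b: "zonal_projection m \<phi> x = (\<Sum>k\<in>orders m. b m k * Y m k x)" if "x \<in> S2" for m x
    using that by blast
  define g where "g = (\<lambda>m x. \<Sum>k\<in>orders m. b m k * Y m k x)"
  have cg: "continuous_on S2 (g m)" for m
    unfolding g_def by (intro continuous_on_sum continuous_on_mult continuous_on_const Y_continuous)
  have dg: "(LINT x|\<sigma>. d x * g m x) = 0" for m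
  proof -
    have "(LINT x|\<sigma>. d x * g m x) = (LINT x|\<sigma>. (\<Sum>k\<in>orders m. b m k * (d x * Y m k x)))"
      by (simp add: g_def sum_distrib_left mult_ac)
    also have "\<dots> = (\<Sum>k\<in>orders m. b m k * L2_inner d (Y m k))"
      unfolding L2_inner_def
      by (subst Bochner_Integration.integral_sum)
        (auto intro!: integrable_mult_right integrable_mult_continuous_sphere[OF d Y_continuous])
    finally show ?thesis by (simp add: o)
  qed
  define D where "D = (LINT x|\<sigma>. \<bar>d x\<bar>)"
  have D: "D \<ge> 0" unfolding D_def by (intro integral_nonneg_AE AE_I2) simp
  have le: "\<bar>LINT x|\<sigma>. d x * \<phi> x\<bar> \<le> e * D" if e: "0 < e" for e
  proof -
    obtain r M where M: "\<And>x. x \<in> S2 \<Longrightarrow> \<bar>\<phi> x - (\<Sum>m<M. r ^ m * g m x)\<bar> \<le> e"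
    proof (rule poisson_partial_sums[OF \<phi> e])
      fix r0 :: real assume "r0 < 1" and "\<And>r. r0 \<le> r \<Longrightarrow> r < 1 \<Longrightarrow> \<exists>M. \<forall>x\<in>S2.
        \<bar>\<phi> x - (\<Sum>m<M. r ^ m * zonal_projection m \<phi> x)\<bar> \<le> e \<and>
        (\<forall>q. 0 < q \<longrightarrow> q \<le> 1 \<longrightarrow>
          \<bar>(\<Sum>m<M. (q * r) ^ m * zonal_projection m \<phi> x) - (\<Sum>m. (q * r) ^ m * zonal_projection m \<phi> x)\<bar> \<le> e)"
      then obtain M where "\<forall>x\<in>S2. \<bar>\<phi> x - (\<Sum>m<M. r0 ^ m * zonal_projection m \<phi> x)\<bar> \<le> e" by blast
      then show thesis using that[of r0 M] by (simp add: b g_def)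
    qed
    define p where "p = (\<lambda>x. \<Sum>m<M. r ^ m * g m x)"
    have cp: "continuous_on S2 p"
      unfolding p_def by (intro continuous_on_sum continuous_on_mult continuous_on_const cg)
    have "(LINT x|\<sigma>. d x * p x) = (LINT x|\<sigma>. (\<Sum>m<M. r ^ m * (d x * g m x)))"
      by (simp add: p_def sum_distrib_left mult_ac)
    also have "\<dots> = 0"
      by (subst Bochner_Integration.integral_sum)
        (auto intro!: integrable_mult_right integrable_mult_continuous_sphere[OF d cg] simp: dg)
    finally have dp: "(LINT x|\<sigma>. d x * p x) = 0" .
    have i: "integrable \<sigma> (\<lambda>x. d x * \<phi> x)" "integrable \<sigma> (\<lambda>x. d x * p x)"
      by (intro integrable_mult_continuous_sphere d \<phi> cp)+
    have "\<bar>LINT x|\<sigma>. d x * \<phi> x\<bar> = \<bar>LINT x|\<sigma>. d x * \<phi> x - d x * p x\<bar>"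
      using i dp by simp
    also have "\<dots> \<le> (LINT x|\<sigma>. \<bar>d x * \<phi> x - d x * p x\<bar>)" by (rule integral_abs_bound)
    also have "\<dots> \<le> (LINT x|\<sigma>. e * \<bar>d x\<bar>)"
    proof (rule integral_mono)
      fix x assume "x \<in> space \<sigma>"
      then have "\<bar>\<phi> x - p x\<bar> \<le> e" using M[of x] by (simp add: p_def)
      then have "\<bar>d x\<bar> * \<bar>\<phi> x - p x\<bar> \<le> \<bar>d x\<bar> * e" by (intro mult_left_mono) auto
      moreover have "\<bar>d x * \<phi> x - d x * p x\<bar> = \<bar>d x\<bar> * \<bar>\<phi> x - p x\<bar>"
        by (simp only: right_diff_distrib[symmetric] abs_mult)
      ultimately show "\<bar>d x * \<phi> x - d x * p x\<bar> \<le> e * \<bar>d x\<bar>"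
        by (simp only: mult.commute)
    qed (use i d in auto)
    also have "\<dots> = e * D" by (simp add: D_def)
    finally show ?thesis .
  qed
  have "\<bar>LINT x|\<sigma>. d x * \<phi> x\<bar> \<le> 0"
  proof (rule field_le_epsilon)
    fix e :: real assume e: "0 < e"
    have "\<bar>LINT x|\<sigma>. d x * \<phi> x\<bar> \<le> e / (D + 1) * D" by (rule le) (use e D in auto)
    also have "\<dots> \<le> 0 + e" using e D by (simp add: field_simps)
    finally show "\<bar>LINT x|\<sigma>. d x * \<phi> x\<bar> \<le> 0 + e" .
  qed
  then show "(LINT x|\<sigma>. d x * \<phi> x) = 0" by simp
qed

text \<open>The Poisson integral of a null function is 0, yet it approximates \<open>h\<close> at
  every point; no statement about the measure of open sets is involved.\<close>

lemma continuous_AE_zero_imp_zero: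
  fixes h :: "real^3 \<Rightarrow> real"
  assumes h: "continuous_on S2 h" and ae: "AE x in \<sigma>. h x = 0" and x: "x \<in> S2"
  shows "h x = 0"
proof -
  have "\<bar>h x\<bar> \<le> 0"
  proof (rule field_le_epsilon)
    fix e :: real assume e: "0 < e"
    obtain r0 where r0: "1 / 2 \<le> r0" "r0 < 1"
      "\<And>r x. r0 \<le> r \<Longrightarrow> r < 1 \<Longrightarrow> x \<in> S2 \<Longrightarrow> \<bar>(LINT y|\<sigma>. poisson r (x \<bullet> y) * h y) - h x\<bar> \<le> e"
      by (rule poisson_integral_approx[OF h e]) (rule that; blast)
    have "(LINT y|\<sigma>. poisson r0 (x \<bullet> y) * h y) = 0"
      by (rule integral_eq_zero_AE) (use ae in auto)
    then show "\<bar>h x\<bar> \<le> 0 + e" using r0(3)[OF order_refl r0(2) x] by simp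
  qed
  then show ?thesis by simp
qed

section \<open>Uniform convergence of the harmonic expansion for s > 1\<close>

definition component :: "(real^3 \<Rightarrow> real) \<Rightarrow> nat \<Rightarrow> real^3 \<Rightarrow> real" where
  "component f l x = (\<Sum>k\<in>orders l. L2_inner f (Y l k) * Y l k x)"

lemma continuous_on_component: "continuous_on S2 (component f l)"
  unfolding component_def by (intro continuous_on_sum continuous_on_mult continuous_on_const Y_continuous)

text \<open>Weighted arithmetic-geometric mean, |a b| <= (w a^2 + b^2 / w) / 2 with w the Sobolev
  weight, summed over the orders. The sum of squares of the basis functions is constant on the
  sphere, so the majorant does not depend on \<open>x\<close>.\<close>

lemma abs_component_le:
  assumes x: "x \<in> S2"
  shows "\<bar>component f l x\<bar> \<le> (sobolev_term Y s f l + (2 * real l + 1) / (1 + eigenvalue l) powr s) / 2"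
proof -
  define w where "w = (1 + eigenvalue l) powr s"
  have w: "w > 0" using one_add_eigenvalue_pos[of l] by (simp add: w_def)
  have "\<bar>component f l x\<bar> \<le> (\<Sum>k\<in>orders l. \<bar>L2_inner f (Y l k) * Y l k x\<bar>)"
    unfolding component_def by (rule sum_abs)
  also have "\<dots> \<le> (\<Sum>k\<in>orders l. (w * \<bar>L2_inner f (Y l k)\<bar>\<^sup>2 + (Y l k x)\<^sup>2 / w) / 2)"
  proof (rule sum_mono)
    fix k
    define u v where "u = \<bar>L2_inner f (Y l k)\<bar>" and "v = \<bar>Y l k x\<bar>"
    have "0 \<le> (w * u - v)\<^sup>2" by simp
    then have "2 * (w * (u * v)) \<le> w * (w * u\<^sup>2 + v\<^sup>2 / w)" using w by (simp add: power2_eq_square algebra_simps)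
    then have "2 * (u * v) \<le> w * u\<^sup>2 + v\<^sup>2 / w" using w by (simp add: mult.left_commute[of 2])
    then show "\<bar>L2_inner f (Y l k) * Y l k x\<bar> \<le> (w * \<bar>L2_inner f (Y l k)\<bar>\<^sup>2 + (Y l k x)\<^sup>2 / w) / 2"
      by (simp add: u_def v_def abs_mult)
  qed
  also have "\<dots> = (sobolev_term Y s f l + (\<Sum>k\<in>orders l. (Y l k x)\<^sup>2) / w) / 2"
    unfolding sobolev_term_def w_def[symmetric] by (simp add: sum_divide_distrib[symmetric] sum.distrib)
  finally show ?thesis by (simp add: sum_Y_squares[OF x] w_def)
qed

text \<open>The majorant makes the series uniformly convergent, hence continuous and integrable term
  by term against each basis function. The sum has the coefficients of \<open>f\<close>, and
  completeness identifies the two almost everywhere.\<close>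

lemma sobolev_expansion:
  assumes s: "1 < s" and f: "f \<in> sobolev_space Y s"
  shows "continuous_on S2 (\<lambda>x. \<Sum>l. component f l x)"
    and "x \<in> S2 \<Longrightarrow> summable (\<lambda>l. component f l x)"
    and "AE x in \<sigma>. (\<Sum>l. component f l x) = f x"
proof -
  define M where "M = (\<lambda>l. (sobolev_term Y s f l + (2 * real l + 1) / (1 + eigenvalue l) powr s) / 2)"
  have sM: "summable M"
    unfolding M_def using f by (intro summable_divide summable_add summable_sobolev_weight s) (auto simp: sobolev_space_def)
  have cM: "\<bar>component f l x\<bar> \<le> M l" if "x \<in> S2" for l x
    unfolding M_def by (rule abs_component_le[OF that])
  define g where "g = (\<lambda>x. \<Sum>l. component f l x)"
  have sc: "summable (\<lambda>l. component f l x)" if "x \<in> S2" for x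
    by (rule summable_comparison_test'[OF sM, of 0]) (use cM[OF that] in auto)
  then show "x \<in> S2 \<Longrightarrow> summable (\<lambda>l. component f l x)" .
  have "uniform_limit S2 (\<lambda>n x. \<Sum>l<n. component f l x) g sequentially"
    unfolding g_def by (rule Weierstrass_m_test[OF _ sM]) (use cM in auto)
  moreover have "\<forall>\<^sub>F n in sequentially. continuous_on S2 (\<lambda>x. \<Sum>l<n. component f l x)"
    by (intro always_eventually allI continuous_on_sum continuous_on_component)
  ultimately have cg: "continuous_on S2 g"
    by (intro uniform_limit_theorem[where F = sequentially and f = "\<lambda>n x. \<Sum>l<n. component f l x"]) auto
  then show "continuous_on S2 (\<lambda>x. \<Sum>l. component f l x)" by (simp add: g_def)
  have fi: "integrable \<sigma> f" using f by (simp add: sobolev_space_def L2_sphere_integrable)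
  have gi: "integrable \<sigma> g" by (rule sphere_integrable_continuous[OF cg])
  have gY: "L2_inner g (Y m k) = L2_inner f (Y m k)" if k: "k \<in> orders m" for m k
  proof -
    obtain B where B: "B > 0" "\<And>x. x \<in> S2 \<Longrightarrow> \<bar>Y m k x\<bar> \<le> B"
      by (rule continuous_on_bounded_sphere[OF Y_continuous[OF k]]) (rule that; blast)
    have ci: "integrable \<sigma> (\<lambda>x. component f l x * Y m k x)" for l
      by (intro sphere_integrable_continuous continuous_on_mult continuous_on_component Y_continuous k)
    have bd: "\<bar>component f l x * Y m k x\<bar> \<le> M l * B" if "x \<in> S2" for l x
      unfolding abs_mult using cM[OF that, of l] B(2)[OF that] by (intro mult_mono) auto
    have sMB: "summable (\<lambda>l. M l * B)" using sM by (rule summable_mult2)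
    have "(\<lambda>l. LINT x|\<sigma>. component f l x * Y m k x) sums (LINT x|\<sigma>. (\<Sum>l. component f l x * Y m k x))"
    proof (rule sums_integral[OF ci])
      show "AE x in \<sigma>. summable (\<lambda>l. norm (component f l x * Y m k x))"
      proof (rule AE_I2)
        fix x assume "x \<in> space \<sigma>"
        then have x: "x \<in> S2" by simp
        show "summable (\<lambda>l. norm (component f l x * Y m k x))"
          by (rule summable_comparison_test'[OF sMB, of 0]) (use bd[OF x] in auto)
      qed
      show "summable (\<lambda>l. LINT x|\<sigma>. norm (component f l x * Y m k x))"
      proof (rule summable_comparison_test'[OF sMB, of 0])
        fix l :: nat
        have "(LINT x|\<sigma>. norm (component f l x * Y m k x)) \<le> (LINT x|\<sigma>. M l * B)"
          using bd ci[of l] by (intro integral_mono) auto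
        moreover have "0 \<le> (LINT x|\<sigma>. norm (component f l x * Y m k x))"
          by (intro integral_nonneg_AE AE_I2) simp
        ultimately show "norm (LINT x|\<sigma>. norm (component f l x * Y m k x)) \<le> M l * B" by simp
      qed
    qed
    moreover have "(LINT x|\<sigma>. (\<Sum>l. component f l x * Y m k x)) = L2_inner g (Y m k)"
      unfolding L2_inner_def g_def
      by (intro Bochner_Integration.integral_cong refl suminf_mult2[symmetric] sc) simp
    moreover have "(LINT x|\<sigma>. component f l x * Y m k x) = (if l = m then L2_inner f (Y m k) else 0)" for l
    proof -
      have "(LINT x|\<sigma>. component f l x * Y m k x) = (LINT x|\<sigma>. (\<Sum>j\<in>orders l. L2_inner f (Y l j) * (Y l j x * Y m k x)))"
        by (simp add: component_def sum_distrib_right mult.assoc)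
      also have "\<dots> = (\<Sum>j\<in>orders l. L2_inner f (Y l j) * L2_inner (Y l j) (Y m k))"
        unfolding L2_inner_def[of "Y _ _" "Y _ _"]
        by (subst Bochner_Integration.integral_sum) (use k in \<open>auto intro!: Y_mult_integrable\<close>)
      also have "\<dots> = (\<Sum>j\<in>orders l. if l = m \<and> j = k then L2_inner f (Y m k) else 0)"
      proof (rule sum.cong[OF refl])
        fix j assume "j \<in> orders l"
        then show "L2_inner f (Y l j) * L2_inner (Y l j) (Y m k) = (if l = m \<and> j = k then L2_inner f (Y m k) else 0)"
          using Y_orthonormal_all[of j l k m] k by auto
      qed
      also have "\<dots> = (if l = m then L2_inner f (Y m k) else 0)" using k by (cases "l = m") auto
      finally show ?thesis .
    qed
    ultimately have "(\<lambda>l. if l = m then L2_inner f (Y m k) else 0) sums L2_inner g (Y m k)" by simp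
    then show ?thesis using sums_single[of m "\<lambda>_. L2_inner f (Y m k)"] sums_unique2 by metis
  qed
  have "AE x in \<sigma>. g x - f x = 0"
  proof (rule orthogonal_to_basis_AE_zero)
    show "integrable \<sigma> (\<lambda>x. g x - f x)" using fi gi by simp
    fix l k assume k: "k \<in> orders l"
    have i: "integrable \<sigma> (\<lambda>x. g x * Y l k x)" "integrable \<sigma> (\<lambda>x. f x * Y l k x)"
      by (intro integrable_mult_continuous_sphere fi gi Y_continuous k)+
    have "L2_inner (\<lambda>x. g x - f x) (Y l k) = (LINT x|\<sigma>. g x * Y l k x - f x * Y l k x)"
      by (simp add: L2_inner_def left_diff_distrib)
    also have "\<dots> = L2_inner g (Y l k) - L2_inner f (Y l k)"
      using i by (simp add: L2_inner_def)
    finally show "L2_inner (\<lambda>x. g x - f x) (Y l k) = 0" using gY[OF k] by simp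
  qed
  then show "AE x in \<sigma>. (\<Sum>l. component f l x) = f x" by (simp add: g_def)
qed

text \<open>The series shows that the choice in \<open>continuous_rep\<close> has a witness;
  continuous functions equal almost everywhere agree on the whole sphere, so every choice gives the
  same values.\<close>

lemma continuous_rep_sobolev:
  assumes s: "1 < s" and f: "f \<in> sobolev_space Y s" and x: "x \<in> S2"
  shows "continuous_rep f x = (\<Sum>l. component f l x)"
proof -
  let ?g = "\<lambda>x. \<Sum>l. component f l x"
  note g = sobolev_expansion[OF s f]
  have c: "continuous_on S2 (continuous_rep f)" "AE x in \<sigma>. continuous_rep f x = f x"
    using someI[of "\<lambda>g. continuous_on S2 g \<and> (AE x in \<sigma>. g x = f x)" ?g] g(1,3)
    unfolding continuous_rep_def by auto
  have "continuous_rep f x - ?g x = 0"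
  proof (rule continuous_AE_zero_imp_zero[OF _ _ x])
    show "continuous_on S2 (\<lambda>x. continuous_rep f x - ?g x)" by (intro continuous_on_diff c g)
    show "AE x in \<sigma>. continuous_rep f x - ?g x = 0"
      using c(2) g(3) by eventually_elim simp
  qed
  then show ?thesis by simp
qed

end

section \<open>Reduction to the discrepancy of the Poisson kernel\<close>

definition poisson_discrepancy :: "(real^3) set \<Rightarrow> real \<Rightarrow> real^3 \<Rightarrow> real" where
  "poisson_discrepancy P r z = 1 / real (card P) * (\<Sum>x\<in>P. poisson r (x \<bullet> z)) - 1"

context spherical_harmonic_basis
begin

definition quadrature_mean :: "(real^3) set \<Rightarrow> nat \<Rightarrow> int \<Rightarrow> real" where
  "quadrature_mean P l k = 1 / real (card P) * (\<Sum>x\<in>P. Y l k x)"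

lemma component_0_eq_integral:
  assumes f: "integrable \<sigma> f" and x: "x \<in> S2"
  shows "component f 0 x = (LINT y|\<sigma>. f y)"
proof -
  have YY: "Y 0 0 x * Y 0 0 y = 1" if "y \<in> S2" for y
    using zonal_addition[OF x that, of 0] by (simp add: zonal_def)
  have "component f 0 x = (LINT y|\<sigma>. f y * Y 0 0 y) * Y 0 0 x"
    by (simp add: component_def L2_inner_def)
  also have "\<dots> = (LINT y|\<sigma>. f y * Y 0 0 y * Y 0 0 x)" by simp
  also have "\<dots> = (LINT y|\<sigma>. f y)"
  proof (rule Bochner_Integration.integral_cong[OF refl])
    fix y assume "y \<in> space \<sigma>"
    then have "Y 0 0 x * Y 0 0 y = 1" using YY by simp
    then have "Y 0 0 y * Y 0 0 x = 1" by (simp add: mult.commute)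
    then show "f y * Y 0 0 y * Y 0 0 x = f y" by (simp only: mult.assoc mult_1_right)
  qed
  finally show ?thesis .
qed

text \<open>Degree 0 reproduces the integral exactly, so only degrees from 1 on contribute.
  Cauchy--Schwarz, with the weight split as square roots, is applied to partial sums and the limit
  taken last; hence \<open>W\<close> has to dominate finite sums only.\<close>

lemma sobolev_quadrature_error:
  assumes s: "1 < s" and f: "f \<in> sobolev_space Y s" and n1: "sobolev_norm Y s f \<le> 1"
    and P: "finite P" "P \<subseteq> S2" "P \<noteq> {}"
    and W: "\<And>L. (\<Sum>l\<in>{1..<L}. (\<Sum>k\<in>orders l. (quadrature_mean P l k)\<^sup>2) / (1 + eigenvalue l) powr s) \<le> W"
  shows "\<bar>1 / real (card P) * (\<Sum>x\<in>P. continuous_rep f x) - (LINT x|\<sigma>. f x)\<bar> \<le> sqrt W"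
proof -
  define w where "w = (\<lambda>l. (1 + eigenvalue l) powr s)"
  have w: "w l > 0" for l using one_add_eigenvalue_pos[of l] by (simp add: w_def)
  define c where "c = (\<lambda>l k. L2_inner f (Y l k))"
  define e where "e = quadrature_mean P"
  define q where "q = (\<lambda>l. \<Sum>k\<in>orders l. c l k * e l k)"
  have N: "real (card P) > 0" using P by (simp add: card_gt_0_iff)
  have q_eq: "q l = 1 / real (card P) * (\<Sum>x\<in>P. component f l x)" for l
    unfolding q_def c_def e_def quadrature_mean_def component_def
    by (subst sum.swap) (simp add: sum_distrib_left sum_distrib_right sum_divide_distrib mult_ac)
  have "(\<lambda>l. 1 / real (card P) * (\<Sum>x\<in>P. component f l x)) sums (1 / real (card P) * (\<Sum>x\<in>P. \<Sum>l. component f l x))"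
    using sobolev_expansion(2)[OF s f] P by (intro sums_mult sums_sum summable_sums) auto
  also have "(\<Sum>x\<in>P. \<Sum>l. component f l x) = (\<Sum>x\<in>P. continuous_rep f x)"
    using continuous_rep_sobolev[OF s f] P by (intro sum.cong) auto
  finally have "q sums (1 / real (card P) * (\<Sum>x\<in>P. continuous_rep f x))" unfolding q_eq[symmetric] .
  moreover have "q 0 = (LINT x|\<sigma>. f x)"
  proof -
    have "integrable \<sigma> f" using f by (simp add: sobolev_space_def L2_sphere_integrable)
    then have "(\<Sum>x\<in>P. component f 0 x) = (\<Sum>x\<in>P. (LINT x|\<sigma>. f x))"
      using P by (intro sum.cong component_0_eq_integral) auto
    then show ?thesis using N by (simp add: q_eq)
  qed
  ultimately have "(\<lambda>l. q (Suc l)) sums (1 / real (card P) * (\<Sum>x\<in>P. continuous_rep f x) - (LINT x|\<sigma>. f x))"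
    by (subst sums_Suc_iff) simp
  then have lim: "(\<lambda>n. \<bar>\<Sum>l<n. q (Suc l)\<bar>) \<longlonglongrightarrow> \<bar>1 / real (card P) * (\<Sum>x\<in>P. continuous_rep f x) - (LINT x|\<sigma>. f x)\<bar>"
    unfolding sums_def by (rule tendsto_rabs)
  have "\<bar>\<Sum>l<n. q (Suc l)\<bar> \<le> sqrt W" for n
  proof -
    define T where "T = {1..<Suc n}"
    define S where "S = (SIGMA l:T. orders l)"
    define a where "a = (\<lambda>z. sqrt (w (fst z)) * c (fst z) (snd z))"
    define b where "b = (\<lambda>z. e (fst z) (snd z) / sqrt (w (fst z)))"
    have fT: "finite T" by (simp add: T_def)
    have Sg: "(\<Sum>z\<in>S. h (fst z) (snd z)) = (\<Sum>l\<in>T. \<Sum>k\<in>orders l. h l k)" for h :: "nat \<Rightarrow> int \<Rightarrow> real"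
      unfolding S_def by (subst sum.Sigma) (use fT in \<open>auto simp: case_prod_unfold\<close>)
    have "(\<Sum>l<n. q (Suc l)) = (\<Sum>l\<in>T. q l)"
      unfolding T_def by (simp add: sum.atLeast_Suc_lessThan_Suc_shift lessThan_atLeast0 del: sum.op_ivl_Suc)
    also have "\<dots> = (\<Sum>z\<in>S. c (fst z) (snd z) * e (fst z) (snd z))"
      unfolding q_def by (rule Sg[symmetric])
    also have "\<dots> = (\<Sum>z\<in>S. a z * b z)"
      by (intro sum.cong refl) (use w in \<open>simp add: a_def b_def less_imp_neq[symmetric]\<close>)
    finally have eq: "(\<Sum>l<n. q (Suc l)) = (\<Sum>z\<in>S. a z * b z)" .
    have a1: "(\<Sum>z\<in>S. (a z)\<^sup>2) \<le> 1"
    proof -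
      have "(\<Sum>z\<in>S. (a z)\<^sup>2) = (\<Sum>z\<in>S. w (fst z) * (c (fst z) (snd z))\<^sup>2)"
        using w by (intro sum.cong refl) (simp add: a_def power_mult_distrib less_imp_le)
      also have "\<dots> = (\<Sum>l\<in>T. \<Sum>k\<in>orders l. w l * (c l k)\<^sup>2)" by (rule Sg)
      also have "\<dots> = (\<Sum>l\<in>T. sobolev_term Y s f l)"
        by (simp add: sobolev_term_def w_def c_def)
      also have "\<dots> \<le> (\<Sum>l. sobolev_term Y s f l)"
      proof (rule sum_le_suminf)
        show "0 \<le> sobolev_term Y s f l" for l by (simp add: sobolev_term_def sum_nonneg)
      qed (use f fT in \<open>auto simp: sobolev_space_def\<close>)
      also have "\<dots> \<le> 1" using n1 by (simp add: sobolev_norm_def)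
      finally show ?thesis .
    qed
    have b1: "(\<Sum>z\<in>S. (b z)\<^sup>2) \<le> W"
    proof -
      have "(\<Sum>z\<in>S. (b z)\<^sup>2) = (\<Sum>z\<in>S. (e (fst z) (snd z))\<^sup>2 / w (fst z))"
        using w by (intro sum.cong refl) (simp add: b_def power_divide less_imp_le)
      also have "\<dots> = (\<Sum>l\<in>T. \<Sum>k\<in>orders l. (e l k)\<^sup>2 / w l)" by (rule Sg)
      also have "\<dots> \<le> W" using W[of "Suc n"] by (simp add: T_def e_def w_def sum_divide_distrib)
      finally show ?thesis .
    qed
    have "(\<Sum>z\<in>S. a z * b z)\<^sup>2 \<le> (\<Sum>z\<in>S. (a z)\<^sup>2) * (\<Sum>z\<in>S. (b z)\<^sup>2)"
      by (rule Cauchy_Schwarz_ineq_sum)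
    also have "\<dots> \<le> 1 * W" using a1 b1 by (intro mult_mono) (auto intro!: sum_nonneg)
    finally have "\<bar>\<Sum>z\<in>S. a z * b z\<bar>\<^sup>2 \<le> W" by simp
    then show ?thesis unfolding eq by (rule real_le_rsqrt)
  qed
  then show ?thesis by (intro LIMSEQ_le_const2[OF lim]) auto
qed

text \<open>For l \<noteq> 0 the coefficients of the discrepancy are \<open>r ^ l\<close> times the
  quadrature means, so the left side is a Bessel sum. The integral of the squared discrepancy is at
  most its sup norm times its L1 norm.\<close>

lemma quadrature_energy_le:
  assumes P: "finite P" "P \<subseteq> S2" "P \<noteq> {}" and r: "0 < r" "r < 1"
    and B: "\<And>z. z \<in> S2 \<Longrightarrow> \<bar>poisson_discrepancy P r z\<bar> \<le> B"
    and T: "finite T" "0 \<notin> T"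
  shows "(\<Sum>l\<in>T. r ^ (2 * l) * (\<Sum>k\<in>orders l. (quadrature_mean P l k)\<^sup>2)) \<le> B * min B 2"
proof -
  let ?G = "poisson_discrepancy P r" and ?N = "real (card P)"
  have N: "?N > 0" using P by (simp add: card_gt_0_iff)
  have cp: "continuous_on S2 (\<lambda>z. poisson r (x \<bullet> z))" if "x \<in> P" for x
    using that P r by (intro continuous_on_poisson_inner) auto
  have cG: "continuous_on S2 ?G"
    unfolding poisson_discrepancy_def by (intro continuous_intros cp)
  have coef: "L2_inner ?G (Y l k) = r ^ l * quadrature_mean P l k" if k: "k \<in> orders l" and l: "l \<noteq> 0" for l k
  proof -
    have i: "integrable \<sigma> (\<lambda>z. poisson r (x \<bullet> z) * Y l k z)" if "x \<in> P" for x
      by (intro sphere_integrable_continuous continuous_on_mult cp Y_continuous k that)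
    \<comment> \<open>The kernel of degree 0 is the constant 1, which turns the reproducing property
      into a vanishing mean. The subtracted 1 in the discrepancy therefore affects degree 0
      alone.\<close>
    have Y0: "(LINT z|\<sigma>. Y l k z) = 0"
    proof -
      obtain x where "x \<in> S2" using P by blast
      from zonal_reproducing[OF Y_harmonic[OF k] this, of 0] l show ?thesis
        by (simp add: zonal_projection_def zonal_def)
    qed
    have "L2_inner ?G (Y l k) = (LINT z|\<sigma>. 1 / ?N * (\<Sum>x\<in>P. poisson r (x \<bullet> z) * Y l k z) - Y l k z)"
      unfolding L2_inner_def poisson_discrepancy_def by (simp add: left_diff_distrib sum_distrib_right mult.assoc)
    also have "\<dots> = 1 / ?N * (\<Sum>x\<in>P. LINT z|\<sigma>. poisson r (x \<bullet> z) * Y l k z) - (LINT z|\<sigma>. Y l k z)"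
    proof -
      have "integrable \<sigma> (\<lambda>z. \<Sum>x\<in>P. poisson r (x \<bullet> z) * Y l k z)"
        by (intro Bochner_Integration.integrable_sum i)
      then show ?thesis using Y_integrable[OF k] i by (simp add: Bochner_Integration.integral_sum)
    qed
    also have "(\<Sum>x\<in>P. LINT z|\<sigma>. poisson r (x \<bullet> z) * Y l k z) = (\<Sum>x\<in>P. r ^ l * Y l k x)"
      using P by (intro sum.cong refl poisson_coefficient k r) auto
    finally show ?thesis by (simp add: Y0 quadrature_mean_def sum_distrib_left[symmetric])
  qed
  have "(\<Sum>l\<in>T. r ^ (2 * l) * (\<Sum>k\<in>orders l. (quadrature_mean P l k)\<^sup>2)) = (\<Sum>l\<in>T. \<Sum>k\<in>orders l. (L2_inner ?G (Y l k))\<^sup>2)"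
  proof (rule sum.cong[OF refl])
    fix l assume "l \<in> T"
    then have l: "l \<noteq> 0" using T by metis
    have "(\<Sum>k\<in>orders l. (L2_inner ?G (Y l k))\<^sup>2) = (\<Sum>k\<in>orders l. r ^ (2 * l) * (quadrature_mean P l k)\<^sup>2)"
    proof (rule sum.cong[OF refl])
      fix k assume "k \<in> orders l"
      from coef[OF this l] show "(L2_inner ?G (Y l k))\<^sup>2 = r ^ (2 * l) * (quadrature_mean P l k)\<^sup>2"
        by (simp add: power_mult_distrib power_mult[symmetric] mult.commute)
    qed
    then show "r ^ (2 * l) * (\<Sum>k\<in>orders l. (quadrature_mean P l k)\<^sup>2) = (\<Sum>k\<in>orders l. (L2_inner ?G (Y l k))\<^sup>2)"
      by (simp add: sum_distrib_left)
  qed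
  also have "\<dots> \<le> (LINT z|\<sigma>. (?G z)\<^sup>2)" by (rule bessel_inequality[OF cG T(1)])
  also have "\<dots> \<le> (LINT z|\<sigma>. B * \<bar>?G z\<bar>)"
  proof (rule integral_mono)
    show "integrable \<sigma> (\<lambda>z. (?G z)\<^sup>2)" "integrable \<sigma> (\<lambda>z. B * \<bar>?G z\<bar>)"
      by (intro sphere_integrable_continuous continuous_on_power continuous_on_mult continuous_on_const continuous_on_rabs cG)+
    fix z assume "z \<in> space \<sigma>"
    then have "\<bar>?G z\<bar> * \<bar>?G z\<bar> \<le> B * \<bar>?G z\<bar>" using B[of z] by (intro mult_right_mono) auto
    then show "(?G z)\<^sup>2 \<le> B * \<bar>?G z\<bar>" by (simp add: power2_eq_square)
  qed
  also have "\<dots> = B * (LINT z|\<sigma>. \<bar>?G z\<bar>)" by simp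
  also have "\<dots> \<le> B * min B 2"
  proof (rule mult_left_mono)
    obtain x where "x \<in> S2" using P by blast
    then show "0 \<le> B" using B[of x] by linarith
    have iG: "integrable \<sigma> (\<lambda>z. \<bar>?G z\<bar>)"
      by (intro sphere_integrable_continuous continuous_on_rabs cG)
    have 1: "(LINT z|\<sigma>. \<bar>?G z\<bar>) \<le> B"
      using integral_mono[OF iG, of "\<lambda>z. B"] B by simp
    have ip: "integrable \<sigma> (\<lambda>z. poisson r (x \<bullet> z))" if "x \<in> P" for x
      by (rule sphere_integrable_continuous[OF cp[OF that]])
    \<comment> \<open>Nonnegativity of the kernel bounds the L1 norm by the two masses 1 + 1,
      independently of the points and of r.\<close>
    have "(LINT z|\<sigma>. \<bar>?G z\<bar>) \<le> (LINT z|\<sigma>. 1 / ?N * (\<Sum>x\<in>P. poisson r (x \<bullet> z)) + 1)"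
    proof (rule integral_mono[OF iG])
      show "integrable \<sigma> (\<lambda>z. 1 / ?N * (\<Sum>x\<in>P. poisson r (x \<bullet> z)) + 1)"
        by (intro sphere_integrable_continuous continuous_intros cp)
      fix z assume "z \<in> space \<sigma>"
      then have "0 \<le> 1 / ?N * (\<Sum>x\<in>P. poisson r (x \<bullet> z))"
        using P r by (intro mult_nonneg_nonneg sum_nonneg poisson_nonneg abs_inner_sphere_le_1) auto
      then show "\<bar>?G z\<bar> \<le> 1 / ?N * (\<Sum>x\<in>P. poisson r (x \<bullet> z)) + 1"
        unfolding poisson_discrepancy_def by linarith
    qed
    also have "\<dots> = 1 / ?N * (\<Sum>x\<in>P. LINT z|\<sigma>. poisson r (x \<bullet> z)) + 1"
    proof -
      have "integrable \<sigma> (\<lambda>z. \<Sum>x\<in>P. poisson r (x \<bullet> z))"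
        by (intro Bochner_Integration.integrable_sum ip)
      then show ?thesis using ip by (simp add: Bochner_Integration.integral_sum)
    qed
    also have "(\<Sum>x\<in>P. LINT z|\<sigma>. poisson r (x \<bullet> z)) = (\<Sum>x\<in>P. 1)"
      using P r by (intro sum.cong refl sphere_integral_poisson) auto
    also have "1 / ?N * (\<Sum>x\<in>P. 1) + 1 = 2" using N by simp
    finally show "(LINT z|\<sigma>. \<bar>?G z\<bar>) \<le> min B 2" using 1 by simp
  qed
  finally show ?thesis .
qed

end

section \<open>Dyadic summation over the degrees\<close>

lemma one_minus_inverse_power_ge:
  "1 / 16 \<le> (1 - 1 / 2 ^ Suc j :: real) ^ (4 * 2 ^ j)"
proof -
  have "1 + real (2 ^ j) * (- (1 / 2 ^ Suc j)) \<le> (1 + - (1 / 2 ^ Suc j)) ^ (2 ^ j)"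
  proof (rule Bernoulli_inequality)
    have "(1::real) \<le> 2 ^ Suc j" by (rule one_le_power) simp
    then show "- 1 \<le> - (1 / 2 ^ Suc j :: real)" by simp
  qed
  then have "1 / 2 \<le> (1 - 1 / 2 ^ Suc j :: real) ^ (2 ^ j)" by simp
  then have "(1 / 2) ^ 4 \<le> ((1 - 1 / 2 ^ Suc j :: real) ^ (2 ^ j)) ^ 4" by (rule power_mono) simp
  also have "((1 - 1 / 2 ^ Suc j :: real) ^ (2 ^ j)) ^ 4 = (1 - 1 / 2 ^ Suc j) ^ (4 * 2 ^ j)"
    by (simp only: power_mult[symmetric] mult.commute)
  also have "(1 / 2 :: real) ^ 4 = 1 / 16" by (simp add: power_divide)
  finally show ?thesis .
qed

text \<open>The two estimates of the energy on the dyadic block \<open>j\<close> cross over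
  at \<open>4 ^ j \<approx> N\<close>, and both sides decay geometrically because \<open>1 < s < 2\<close>.\<close>
lemma dyadic_sum_le:
  fixes s :: real
  assumes s: "1 < s" "s < 2"
  obtains C where "C > 0"
    "\<And>N J. 1 \<le> N \<Longrightarrow> (\<Sum>j<J. (4 ^ j / N) powr (- s) * (4 ^ j / N) * min (4 ^ j / N) 1) \<le> C"
proof -
  define a b :: real where "a = 4 powr (s - 2)" and "b = 4 powr (1 - s)"
  have ab: "0 < a" "a < 1" "0 < b" "b < 1"
    using s powr_less_cancel_iff[of 4 "s - 2" 0] powr_less_cancel_iff[of 4 "1 - s" 0] by (auto simp: a_def b_def)
  have geo: "(\<Sum>i\<in>A. c ^ h i) \<le> 1 / (1 - c)" if "0 < c" "c < 1" "finite A" "inj_on h A"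
    for c :: real and A :: "nat set" and h :: "nat \<Rightarrow> nat"
  proof -
    have "(\<Sum>i\<in>A. c ^ h i) = (\<Sum>i\<in>h ` A. c ^ i)" using that by (simp add: sum.reindex)
    also have "\<dots> \<le> (\<Sum>i. c ^ i)" using that by (intro sum_le_suminf summable_geometric) auto
    finally show ?thesis using that by (simp add: suminf_geometric)
  qed
  show thesis
  proof (rule that[of "1 / (1 - a) + 1 / (1 - b)"])
    show "0 < 1 / (1 - a) + 1 / (1 - b)" using ab by (intro add_pos_pos) auto
    fix N :: real and J :: nat assume N: "1 \<le> N"
    define t where "t = (\<lambda>j::nat. (4 ^ j / N) powr (- s) * (4 ^ j / N) * min (4 ^ j / N) 1)"
    define K where "K = nat \<lfloor>log 4 N\<rfloor>"
    have l0: "0 \<le> log 4 N" using N by simp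
    have K: "real K \<le> log 4 N" "log 4 N < real K + 1" using l0 unfolding K_def by linarith+
    have Kp: "4 ^ K \<le> N" "N < 4 ^ Suc K"
    proof -
      have "4 powr real K \<le> 4 powr log 4 N" using K by (intro powr_mono) auto
      then show "4 ^ K \<le> N" using N by (simp add: powr_realpow)
      have "4 powr log 4 N < 4 powr (real K + 1)" using K by (intro powr_less_mono) auto
      then show "N < 4 ^ Suc K" using N by (simp add: powr_realpow powr_add)
    qed
    \<comment> \<open>Below the crossover u = 4 ^ j / N is at most 4 to the power - (K - j). Taking
      u in the minimum leaves u powr (2 - s), which decays as j moves down from K because s <
      2.\<close>
    have lo: "t j \<le> a ^ (K - j)" if j: "j \<le> K" for j
    proof -
      define u where "u = 4 ^ j / N"
      have u: "0 < u" using N by (simp add: u_def)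
      have "u \<le> 4 ^ j / 4 ^ K" unfolding u_def using Kp N by (intro divide_left_mono) auto
      also have "\<dots> = 4 powr (- real (K - j))"
      proof -
        have "- real (K - j) = real j - real K" using j by simp
        then show ?thesis by (simp only: powr_diff) (simp add: powr_realpow)
      qed
      finally have ul: "u \<le> 4 powr (- real (K - j))" .
      have "t j = u powr (- s) * u * min u 1" by (simp add: t_def u_def)
      also have "\<dots> \<le> u powr (- s) * u * u" using u by (intro mult_left_mono) auto
      also have "\<dots> = u powr (2 - s)" using u by (simp add: powr_diff powr_minus power2_eq_square field_simps)
      also have "\<dots> \<le> (4 powr (- real (K - j))) powr (2 - s)" using ul u s by (intro powr_mono2) auto
      also have "\<dots> = a ^ (K - j)" unfolding a_def by (simp add: powr_powr powr_realpow[symmetric] mult.commute right_diff_distrib left_diff_distrib)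
      finally show ?thesis .
    qed
    \<comment> \<open>Above the crossover the minimum is replaced by 1, leaving u powr (1 - s). The
      exponent is negative, so a lower bound for u is what is needed.\<close>
    have hi: "t j \<le> b ^ (j - Suc K)" if j: "K < j" for j
    proof -
      define u where "u = 4 ^ j / N"
      have u: "0 < u" using N by (simp add: u_def)
      have "4 powr real (j - Suc K) = 4 ^ j / 4 ^ Suc K"
      proof -
        have "real (j - Suc K) = real j - real (Suc K)" using j by simp
        then show ?thesis by (simp only: powr_diff) (simp add: powr_realpow del: of_nat_Suc power_Suc)
      qed
      also have "\<dots> \<le> u" unfolding u_def using Kp N by (intro divide_left_mono) auto
      finally have ul: "4 powr real (j - Suc K) \<le> u" .
      have "t j = u powr (- s) * u * min u 1" by (simp add: t_def u_def)
      also have "\<dots> \<le> u powr (- s) * u * 1" using u by (intro mult_left_mono) auto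
      also have "\<dots> = u powr (1 - s)" using u by (simp add: powr_diff powr_minus field_simps)
      also have "\<dots> \<le> (4 powr real (j - Suc K)) powr (1 - s)" using ul u s by (intro powr_mono2') auto
      also have "\<dots> = b ^ (j - Suc K)" unfolding b_def by (simp add: powr_powr powr_realpow[symmetric] mult.commute right_diff_distrib left_diff_distrib)
      finally show ?thesis .
    qed
    have "(\<Sum>j<J. t j) \<le> (\<Sum>j<J. (if j \<le> K then a ^ (K - j) else 0) + (if K < j then b ^ (j - Suc K) else 0))"
      using lo hi by (intro sum_mono) auto
    also have "\<dots> = (\<Sum>j\<in>{j. j < J \<and> j \<le> K}. a ^ (K - j)) + (\<Sum>j\<in>{j. j < J \<and> K < j}. b ^ (j - Suc K))"
    proof -
      have "(\<Sum>j<J. if Q j then h j else 0) = (\<Sum>j\<in>{j. j < J \<and> Q j}. h j)" for Q and h :: "nat \<Rightarrow> real"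
        by (subst sum.inter_filter[symmetric]) (auto intro: sum.cong)
      then show ?thesis by (simp add: sum.distrib)
    qed
    also have "\<dots> \<le> 1 / (1 - a) + 1 / (1 - b)"
      by (intro add_mono geo ab) (auto simp: inj_on_def)
    finally show "(\<Sum>j<J. (4 ^ j / N) powr (- s) * (4 ^ j / N) * min (4 ^ j / N) 1) \<le> 1 / (1 - a) + 1 / (1 - b)"
      by (simp add: t_def)
  qed
qed

context spherical_harmonic_basis
begin

text \<open>On the degrees from 2 ^ j up to 2 ^ (j + 1) the kernel with 1 - r = 1 / 2 ^ (j + 1)
  damps only by a bounded factor, and the discrepancy bound becomes 4 D u with u = 4 ^ j / N. The
  constant 256 is 16 for the lost damping times 16 from the square of 4 D.\<close>

lemma quadrature_energy_dyadic:
  fixes s D :: real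
  assumes s: "1 < s" "s < 2" and D: "1 \<le> D"
    and P: "finite P" "P \<subseteq> S2" "P \<noteq> {}" and N: "N = real (card P)"
    and G: "\<And>r z. 1 / 2 \<le> r \<Longrightarrow> r < 1 \<Longrightarrow> z \<in> S2 \<Longrightarrow> \<bar>poisson_discrepancy P r z\<bar> \<le> D / (N * (1 - r)\<^sup>2)"
    and C: "\<And>J. (\<Sum>j<J. (4 ^ j / N) powr (- s) * (4 ^ j / N) * min (4 ^ j / N) 1) \<le> C"
  shows "(\<Sum>l\<in>{1..<L}. (\<Sum>k\<in>orders l. (quadrature_mean P l k)\<^sup>2) / (1 + eigenvalue l) powr s)
      \<le> 256 * D\<^sup>2 * C * N powr (- s)"
proof -
  define A where "A = (\<lambda>l. \<Sum>k\<in>orders l. (quadrature_mean P l k)\<^sup>2)"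
  define w where "w = (\<lambda>l. (1 + eigenvalue l) powr s)"
  have A0: "A l \<ge> 0" for l unfolding A_def by (intro sum_nonneg) auto
  have N0: "N > 0" using P N by (simp add: card_gt_0_iff)
  have w0: "w l > 0" for l using one_add_eigenvalue_pos[of l] by (simp add: w_def)
  define T where "T = (\<lambda>j::nat. {2 ^ j..<2 ^ Suc j :: nat})"
  have block: "(\<Sum>l\<in>T j. A l / w l) \<le> 256 * D\<^sup>2 * N powr (- s) * ((4 ^ j / N) powr (- s) * (4 ^ j / N) * min (4 ^ j / N) 1)" for j
  proof -
    define r where "r = (1 - 1 / 2 ^ Suc j :: real)"
    have r: "1 / 2 \<le> r" "r < 1" by (auto simp: r_def field_simps)
    define u where "u = 4 ^ j / N"
    have u: "u > 0" using N0 by (simp add: u_def)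
    have B: "D / (N * (1 - r)\<^sup>2) = 4 * D * u"
      by (simp add: r_def u_def power_divide power_mult[symmetric] power2_eq_square power_mult_distrib[symmetric])
    have "(\<Sum>l\<in>T j. r ^ (2 * l) * A l) \<le> (4 * D * u) * min (4 * D * u) 2"
      unfolding A_def by (rule quadrature_energy_le[OF P]) (use r G in \<open>auto simp: B[symmetric] T_def\<close>)
    also have "\<dots> \<le> (4 * D * u) * (4 * D * min u 1)"
    proof (rule mult_left_mono)
      \<comment> \<open>Here D >= 1 is used: it makes 2 <= 4 D in the case u > 1.\<close>
      show "min (4 * D * u) 2 \<le> 4 * D * min u 1"
      proof (cases "u \<le> 1")
        case True
        then show ?thesis by (simp add: min_def)
      next
        case False
        then have "min (4 * D * u) 2 \<le> 2" "min u 1 = 1" by auto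
        then show ?thesis using D by simp
      qed
    qed (use D u in simp)
    finally have e: "(\<Sum>l\<in>T j. r ^ (2 * l) * A l) \<le> 16 * D\<^sup>2 * (u * min u 1)" by (simp add: power2_eq_square mult_ac)
    have "(\<Sum>l\<in>T j. A l / w l) \<le> (\<Sum>l\<in>T j. (16 * (4 ^ j) powr (- s)) * (r ^ (2 * l) * A l))"
    proof (rule sum_mono)
      fix l assume "l \<in> T j"
      then have l: "2 ^ j \<le> l" "l < 2 ^ Suc j" by (auto simp: T_def)
      \<comment> \<open>The exponent 4 * 2 ^ j bounds 2 l on the whole block, and Bernoulli's
        inequality gives 1 / 2 for the exponent 2 ^ j.\<close>
      have "1 / 16 \<le> r ^ (4 * 2 ^ j)" unfolding r_def by (rule one_minus_inverse_power_ge)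
      also have "\<dots> \<le> r ^ (2 * l)" using l r by (intro power_decreasing) auto
      finally have r16: "1 \<le> 16 * r ^ (2 * l)" by simp
      have "(2 ^ j)\<^sup>2 \<le> (real l)\<^sup>2" using l(1) by (intro power_mono) (auto simp: numeral_power_le_of_nat_cancel_iff)
      then have "4 ^ j \<le> 1 + eigenvalue l"
        by (simp add: eigenvalue_def power2_eq_square algebra_simps flip: power_mult_distrib)
      then have "(4 ^ j) powr s \<le> w l" unfolding w_def using s by (intro powr_mono2) auto
      then have "1 / w l \<le> 1 / (4 ^ j) powr s" using w0 by (intro divide_left_mono) auto
      then have "A l / w l \<le> (4 ^ j) powr (- s) * A l"
        using mult_right_mono[OF _ A0[of l]] by (fastforce simp: powr_minus divide_inverse mult.commute)
      also have "\<dots> \<le> (4 ^ j) powr (- s) * A l * (16 * r ^ (2 * l))"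
        using r16 A0[of l] mult_left_mono[OF r16, of "(4 ^ j) powr (- s) * A l"] by simp
      finally show "A l / w l \<le> (16 * (4 ^ j) powr (- s)) * (r ^ (2 * l) * A l)" by (simp add: mult_ac)
    qed
    also have "\<dots> = (16 * (4 ^ j) powr (- s)) * (\<Sum>l\<in>T j. r ^ (2 * l) * A l)" by (simp add: sum_distrib_left)
    also have "\<dots> \<le> (16 * (4 ^ j) powr (- s)) * (16 * D\<^sup>2 * (u * min u 1))"
      by (intro mult_left_mono e) simp
    also have "(4 ^ j) powr (- s) = N powr (- s) * u powr (- s)"
      using N0 u by (simp add: u_def powr_divide)
    finally show ?thesis by (simp add: u_def mult_ac)
  qed
  have "{1..<L} \<subseteq> (\<Union>j<L. T j)"
  proof
    fix l assume l: "l \<in> {1..<L}"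
    obtain j where "2 ^ j \<le> l" "l < 2 ^ Suc j"
      using ex_power_ivl1[of 2 l] l by auto
    \<comment> \<open>Since j < 2 ^ j <= l < L, the first \<open>L\<close> blocks already cover all
      degrees below \<open>L\<close>.\<close>
    moreover have "j < l" by (rule less_le_trans[OF less_exp]) (rule calculation(1))
    then have "j < L" using l by simp
    ultimately show "l \<in> (\<Union>j<L. T j)" by (auto simp: T_def intro!: bexI[of _ j])
  qed
  then have "(\<Sum>l\<in>{1..<L}. A l / w l) \<le> (\<Sum>l\<in>(\<Union>j<L. T j). A l / w l)"
    using A0 w0 by (intro sum_mono2) (auto simp: T_def less_imp_le)
  also have "\<dots> = (\<Sum>j<L. \<Sum>l\<in>T j. A l / w l)"
  proof (rule sum.UNION_disjoint)
    show "\<forall>i\<in>{..<L}. \<forall>j\<in>{..<L}. i \<noteq> j \<longrightarrow> T i \<inter> T j = {}"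
    proof (intro ballI impI)
      fix i j :: nat assume "i \<noteq> j"
      have d: "T i \<inter> T j = {}" if "i < j" for i j
      proof -
        have "(2::nat) ^ Suc i \<le> 2 ^ j" using that by (intro power_increasing) auto
        then show ?thesis by (auto simp: T_def)
      qed
      show "T i \<inter> T j = {}" using d[of i j] d[of j i] \<open>i \<noteq> j\<close> by (cases "i < j") auto
    qed
  qed (auto simp: T_def)
  also have "\<dots> \<le> (\<Sum>j<L. 256 * D\<^sup>2 * N powr (- s) * ((4 ^ j / N) powr (- s) * (4 ^ j / N) * min (4 ^ j / N) 1))"
    by (intro sum_mono block)
  also have "\<dots> \<le> 256 * D\<^sup>2 * N powr (- s) * C"
    unfolding sum_distrib_left[symmetric] by (intro mult_left_mono C) auto
  finally show ?thesis by (simp add: A_def w_def mult_ac)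
qed

end

section \<open>Second-order estimates on one parallel\<close>

abbreviation poisson_denom :: "real \<Rightarrow> real \<Rightarrow> real" where
  "poisson_denom r t \<equiv> 1 - 2 * r * t + r\<^sup>2"

definition poisson_deriv :: "real \<Rightarrow> real \<Rightarrow> real" where
  "poisson_deriv r t = 3 * r * poisson r t / poisson_denom r t"

lemma poisson_denom_ge:
  fixes r t :: real
  assumes "0 \<le> r" "t \<le> 1"
  shows "(1 - r)\<^sup>2 \<le> poisson_denom r t"
proof -
  have "2 * r * t \<le> 2 * r * 1" using assms by (intro mult_left_mono) auto
  then show ?thesis by (simp add: power2_eq_square algebra_simps)
qed

text \<open>The kernel is a negative 3 / 2 power of its denominator. The natural factor c powr (3 /
  2) is enlarged to the square, as c >= 1, to stay with integer powers.\<close>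

lemma poisson_le_poisson:
  fixes r t t' c :: real
  assumes r: "\<bar>r\<bar> < 1" and t: "\<bar>t\<bar> \<le> 1" "\<bar>t'\<bar> \<le> 1" and c: "1 \<le> c"
    and D: "poisson_denom r t' \<le> c * poisson_denom r t"
  shows "poisson r t \<le> c\<^sup>2 * poisson r t'"
proof -
  define a b where "a = sqrt (poisson_denom r t)" and "b = sqrt (poisson_denom r t')"
  have ab: "a > 0" "b > 0" using poisson_denom_pos[OF r] t by (auto simp: a_def b_def)
  have "b \<le> sqrt c * a" unfolding a_def b_def real_sqrt_mult[symmetric] using D by simp
  then have "b ^ 3 \<le> (sqrt c * a) ^ 3" using ab by (intro power_mono) auto
  also have "\<dots> = sqrt c ^ 3 * a ^ 3" by (rule power_mult_distrib)
  also have "\<dots> \<le> sqrt c ^ 4 * a ^ 3" using c ab by (intro mult_right_mono power_increasing) auto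
  also have "sqrt c ^ 4 = c\<^sup>2"
  proof -
    have "sqrt c ^ 4 = ((sqrt c)\<^sup>2)\<^sup>2" by (simp add: power_mult[symmetric])
    then show ?thesis using c by simp
  qed
  finally have le: "b ^ 3 \<le> c\<^sup>2 * a ^ 3" .
  have r0: "0 \<le> 1 - r\<^sup>2" using r by (simp add: abs_square_le_1)
  have "(1 - r\<^sup>2) / a ^ 3 = c\<^sup>2 * ((1 - r\<^sup>2) / (c\<^sup>2 * a ^ 3))" using c ab by simp
  also have "\<dots> \<le> c\<^sup>2 * ((1 - r\<^sup>2) / b ^ 3)"
    using le ab r0 c by (intro mult_left_mono divide_left_mono mult_pos_pos zero_less_power) auto
  finally show ?thesis by (simp add: poisson_def a_def b_def)
qed

lemma poisson_deriv_has_derivative: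
  fixes r t :: real
  assumes "\<bar>r\<bar> < 1" "\<bar>t\<bar> \<le> 1"
  shows "(poisson_deriv r has_real_derivative 15 * r\<^sup>2 * poisson r t / (poisson_denom r t)\<^sup>2) (at t)"
proof -
  let ?D = "poisson_denom r t"
  have D: "?D > 0" using poisson_denom_pos[of r t] assms by simp
  have d: "((\<lambda>t. poisson_denom r t) has_real_derivative - (2 * r)) (at t)"
    by (auto intro!: derivative_eq_intros)
  have "((\<lambda>t. 3 * r * poisson r t) has_real_derivative 3 * r * (3 * r * poisson r t / ?D)) (at t)"
    by (intro DERIV_cmult poisson_has_derivative assms)
  from DERIV_divide[OF this d] D
  have "(poisson_deriv r has_real_derivative
      (3 * r * (3 * r * poisson r t / ?D) * ?D - 3 * r * poisson r t * - (2 * r)) / (?D * ?D)) (at t)"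
    by (simp add: poisson_deriv_def[abs_def])
  also have "(3 * r * (3 * r * poisson r t / ?D) * ?D - 3 * r * poisson r t * - (2 * r)) / (?D * ?D)
      = 15 * r\<^sup>2 * poisson r t / ?D\<^sup>2"
    using D by (simp add: power2_eq_square)
  finally show ?thesis .
qed

text \<open>The denominator decreases in \<open>t\<close>, so between the two arguments it is
  smallest at the larger one, where it is comparable to its value at \<open>t\<close>. One factor
  \<open>c\<^sup>2\<close> is for the kernel and one for the squared denominator.\<close>

lemma poisson_second_deriv_le:
  fixes r t t' c \<xi> :: real
  assumes r: "0 \<le> r" "r < 1" and t: "\<bar>t\<bar> \<le> 1" "\<bar>t'\<bar> \<le> 1" and c: "1 \<le> c"
    and D: "poisson_denom r t \<le> c * poisson_denom r t'"
    and \<xi>: "min t t' \<le> \<xi>" "\<xi> \<le> max t t'"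
  shows "0 \<le> 15 * r\<^sup>2 * poisson r \<xi> / (poisson_denom r \<xi>)\<^sup>2"
    and "15 * r\<^sup>2 * poisson r \<xi> / (poisson_denom r \<xi>)\<^sup>2 \<le> 15 * c ^ 4 * poisson r t / (poisson_denom r t)\<^sup>2"
proof -
  have \<xi>1: "\<bar>\<xi>\<bar> \<le> 1" using \<xi> t by (auto simp: min_def max_def split: if_splits)
  have r1: "\<bar>r\<bar> < 1" using r by simp
  have Dt: "poisson_denom r t > 0" "poisson_denom r \<xi> > 0" using poisson_denom_pos[OF r1] t \<xi>1 by auto
  have "r * \<xi> \<le> r * max t t'" using \<xi> r by (intro mult_left_mono) auto
  then have "poisson_denom r (max t t') \<le> poisson_denom r \<xi>" by simp
  moreover have "poisson_denom r t \<le> c * poisson_denom r (max t t')"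
    using D c Dt(1) mult_right_mono[of 1 c "poisson_denom r t"] by (auto simp: max_def)
  ultimately have D\<xi>: "poisson_denom r t \<le> c * poisson_denom r \<xi>"
    using c by (smt (verit) mult_left_mono)
  have p: "poisson r \<xi> \<le> c\<^sup>2 * poisson r t"
    by (rule poisson_le_poisson[OF r1 \<xi>1 t(1) c D\<xi>])
  have p0: "0 \<le> poisson r \<xi>" "0 \<le> poisson r t" using poisson_nonneg[OF r1] \<xi>1 t by auto
  show "0 \<le> 15 * r\<^sup>2 * poisson r \<xi> / (poisson_denom r \<xi>)\<^sup>2" using p0 by simp
  have "(poisson_denom r t)\<^sup>2 \<le> (c * poisson_denom r \<xi>)\<^sup>2" using D\<xi> Dt by (intro power_mono) auto
  moreover have "1 / Q\<^sup>2 \<le> c\<^sup>2 / P\<^sup>2" if "P\<^sup>2 \<le> (c * Q)\<^sup>2" "P > 0" "Q > 0" for P Q :: real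
    using that by (simp add: power_mult_distrib field_simps)
  ultimately have i: "1 / (poisson_denom r \<xi>)\<^sup>2 \<le> c\<^sup>2 / (poisson_denom r t)\<^sup>2"
    using Dt by blast
  have "15 * r\<^sup>2 * poisson r \<xi> / (poisson_denom r \<xi>)\<^sup>2 = 15 * r\<^sup>2 * poisson r \<xi> * (1 / (poisson_denom r \<xi>)\<^sup>2)" by simp
  also have "\<dots> \<le> 15 * 1 * (c\<^sup>2 * poisson r t) * (c\<^sup>2 / (poisson_denom r t)\<^sup>2)"
    using p p0 i r by (intro mult_mono) (auto simp: abs_square_le_1)
  also have "\<dots> = 15 * c ^ 4 * poisson r t / (poisson_denom r t)\<^sup>2"
    by (simp add: power2_eq_square power4_eq_xxxx)
  finally show "15 * r\<^sup>2 * poisson r \<xi> / (poisson_denom r \<xi>)\<^sup>2 \<le> 15 * c ^ 4 * poisson r t / (poisson_denom r t)\<^sup>2" .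
qed

lemma poisson_deriv_diff_le:
  fixes r t t' c :: real
  assumes r: "0 \<le> r" "r < 1" and t: "\<bar>t\<bar> \<le> 1" "\<bar>t'\<bar> \<le> 1" and c: "1 \<le> c"
    and D: "poisson_denom r t \<le> c * poisson_denom r t'"
  shows "\<bar>poisson_deriv r t' - poisson_deriv r t\<bar> \<le> 15 * c ^ 4 * poisson r t / (poisson_denom r t)\<^sup>2 * \<bar>t' - t\<bar>"
proof (cases "t = t'")
  case False
  let ?k = "\<lambda>\<xi>. 15 * r\<^sup>2 * poisson r \<xi> / (poisson_denom r \<xi>)\<^sup>2"
  have lt: "min t t' < max t t'" using False by (auto simp: min_def max_def)
  have "\<bar>\<xi>\<bar> \<le> 1" if "min t t' \<le> \<xi>" "\<xi> \<le> max t t'" for \<xi>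
    using that t by (auto simp: min_def max_def split: if_splits)
  then have "\<exists>\<xi>. \<xi> > min t t' \<and> \<xi> < max t t' \<and> poisson_deriv r (max t t') - poisson_deriv r (min t t') = (max t t' - min t t') * ?k \<xi>"
    using r by (intro MVT2[OF lt] poisson_deriv_has_derivative) auto
  then obtain \<xi> where \<xi>: "min t t' \<le> \<xi>" "\<xi> \<le> max t t'"
    "poisson_deriv r (max t t') - poisson_deriv r (min t t') = (max t t' - min t t') * ?k \<xi>"
    by (auto dest: less_imp_le)
  note k = poisson_second_deriv_le[OF r t c D \<xi>(1,2)]
  have "\<bar>poisson_deriv r t' - poisson_deriv r t\<bar> = \<bar>poisson_deriv r (max t t') - poisson_deriv r (min t t')\<bar>"
    by (auto simp: min_def max_def)
  also have "\<dots> = \<bar>t' - t\<bar> * ?k \<xi>" unfolding \<xi>(3) abs_mult abs_of_nonneg[OF k(1)] by (auto simp: min_def max_def)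
  also have "\<dots> \<le> \<bar>t' - t\<bar> * (15 * c ^ 4 * poisson r t / (poisson_denom r t)\<^sup>2)"
    using k(2) by (intro mult_left_mono) auto
  finally show ?thesis by (simp add: mult.commute)
qed simp

text \<open>The mean value theorem is applied twice, to the kernel and then to its derivative
  between \<open>t\<close> and the intermediate point. The bound is stated at the base point
  \<open>t\<close>, so that it can later be summed over the quadrature nodes.\<close>

lemma poisson_taylor:
  fixes r t t' c :: real
  assumes r: "0 \<le> r" "r < 1" and t: "\<bar>t\<bar> \<le> 1" "\<bar>t'\<bar> \<le> 1" and c: "1 \<le> c"
    and D: "poisson_denom r t \<le> c * poisson_denom r t'"
  shows "\<bar>poisson r t' - poisson r t - poisson_deriv r t * (t' - t)\<bar>
      \<le> 15 * c ^ 4 * poisson r t / (poisson_denom r t)\<^sup>2 * (t' - t)\<^sup>2"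
proof (cases "t = t'")
  case False
  have lt: "min t t' < max t t'" using False by (auto simp: min_def max_def)
  have m1: "\<bar>\<xi>\<bar> \<le> 1" if "min t t' \<le> \<xi>" "\<xi> \<le> max t t'" for \<xi>
    using that t by (auto simp: min_def max_def split: if_splits)
  have "\<exists>\<xi>. \<xi> > min t t' \<and> \<xi> < max t t' \<and> poisson r (max t t') - poisson r (min t t') = (max t t' - min t t') * poisson_deriv r \<xi>"
    unfolding poisson_deriv_def using r m1 by (intro MVT2[OF lt] poisson_has_derivative) auto
  then obtain \<xi> where \<xi>: "min t t' \<le> \<xi>" "\<xi> \<le> max t t'"
    "poisson r (max t t') - poisson r (min t t') = (max t t' - min t t') * poisson_deriv r \<xi>"
    by (auto dest: less_imp_le)
  have eq: "poisson r t' - poisson r t = (t' - t) * poisson_deriv r \<xi>"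
    using \<xi>(3) by (auto simp: min_def max_def algebra_simps split: if_splits)
  have "r * \<xi> \<le> r * max t t'" using \<xi> r by (intro mult_left_mono) auto
  then have D1: "poisson_denom r (max t t') \<le> poisson_denom r \<xi>" by simp
  have Dt: "poisson_denom r t > 0" using poisson_denom_pos[of r t] r t by auto
  have "poisson_denom r t \<le> c * poisson_denom r (max t t')"
    using D c Dt mult_right_mono[of 1 c "poisson_denom r t"] by (auto simp: max_def)
  then have D\<xi>: "poisson_denom r t \<le> c * poisson_denom r \<xi>"
    using c D1 by (smt (verit) mult_left_mono)
  have "\<bar>poisson r t' - poisson r t - poisson_deriv r t * (t' - t)\<bar> = \<bar>t' - t\<bar> * \<bar>poisson_deriv r \<xi> - poisson_deriv r t\<bar>"
    unfolding eq by (simp add: abs_mult[symmetric] algebra_simps)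
  also have "\<dots> \<le> \<bar>t' - t\<bar> * (15 * c ^ 4 * poisson r t / (poisson_denom r t)\<^sup>2 * \<bar>\<xi> - t\<bar>)"
    by (intro mult_left_mono poisson_deriv_diff_le[OF r t(1) m1[OF \<xi>(1,2)] c D\<xi>]) simp
  also have "\<dots> \<le> \<bar>t' - t\<bar> * (15 * c ^ 4 * poisson r t / (poisson_denom r t)\<^sup>2 * \<bar>t' - t\<bar>)"
  proof (intro mult_left_mono)
    show "\<bar>\<xi> - t\<bar> \<le> \<bar>t' - t\<bar>" using \<xi>(1,2) by (auto simp: min_def max_def split: if_splits)
    show "0 \<le> 15 * c ^ 4 * poisson r t / (poisson_denom r t)\<^sup>2" using poisson_nonneg[of r t] r t c by simp
  qed simp
  also have "\<dots> = 15 * c ^ 4 * poisson r t / (poisson_denom r t)\<^sup>2 * (t' - t)\<^sup>2"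
  proof -
    have "\<bar>t' - t\<bar> * (u * \<bar>t' - t\<bar>) = u * (t' - t)\<^sup>2" for u
      by (simp add: power2_eq_square)
    then show ?thesis .
  qed
  finally show ?thesis .
qed simp

text \<open>Serves radii too close to 1 for Taylor expansion. With q = (1 - r0) / (1 - r) the
  denominators differ by at most q^2, which gives q^3 in the kernel; one q is absorbed by the
  numerator 1 - r, and the 2 comes from 1 + r.\<close>

lemma poisson_le_smaller_radius:
  fixes r r0 t :: real
  assumes r: "0 \<le> r0" "r0 \<le> r" "r < 1" and t: "\<bar>t\<bar> \<le> 1"
  shows "poisson r t \<le> 2 * ((1 - r0) / (1 - r))\<^sup>2 * poisson r0 t"
proof -
  define q where "q = (1 - r0) / (1 - r)"
  have q: "1 \<le> q" "q * (1 - r) = 1 - r0" using r by (auto simp: q_def)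
  define a b where "a = sqrt (poisson_denom r t)" and "b = sqrt (poisson_denom r0 t)"
  have ab: "a > 0" "b > 0" using poisson_denom_pos[of r t] poisson_denom_pos[of r0 t] t r by (auto simp: a_def b_def)
  have "poisson_denom r0 t \<le> q\<^sup>2 * poisson_denom r t"
  proof -
    have "poisson_denom r0 t = (q * (1 - r))\<^sup>2 + 2 * r0 * (1 - t)"
      unfolding q(2) by (simp add: power2_eq_square algebra_simps)
    also have "\<dots> \<le> (q * (1 - r))\<^sup>2 + q\<^sup>2 * (2 * r * (1 - t))"
    proof -
      have "2 * r0 * (1 - t) \<le> 2 * r * (1 - t)" using r t by (intro mult_right_mono) auto
      also have "\<dots> \<le> q\<^sup>2 * (2 * r * (1 - t))"
        using q r t mult_right_mono[of 1 "q\<^sup>2" "2 * r * (1 - t)"] by simp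
      finally show ?thesis by simp
    qed
    also have "\<dots> = q\<^sup>2 * poisson_denom r t" by (simp add: power2_eq_square algebra_simps)
    finally show ?thesis .
  qed
  then have "b \<le> sqrt (q\<^sup>2 * poisson_denom r t)" unfolding b_def by simp
  also have "\<dots> = q * a" using q by (simp add: a_def real_sqrt_mult)
  finally have "b ^ 3 \<le> (q * a) ^ 3" using ab by (intro power_mono) auto
  then have i: "1 / a ^ 3 \<le> q ^ 3 / b ^ 3" using ab by (simp add: power_mult_distrib field_simps)
  have "poisson r t = (1 - r) * (1 + r) * (1 / a ^ 3)"
    by (simp add: poisson_def a_def power2_eq_square algebra_simps)
  also have "\<dots> \<le> (1 - r) * 2 * (q ^ 3 / b ^ 3)"
    using i r ab by (intro mult_mono) auto
  also have "\<dots> = 2 * q\<^sup>2 * ((q * (1 - r)) / b ^ 3)" by (simp add: power2_eq_square power3_eq_cube)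
  also have "\<dots> \<le> 2 * q\<^sup>2 * ((1 - r0\<^sup>2) / b ^ 3)"
  proof (intro mult_left_mono divide_right_mono)
    have "1 - r0\<^sup>2 = (1 - r0) * (1 + r0)" by (simp add: power2_eq_square algebra_simps)
    moreover have "(1 - r0) * 1 \<le> (1 - r0) * (1 + r0)" using r by (intro mult_left_mono) auto
    ultimately show "q * (1 - r) \<le> 1 - r0\<^sup>2" using q by simp
  qed (use ab in auto)
  also have "(1 - r0\<^sup>2) / b ^ 3 = poisson r0 t" by (simp add: poisson_def b_def)
  finally show ?thesis by (simp add: q_def)
qed

section \<open>Geometry of equally spaced points on a parallel\<close>

lemma sum_cos_sin_equally_spaced:
  assumes "2 \<le> n"
  shows "(\<Sum>l<n. cos (2 * pi * real l / real n)) = 0" "(\<Sum>l<n. sin (2 * pi * real l / real n)) = 0"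
proof -
  define w where "w = cis (2 * pi / real n)"
  have n: "real n \<ge> 2" using assms by simp
  have "w \<noteq> 1"
  proof
    assume "w = 1"
    then have "cos (2 * pi / real n) = 1" by (simp add: w_def complex_eq_iff)
    moreover have "cos (2 * pi / real n) < cos 0"
      using n by (intro cos_monotone_0_pi) (auto simp: field_simps)
    ultimately show False by simp
  qed
  moreover have "w ^ n = 1"
  proof -
    have "real n * (2 * pi / real n) = 2 * pi" using n by simp
    then show ?thesis unfolding w_def Complex.DeMoivre by (simp only: cis_2pi)
  qed
  ultimately have "(\<Sum>l<n. w ^ l) = 0" by (simp add: geometric_sum)
  moreover have "(\<Sum>l<n. w ^ l) = (\<Sum>l<n. cis (2 * pi * real l / real n))"
    by (intro sum.cong refl) (simp add: w_def Complex.DeMoivre mult_ac)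
  ultimately have "(\<Sum>l<n. cis (2 * pi * real l / real n)) = 0" by simp
  then show "(\<Sum>l<n. cos (2 * pi * real l / real n)) = 0" "(\<Sum>l<n. sin (2 * pi * real l / real n)) = 0"
    by (simp_all add: complex_eq_iff)
qed

definition circle_point :: "real \<Rightarrow> real \<Rightarrow> real \<Rightarrow> real^3" where
  "circle_point \<rho> \<theta> h = vector [\<rho> * cos \<theta>, \<rho> * sin \<theta>, h]"

lemma circle_point_in_sphere: "\<rho>\<^sup>2 + h\<^sup>2 = 1 \<Longrightarrow> circle_point \<rho> \<theta> h \<in> S2"
proof -
  assume "\<rho>\<^sup>2 + h\<^sup>2 = 1"
  moreover have "(\<rho> * cos \<theta>)\<^sup>2 + (\<rho> * sin \<theta>)\<^sup>2 = \<rho>\<^sup>2 * ((cos \<theta>)\<^sup>2 + (sin \<theta>)\<^sup>2)"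
    by (simp only: power_mult_distrib distrib_left)
  ultimately show ?thesis by (simp add: circle_point_def norm_vector_3)
qed

lemma circle_point_inner:
  "circle_point \<rho> \<theta> h \<bullet> z = \<rho> * (cos \<theta> * z $ 1 + sin \<theta> * z $ 2) + h * z $ 3"
  by (subst inner_commute) (simp add: circle_point_def inner_vector_3 algebra_simps)

lemma one_minus_cos_le: "1 - cos x \<le> x\<^sup>2 / 2" for x :: real
proof -
  have "cos x = 1 - 2 * (sin (x / 2))\<^sup>2" using cos_double_sin[of "x / 2"] by simp
  moreover have "(sin (x / 2))\<^sup>2 \<le> (x / 2)\<^sup>2"
    using abs_sin_x_le_abs_x[of "x / 2"] by (rule abs_le_square_iff[THEN iffD1])
  ultimately show ?thesis by (simp add: power_divide)
qed

lemma norm_circle_point_diff: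
  "(norm (circle_point R (\<theta> + \<phi>) h' - circle_point \<rho> \<theta> h))\<^sup>2
     = (R - \<rho>)\<^sup>2 + 2 * R * \<rho> * (1 - cos \<phi>) + (h' - h)\<^sup>2"
proof -
  let ?c = "cos (\<theta> + \<phi>)" and ?s = "sin (\<theta> + \<phi>)"
  have n: "(norm (circle_point R (\<theta> + \<phi>) h' - circle_point \<rho> \<theta> h))\<^sup>2
     = (R * ?c - \<rho> * cos \<theta>)\<^sup>2 + (R * ?s - \<rho> * sin \<theta>)\<^sup>2 + (h' - h)\<^sup>2"
    by (simp add: circle_point_def norm_vec_def L2_set_def sum_3)
  have c: "cos \<phi> = ?c * cos \<theta> + ?s * sin \<theta>" using cos_diff[of "\<theta> + \<phi>" \<theta>] by simp
  have p: "?s\<^sup>2 + ?c\<^sup>2 = 1" "(sin \<theta>)\<^sup>2 + (cos \<theta>)\<^sup>2 = 1" by simp_all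
  show ?thesis unfolding n c using p by algebra
qed

text \<open>Reads the root of the denominator as a distance, so that comparisons of denominators
  reduce to the triangle inequality.\<close>

lemma poisson_denom_eq_norm:
  fixes x z :: "real^3"
  assumes "x \<in> S2" "z \<in> S2"
  shows "poisson_denom r (x \<bullet> z) = (norm (z - r *\<^sub>R x))\<^sup>2"
proof -
  have "x \<bullet> x = 1" "z \<bullet> z = 1" using assms by (simp_all add: norm_eq_1)
  then show ?thesis
    unfolding power2_norm_eq_inner
    by (simp add: inner_diff_left inner_diff_right inner_commute power2_eq_square algebra_simps)
qed

text \<open>\<open>\<eta>\<close> plays the role of \<open>N powr (- 1 / 2)\<close>; the cells of the parallel have half-width \<open>n * \<eta>\<^sup>2\<close>
  in height and \<open>pi / n\<close> in longitude.\<close>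
locale parallel =
  fixes \<eta> \<rho> h r :: real and n :: nat and z :: "real^3"
  assumes \<eta>: "0 < \<eta>" and \<eta>_le: "\<eta> \<le> 1 - r" and r: "1 / 2 \<le> r" "r < 1"
    and \<rho>: "0 < \<rho>" and on_sphere: "\<rho>\<^sup>2 + h\<^sup>2 = 1"
    and n: "2 \<le> n" and \<rho>_le: "\<rho> \<le> real n * \<eta>" and n_le: "real n * \<eta> \<le> 8 * \<rho>"
    and z: "z \<in> S2"
begin

definition angle :: "nat \<Rightarrow> real" where "angle l = 2 * pi * real l / real n"
text \<open>\<open>u l\<close> and \<open>u' l\<close> are the components of \<open>z\<close> along
  the outward horizontal and the eastward unit vectors at longitude \<open>angle l\<close>.\<close>

definition u :: "nat \<Rightarrow> real" where "u l = cos (angle l) * z $ 1 + sin (angle l) * z $ 2"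
definition u' :: "nat \<Rightarrow> real" where "u' l = cos (angle l) * z $ 2 - sin (angle l) * z $ 1"
definition x :: "nat \<Rightarrow> real^3" where "x l = circle_point \<rho> (angle l) h"
definition y :: "real \<Rightarrow> real \<Rightarrow> nat \<Rightarrow> real^3" where
  "y \<theta> \<phi> l = circle_point (sin \<theta>) (angle l + \<phi>) (cos \<theta>)"

abbreviation \<delta> :: real where "\<delta> \<equiv> 1 - r"
abbreviation K :: "real^3 \<Rightarrow> real" where "K p \<equiv> poisson r (p \<bullet> z)"
abbreviation D :: "real^3 \<Rightarrow> real" where "D p \<equiv> poisson_denom r (p \<bullet> z)"
text \<open>\<open>sqrt (D p)\<close> is the distance from \<open>z\<close> to \<open>r *\<^sub>R p\<close>; it varies by a factor of at most 43 within a cell, and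
  \<open>43\<^sup>2 \<le> 2000\<close>.\<close>
abbreviation c :: real where "c \<equiv> 2000"

lemma r_abs: "\<bar>r\<bar> < 1" "0 \<le> r" using r by auto
lemma \<delta>_pos: "0 < \<delta>" using r by simp

lemma abs_h_le_1: "\<bar>h\<bar> \<le> 1"
proof -
  have "h\<^sup>2 \<le> 1" using on_sphere zero_le_power2[of \<rho>] by linarith
  then show ?thesis by (simp add: abs_square_le_1)
qed

lemma D_pos: "p \<in> S2 \<Longrightarrow> 0 < D p"
  by (rule poisson_denom_pos[OF r_abs(1) abs_inner_sphere_le_1[OF _ z]])

lemma x_sphere: "x l \<in> S2"
  unfolding x_def by (rule circle_point_in_sphere[OF on_sphere])

lemma y_sphere: "y \<theta> \<phi> l \<in> S2"
  unfolding y_def by (rule circle_point_in_sphere) simp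

lemma x_inner: "x l \<bullet> z = \<rho> * u l + h * z $ 3"
  by (simp add: x_def circle_point_inner u_def)

lemma y_inner: "y \<theta> \<phi> l \<bullet> z = sin \<theta> * (cos \<phi> * u l + sin \<phi> * u' l) + cos \<theta> * z $ 3"
  by (simp add: y_def circle_point_inner u_def u'_def cos_add sin_add algebra_simps)

lemma D_ge: "p \<in> S2 \<Longrightarrow> \<delta>\<^sup>2 \<le> D p"
  using poisson_denom_ge[of r "p \<bullet> z"] abs_inner_sphere_le_1[OF _ z, of p] r by auto

lemma sqrt_D_eq: "p \<in> S2 \<Longrightarrow> sqrt (D p) = norm (z - r *\<^sub>R p)"
  by (simp add: poisson_denom_eq_norm[OF _ z])

lemma \<delta>_le_sqrt_D: "p \<in> S2 \<Longrightarrow> \<delta> \<le> sqrt (D p)"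
  using D_ge[of p] r by (intro real_le_rsqrt) auto

lemma sqrt_D_lipschitz: "p \<in> S2 \<Longrightarrow> q \<in> S2 \<Longrightarrow> \<bar>sqrt (D p) - sqrt (D q)\<bar> \<le> r * norm (p - q)"
proof -
  assume pq: "p \<in> S2" "q \<in> S2"
  have "\<bar>norm (z - r *\<^sub>R p) - norm (z - r *\<^sub>R q)\<bar> \<le> norm ((z - r *\<^sub>R p) - (z - r *\<^sub>R q))"
    by (rule norm_triangle_ineq3)
  also have "(z - r *\<^sub>R p) - (z - r *\<^sub>R q) = r *\<^sub>R (q - p)" by (simp add: algebra_simps)
  finally show ?thesis using pq r_abs by (simp add: sqrt_D_eq norm_minus_commute)
qed

lemma K_nonneg: "p \<in> S2 \<Longrightarrow> 0 \<le> K p"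
  by (intro poisson_nonneg r_abs abs_inner_sphere_le_1 z)

text \<open>The horizontal unit vector \<open>e\<close> at this longitude satisfies e . x = \<rho>
  and e . z = u, so u = e . (z - r x) + r \<rho>. Near a pole, \<open>u\<close> is thus controlled
  by the distance entering the denominator.\<close>

lemma abs_u_le: "\<bar>u l\<bar> \<le> sqrt (D (x l)) + \<rho>"
proof -
  define e where "e = circle_point 1 (angle l) 0"
  have e: "e \<in> S2" unfolding e_def by (rule circle_point_in_sphere) simp
  have "e \<bullet> x l = \<rho>"
  proof -
    have "e \<bullet> x l = 1 * (cos (angle l) * x l $ 1 + sin (angle l) * x l $ 2) + 0 * x l $ 3"
      unfolding e_def by (rule circle_point_inner)
    also have "\<dots> = \<rho> * (cos (angle l))\<^sup>2 + \<rho> * (sin (angle l))\<^sup>2"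
      by (simp add: x_def circle_point_def power2_eq_square mult_ac)
    also have "\<dots> = \<rho> * ((cos (angle l))\<^sup>2 + (sin (angle l))\<^sup>2)" by (simp only: distrib_left)
    finally show ?thesis by simp
  qed
  moreover have "e \<bullet> z = u l" by (simp add: e_def circle_point_inner u_def)
  ultimately have "u l = e \<bullet> (z - r *\<^sub>R x l) + r * \<rho>" by (simp add: inner_diff_right)
  moreover have "\<bar>e \<bullet> (z - r *\<^sub>R x l)\<bar> \<le> norm (z - r *\<^sub>R x l)"
    using Cauchy_Schwarz_ineq2[of e "z - r *\<^sub>R x l"] e by simp
  moreover have "0 \<le> r * \<rho>" "r * \<rho> \<le> 1 * \<rho>" using r \<rho> by (auto intro!: mult_right_mono)
  ultimately show ?thesis unfolding sqrt_D_eq[OF x_sphere] by linarith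
qed

lemma sum_u: "(\<Sum>l<n. u l) = 0"
  unfolding u_def angle_def
  using sum_cos_sin_equally_spaced[OF n]
  by (simp add: sum.distrib sum_distrib_right[symmetric])

text \<open>The factor \<rho> on the right is the point: it compensates the 1 / \<rho> of
  \<open>horizontal_difference\<close> near the poles. As the \<open>u l\<close> sum to 0, a
  constant may be subtracted from the derivative. On a circle small against \<delta> the derivative
  is nearly constant; otherwise 1 / \<delta> is at most 4 \<rho> / \<open>\<delta>\<^sup>2\<close>
  and nothing need cancel.\<close>

lemma ring_cancellation:
  "\<bar>\<Sum>l<n. poisson_deriv r (x l \<bullet> z) * u l\<bar> \<le> 30 * c ^ 4 * \<rho> / \<delta>\<^sup>2 * (\<Sum>l<n. K (x l))"
proof -
  have K0: "0 \<le> K (x l)" for l by (rule K_nonneg[OF x_sphere])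
  have D0: "0 < D (x l)" for l by (rule D_pos[OF x_sphere])
  \<comment> \<open>\<open>h * z $ 3\<close> is the mean of \<open>x l \<bullet> z\<close> over the
    circle, the natural point at which to freeze the derivative.\<close>
  define q where "q = (if 4 * \<rho> \<ge> \<delta> then 0 else poisson_deriv r (h * z $ 3))"
  have bound: "\<bar>(poisson_deriv r (x l \<bullet> z) - q) * u l\<bar> \<le> 30 * c ^ 4 * \<rho> / \<delta>\<^sup>2 * K (x l)" for l
  proof -
    define d where "d = sqrt (D (x l))"
    have d: "0 < d" "\<delta> \<le> d" "D (x l) = d\<^sup>2" using D0[of l] \<delta>_le_sqrt_D[OF x_sphere, of l] by (auto simp: d_def)
    have u: "\<bar>u l\<bar> \<le> d + \<rho>" using abs_u_le by (simp add: d_def)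
    show ?thesis
    proof (cases "4 * \<rho> \<ge> \<delta>")
      case True
      have "\<bar>(poisson_deriv r (x l \<bullet> z) - q) * u l\<bar> = 3 * r * K (x l) / d\<^sup>2 * \<bar>u l\<bar>"
        using True K0[of l] r by (simp add: q_def poisson_deriv_def abs_mult d(3))
      also have "\<dots> \<le> 3 * 1 * K (x l) / d\<^sup>2 * (d + \<rho>)"
        using u K0[of l] r by (intro mult_mono divide_right_mono) auto
      also have "\<dots> = 3 * K (x l) * (1 / d + \<rho> / d\<^sup>2)"
        using d by (simp add: power2_eq_square field_simps)
      also have "\<dots> \<le> 3 * K (x l) * (4 * \<rho> / \<delta>\<^sup>2 + \<rho> / \<delta>\<^sup>2)"
      proof (intro mult_left_mono add_mono)
        have "1 / d \<le> 1 / \<delta>" using d \<delta>_pos by (intro divide_left_mono) auto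
        also have "1 / \<delta> = \<delta> / \<delta>\<^sup>2" using \<delta>_pos by (simp add: power2_eq_square)
        also have "\<dots> \<le> 4 * \<rho> / \<delta>\<^sup>2" using True by (intro divide_right_mono) auto
        finally show "1 / d \<le> 4 * \<rho> / \<delta>\<^sup>2" .
        have "\<delta>\<^sup>2 \<le> d\<^sup>2" using d \<delta>_pos by (intro power_mono) auto
        then show "\<rho> / d\<^sup>2 \<le> \<rho> / \<delta>\<^sup>2" using \<rho> \<delta>_pos d by (intro divide_left_mono mult_pos_pos zero_less_power) auto
      qed (use K0[of l] in auto)
      also have "\<dots> = 15 * (\<rho> / \<delta>\<^sup>2 * K (x l))" by simp
      also have "\<dots> \<le> (30 * c ^ 4) * (\<rho> / \<delta>\<^sup>2 * K (x l))"
        using \<rho> K0[of l] by (intro mult_right_mono) auto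
      finally show ?thesis by simp
    next
      case False
      then have \<rho>d: "\<rho> \<le> d / 4" using d by linarith
      have ul: "\<bar>u l\<bar> \<le> 5 / 4 * d" using u \<rho>d by linarith
      define t0 where "t0 = h * z $ 3"
      have t: "x l \<bullet> z - t0 = \<rho> * u l" by (simp add: x_inner t0_def)
      have "\<bar>h\<bar> \<le> 1" by (rule abs_h_le_1)
      moreover have "\<bar>z $ 3\<bar> \<le> 1" using component_le_norm_cart[of z 3] z by simp
      ultimately have t01: "\<bar>t0\<bar> \<le> 1" unfolding t0_def abs_mult by (simp add: mult_le_one)
      have "\<bar>\<rho> * u l\<bar> \<le> d / 4 * (5 / 4 * d)"
        unfolding abs_mult using \<rho>d ul \<rho> d by (intro mult_mono) auto
      then have ru: "\<bar>\<rho> * u l\<bar> \<le> 5 / 16 * d\<^sup>2" by (simp add: power2_eq_square)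
      have "2 * r * (x l \<bullet> z - t0) \<ge> - (5 / 8 * d\<^sup>2)"
      proof -
        have "\<bar>r * (\<rho> * u l)\<bar> \<le> 1 * (5 / 16 * d\<^sup>2)" unfolding abs_mult[of r] using ru r by (intro mult_mono) auto
        then show ?thesis unfolding t by simp
      qed
      \<comment> \<open>The denominator at \<open>t0\<close> exceeds that at \<open>x l\<close> by 2
        r \<rho> u, which is at least - 5 / 8 of the latter; the ratio 8 / 3 is far below
        \<open>c\<close>.\<close>
      then have "3 / 8 * d\<^sup>2 \<le> poisson_denom r t0" using d(3) by (simp add: algebra_simps)
      moreover have "0 \<le> d\<^sup>2" by simp
      moreover have "a \<le> c * b" if "3 / 8 * a \<le> b" "0 \<le> a" for a b :: real using that by linarith
      ultimately have Dc: "D (x l) \<le> c * poisson_denom r t0" unfolding d(3) by blast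
      have "\<bar>poisson_deriv r t0 - poisson_deriv r (x l \<bullet> z)\<bar> \<le> 15 * c ^ 4 * K (x l) / (D (x l))\<^sup>2 * \<bar>t0 - x l \<bullet> z\<bar>"
        by (rule poisson_deriv_diff_le[OF r_abs(2) r(2) _ t01 _ Dc]) (use abs_inner_sphere_le_1[OF x_sphere z] in auto)
      also have "\<bar>t0 - x l \<bullet> z\<bar> = \<rho> * \<bar>u l\<bar>"
        using t \<rho> by (metis abs_minus_commute abs_mult abs_of_pos)
      finally have k: "\<bar>poisson_deriv r t0 - poisson_deriv r (x l \<bullet> z)\<bar> \<le> 15 * c ^ 4 * K (x l) / (d\<^sup>2)\<^sup>2 * (\<rho> * \<bar>u l\<bar>)"
        by (simp only: d(3))
      have "\<bar>(poisson_deriv r (x l \<bullet> z) - q) * u l\<bar> = \<bar>poisson_deriv r t0 - poisson_deriv r (x l \<bullet> z)\<bar> * \<bar>u l\<bar>"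
        using False by (simp add: q_def t0_def abs_mult abs_minus_commute)
      also have "\<dots> \<le> 15 * c ^ 4 * K (x l) / (d\<^sup>2)\<^sup>2 * (\<rho> * \<bar>u l\<bar>) * \<bar>u l\<bar>"
        by (intro mult_right_mono k) simp
      also have "\<dots> = 15 * c ^ 4 * K (x l) * \<rho> / (d\<^sup>2)\<^sup>2 * (\<bar>u l\<bar> * \<bar>u l\<bar>)" by simp
      also have "\<dots> \<le> 15 * c ^ 4 * K (x l) * \<rho> / (d\<^sup>2)\<^sup>2 * (2 * d\<^sup>2)"
      proof (intro mult_left_mono)
        have "\<bar>u l\<bar> * \<bar>u l\<bar> \<le> (5 / 4 * d) * (5 / 4 * d)" using ul d by (intro mult_mono) auto
        also have "\<dots> \<le> 2 * d\<^sup>2" by (simp add: power2_eq_square)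
        finally show "\<bar>u l\<bar> * \<bar>u l\<bar> \<le> 2 * d\<^sup>2" .
      qed (use K0[of l] \<rho> in auto)
      also have "\<dots> = 30 * c ^ 4 * \<rho> * K (x l) / d\<^sup>2" using d by (simp add: power2_eq_square)
      also have "\<dots> \<le> 30 * c ^ 4 * \<rho> * K (x l) / \<delta>\<^sup>2"
        using d \<delta>_pos K0[of l] \<rho> by (intro divide_left_mono power_mono mult_pos_pos zero_less_power) auto
      finally show ?thesis by simp
    qed
  qed
  have "(\<Sum>l<n. poisson_deriv r (x l \<bullet> z) * u l) = (\<Sum>l<n. (poisson_deriv r (x l \<bullet> z) - q) * u l)"
    by (simp add: left_diff_distrib sum_subtractf sum_distrib_left[symmetric] sum_u)
  also have "\<bar>\<dots>\<bar> \<le> (\<Sum>l<n. \<bar>(poisson_deriv r (x l \<bullet> z) - q) * u l\<bar>)" by (rule sum_abs)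
  also have "\<dots> \<le> (\<Sum>l<n. 30 * c ^ 4 * \<rho> / \<delta>\<^sup>2 * K (x l))" by (intro sum_mono bound)
  finally show ?thesis by (simp only: sum_distrib_left)
qed

end

locale parallel_cell = parallel +
  fixes \<theta> \<phi> :: real
  assumes \<theta>: "0 \<le> \<theta>" "\<theta> \<le> pi" and band: "\<bar>cos \<theta> - h\<bar> \<le> real n * \<eta>\<^sup>2"
    and \<phi>: "\<bar>\<phi>\<bar> \<le> pi / real n"
begin

definition v :: real where "v = cos \<theta> - h"
abbreviation R :: real where "R \<equiv> sin \<theta>"

lemma R_nonneg: "0 \<le> R" using \<theta> by (simp add: sin_ge_zero)

lemma n_pos: "0 < real n" "1 \<le> real n" using n by auto

lemma abs_v_le: "\<bar>v\<bar> \<le> 8 * \<rho> * \<eta>"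
proof -
  have "\<bar>v\<bar> \<le> (real n * \<eta>) * \<eta>" using band by (simp add: v_def power2_eq_square)
  also have "\<dots> \<le> (8 * \<rho>) * \<eta>" using n_le \<eta> by (intro mult_right_mono) auto
  finally show ?thesis .
qed

lemma \<rho>_le_1: "\<rho> \<le> 1"
proof -
  have "\<rho>\<^sup>2 \<le> 1\<^sup>2" using on_sphere zero_le_power2[of h] unfolding one_power2 by linarith
  then show ?thesis by (rule power2_le_imp_le) simp
qed

lemma v_square_le: "v\<^sup>2 \<le> 64 * \<rho>\<^sup>2 * \<eta>\<^sup>2"
proof -
  have "\<bar>v\<bar>\<^sup>2 \<le> (8 * \<rho> * \<eta>)\<^sup>2" by (intro power_mono abs_v_le) simp
  then show ?thesis by (simp add: power_mult_distrib)
qed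

text \<open>Both follow from (R - \<rho>) (R + \<rho>) = - 2 h v - v^2, the sphere equation at two
  heights. The slope of the horizontal radius in height is - h / \<rho>, and the deviation from that
  linear change is exactly - ((R - \<rho>)^2 + v^2) / (2 \<rho>); 544 is half of 1024 + 64.\<close>

lemma radius_difference:
  "\<bar>R - \<rho>\<bar> \<le> 32 * \<eta>" "\<bar>R - \<rho> + h * v / \<rho>\<bar> \<le> 544 * \<eta>\<^sup>2 / \<rho>"
proof -
  have prod: "(R - \<rho>) * (R + \<rho>) = - (2 * h * v) - v\<^sup>2"
  proof -
    have "R\<^sup>2 = 1 - (cos \<theta>)\<^sup>2" by (simp add: sin_squared_eq)
    then show ?thesis using on_sphere unfolding v_def by algebra
  qed
  note h1 = abs_h_le_1
  have v2: "\<bar>v\<bar> \<le> 2" using h1 abs_cos_le_one[of \<theta>] unfolding v_def by linarith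
  have "\<bar>R - \<rho>\<bar> * \<rho> \<le> \<bar>R - \<rho>\<bar> * (R + \<rho>)" using R_nonneg by (intro mult_left_mono) auto
  also have "\<dots> = \<bar>- (2 * h * v) - v\<^sup>2\<bar>" using R_nonneg \<rho> by (simp add: prod[symmetric] abs_mult)
  also have "\<dots> \<le> 2 * (\<bar>h\<bar> * \<bar>v\<bar>) + \<bar>v\<bar> * \<bar>v\<bar>"
    using abs_triangle_ineq4[of "- (2 * h * v)" "v\<^sup>2"] by (simp add: abs_mult power2_eq_square)
  also have "\<dots> \<le> 2 * (1 * \<bar>v\<bar>) + 2 * \<bar>v\<bar>" using h1 v2 by (intro add_mono mult_mono) auto
  also have "\<dots> \<le> 4 * (8 * \<rho> * \<eta>)" using abs_v_le by (simp add: mult_ac)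
  finally have "\<bar>R - \<rho>\<bar> * \<rho> \<le> (32 * \<eta>) * \<rho>" by (simp add: mult_ac)
  then show R1: "\<bar>R - \<rho>\<bar> \<le> 32 * \<eta>" using \<rho> by simp
  have id: "R - \<rho> + h * v / \<rho> = - ((R - \<rho>)\<^sup>2 + v\<^sup>2) / (2 * \<rho>)"
  proof -
    have "2 * \<rho> * (R - \<rho> + h * v / \<rho>) = 2 * \<rho> * (R - \<rho>) + 2 * h * v" using \<rho> by (simp add: field_simps)
    also have "\<dots> = - ((R - \<rho>)\<^sup>2 + v\<^sup>2)" using prod by algebra
    finally show ?thesis using \<rho> by (simp add: field_simps)
  qed
  have "\<bar>R - \<rho> + h * v / \<rho>\<bar> = ((R - \<rho>)\<^sup>2 + v\<^sup>2) / (2 * \<rho>)"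
    unfolding id using \<rho> by (simp add: abs_divide)
  also have "\<dots> \<le> (1024 * \<eta>\<^sup>2 + 64 * \<eta>\<^sup>2) / (2 * \<rho>)"
  proof (intro divide_right_mono add_mono)
    have "\<bar>R - \<rho>\<bar>\<^sup>2 \<le> (32 * \<eta>)\<^sup>2" by (intro power_mono R1) simp
    then show "(R - \<rho>)\<^sup>2 \<le> 1024 * \<eta>\<^sup>2" by (simp add: power_mult_distrib)
    have "\<rho>\<^sup>2 \<le> 1\<^sup>2" using \<rho>_le_1 \<rho> by (intro power_mono) auto
    then have "64 * \<rho>\<^sup>2 * \<eta>\<^sup>2 \<le> 64 * 1 * \<eta>\<^sup>2" by (intro mult_right_mono) auto
    then show "v\<^sup>2 \<le> 64 * \<eta>\<^sup>2" using v_square_le by simp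
  qed (use \<rho> in simp)
  also have "\<dots> = 544 * \<eta>\<^sup>2 / \<rho>" using \<rho> by (simp add: field_simps)
  finally show "\<bar>R - \<rho> + h * v / \<rho>\<bar> \<le> 544 * \<eta>\<^sup>2 / \<rho>" .
qed

lemma R_div_n: "R / real n \<le> 33 * \<eta>"
proof -
  have "R \<le> \<rho> + 32 * \<eta>" using radius_difference(1) by linarith
  also have "\<dots> \<le> real n * \<eta> + real n * (32 * \<eta>)"
  proof -
    have "1 * (32 * \<eta>) \<le> real n * (32 * \<eta>)" using n_pos \<eta> by (intro mult_right_mono) auto
    then show ?thesis using \<rho>_le by linarith
  qed
  finally show ?thesis using n_pos by (simp add: field_simps)
qed

lemma \<phi>_square: "\<phi>\<^sup>2 \<le> 16 / (real n)\<^sup>2"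
proof -
  have "\<bar>\<phi>\<bar>\<^sup>2 \<le> (pi / real n)\<^sup>2" by (intro power_mono \<phi>) simp
  also have "\<dots> \<le> (4 / real n)\<^sup>2" using pi_less_4 n_pos by (intro power_mono divide_right_mono) auto
  finally show ?thesis by (simp add: power_divide)
qed

text \<open>Rotation by \<phi> shortens the component along the original direction by R (1 - cos
  \<phi>), again of order \<open>\<eta>\<^sup>2 / \<rho>\<close> since 1 / n <= \<eta> / \<rho>. The
  constants 544 and 264 are rounded up to 1000.\<close>

lemma horizontal_difference: "\<bar>R * cos \<phi> - \<rho> + h * v / \<rho>\<bar> \<le> 1000 * \<eta>\<^sup>2 / \<rho>"
proof -
  have "R * (1 - cos \<phi>) \<le> R * (8 / (real n)\<^sup>2)"
    using one_minus_cos_le[of \<phi>] \<phi>_square R_nonneg by (intro mult_left_mono) auto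
  also have "\<dots> = 8 * ((R / real n) * (1 / real n))" by (simp add: power2_eq_square)
  also have "\<dots> \<le> 8 * ((33 * \<eta>) * (\<eta> / \<rho>))"
  proof (intro mult_left_mono mult_mono R_div_n)
    show "1 / real n \<le> \<eta> / \<rho>" using \<rho>_le \<rho> n_pos by (simp add: field_simps)
  qed (use \<eta> n_pos in auto)
  also have "\<dots> = 264 * \<eta>\<^sup>2 / \<rho>" by (simp add: power2_eq_square)
  finally have "R * (1 - cos \<phi>) \<le> 264 * \<eta>\<^sup>2 / \<rho>" .
  moreover have "0 \<le> R * (1 - cos \<phi>)" using R_nonneg by simp
  moreover have "R * cos \<phi> - \<rho> + h * v / \<rho> = (R - \<rho> + h * v / \<rho>) - R * (1 - cos \<phi>)" by (simp add: algebra_simps)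
  moreover have "544 * \<eta>\<^sup>2 / \<rho> + 264 * \<eta>\<^sup>2 / \<rho> \<le> 1000 * \<eta>\<^sup>2 / \<rho>"
  proof -
    have "0 \<le> \<eta>\<^sup>2 / \<rho>" using \<rho> by simp
    then have "544 * (\<eta>\<^sup>2 / \<rho>) + 264 * (\<eta>\<^sup>2 / \<rho>) \<le> 1000 * (\<eta>\<^sup>2 / \<rho>)" by linarith
    then show ?thesis by simp
  qed
  moreover have "\<bar>A\<bar> \<le> s" if "B \<le> q" "0 \<le> B" "A = A' - B" "p + q \<le> s" "\<bar>A'\<bar> \<le> p" for A A' B p q s :: real
    using that by linarith
  ultimately show ?thesis using radius_difference(2) by blast
qed

text \<open>Radial, longitudinal and vertical parts give 1024 + 528 + 64 = 1616, below 42^2 =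
  1764.\<close>

lemma displacement: "norm (y \<theta> \<phi> l - x l) \<le> 42 * \<eta>"
proof (rule power2_le_imp_le)
  have "(norm (y \<theta> \<phi> l - x l))\<^sup>2 = (R - \<rho>)\<^sup>2 + 2 * R * \<rho> * (1 - cos \<phi>) + v\<^sup>2"
    unfolding y_def x_def v_def by (rule norm_circle_point_diff)
  also have "\<dots> \<le> 1024 * \<eta>\<^sup>2 + 528 * \<eta>\<^sup>2 + 64 * \<eta>\<^sup>2"
  proof (intro add_mono)
    have "\<bar>R - \<rho>\<bar>\<^sup>2 \<le> (32 * \<eta>)\<^sup>2" by (intro power_mono radius_difference) simp
    then show "(R - \<rho>)\<^sup>2 \<le> 1024 * \<eta>\<^sup>2" by (simp add: power_mult_distrib)
    have "2 * R * \<rho> * (1 - cos \<phi>) \<le> 2 * R * \<rho> * (8 / (real n)\<^sup>2)"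
      using one_minus_cos_le[of \<phi>] \<phi>_square R_nonneg \<rho> by (intro mult_left_mono) auto
    also have "\<dots> = 16 * ((R / real n) * (\<rho> / real n))" by (simp add: power2_eq_square)
    also have "\<dots> \<le> 16 * ((33 * \<eta>) * \<eta>)"
      using R_div_n \<rho>_le n_pos \<rho> \<eta> by (intro mult_left_mono mult_mono) (auto simp: field_simps)
    finally show "2 * R * \<rho> * (1 - cos \<phi>) \<le> 528 * \<eta>\<^sup>2" by (simp add: power2_eq_square)
    have "\<rho>\<^sup>2 \<le> 1\<^sup>2" using \<rho>_le_1 \<rho> by (intro power_mono) auto
    then have "64 * \<rho>\<^sup>2 * \<eta>\<^sup>2 \<le> 64 * 1 * \<eta>\<^sup>2" by (intro mult_right_mono) auto
    then show "v\<^sup>2 \<le> 64 * \<eta>\<^sup>2" using v_square_le by simp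
  qed
  also have "\<dots> \<le> (42 * \<eta>)\<^sup>2" by (simp add: power_mult_distrib)
  finally show "(norm (y \<theta> \<phi> l - x l))\<^sup>2 \<le> (42 * \<eta>)\<^sup>2" .
qed (use \<eta> in simp)

text \<open>This is where \<open>\<eta>_le\<close> enters: the displacement is at most 42 \<delta>,
  while both roots are at least \<delta>, whence 43.\<close>

lemma sqrt_D_compare:
  "sqrt (D (y \<theta> \<phi> l)) \<le> 43 * sqrt (D (x l))" "sqrt (D (x l)) \<le> 43 * sqrt (D (y \<theta> \<phi> l))"
proof -
  have "\<bar>sqrt (D (y \<theta> \<phi> l)) - sqrt (D (x l))\<bar> \<le> r * norm (y \<theta> \<phi> l - x l)"
    by (rule sqrt_D_lipschitz[OF y_sphere x_sphere])
  also have "\<dots> \<le> 1 * (42 * \<eta>)" using displacement r by (intro mult_mono) auto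
  also have "\<dots> \<le> 42 * \<delta>" using \<eta>_le by simp
  finally have "\<bar>sqrt (D (y \<theta> \<phi> l)) - sqrt (D (x l))\<bar> \<le> 42 * \<delta>" .
  moreover have "a \<le> 43 * b \<and> b \<le> 43 * a" if "\<bar>a - b\<bar> \<le> 42 * d" "d \<le> a" "d \<le> b" for a b d :: real
    using that by linarith
  ultimately show "sqrt (D (y \<theta> \<phi> l)) \<le> 43 * sqrt (D (x l))" "sqrt (D (x l)) \<le> 43 * sqrt (D (y \<theta> \<phi> l))"
    using \<delta>_le_sqrt_D[OF x_sphere, of l] \<delta>_le_sqrt_D[OF y_sphere, of \<theta> \<phi> l] by blast+
qed

lemma D_compare: "D (y \<theta> \<phi> l) \<le> c * D (x l)" "D (x l) \<le> c * D (y \<theta> \<phi> l)"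
proof -
  have sq: "d \<le> c * e" if "sqrt d \<le> 43 * sqrt e" "0 \<le> d" "0 \<le> e" for d e
  proof -
    have "(sqrt d)\<^sup>2 \<le> (43 * sqrt e)\<^sup>2" using that by (intro power_mono) auto
    then show ?thesis using that by (simp add: power_mult_distrib)
  qed
  have "0 \<le> D (x l)" "0 \<le> D (y \<theta> \<phi> l)"
    by (intro less_imp_le D_pos x_sphere y_sphere)+
  then show "D (y \<theta> \<phi> l) \<le> c * D (x l)" "D (x l) \<le> c * D (y \<theta> \<phi> l)"
    using sq sqrt_D_compare by blast+
qed

text \<open>Better than the displacement bound by a factor D: the difference of inner products is,
  up to 2 r, a difference of squares (a - b) (a + b) with a + b <= 44 a. Here 924 = 42 * 44 / 2, and
  its square is below 10 ^ 6.\<close>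

lemma inner_difference_square: "(y \<theta> \<phi> l \<bullet> z - x l \<bullet> z)\<^sup>2 \<le> 10 ^ 6 * \<eta>\<^sup>2 * D (x l)"
proof -
  define a b where "a = sqrt (D (x l))" and "b = sqrt (D (y \<theta> \<phi> l))"
  have ab: "0 \<le> a" "0 \<le> b" "D (x l) = a\<^sup>2" "D (y \<theta> \<phi> l) = b\<^sup>2"
    using less_imp_le[OF D_pos[OF x_sphere, of l]] less_imp_le[OF D_pos[OF y_sphere, of \<theta> \<phi> l]]
    by (simp_all only: a_def b_def real_sqrt_ge_zero real_sqrt_pow2)
  have prod: "2 * r * (y \<theta> \<phi> l \<bullet> z - x l \<bullet> z) = (a - b) * (a + b)"
    using ab(3,4) by (simp add: power2_eq_square algebra_simps)
  have "2 * r * \<bar>y \<theta> \<phi> l \<bullet> z - x l \<bullet> z\<bar> = \<bar>2 * r * (y \<theta> \<phi> l \<bullet> z - x l \<bullet> z)\<bar>"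
    using r by (simp add: abs_mult)
  also have "\<dots> = \<bar>a - b\<bar> * \<bar>a + b\<bar>" unfolding prod by (rule abs_mult)
  also have "\<dots> \<le> (r * (42 * \<eta>)) * (44 * a)"
  proof (intro mult_mono)
    have "\<bar>a - b\<bar> \<le> r * norm (y \<theta> \<phi> l - x l)"
      using sqrt_D_lipschitz[OF y_sphere x_sphere, of \<theta> \<phi> l l] by (simp add: a_def b_def abs_minus_commute)
    also have "\<dots> \<le> r * (42 * \<eta>)" using displacement r by (intro mult_left_mono) auto
    finally show "\<bar>a - b\<bar> \<le> r * (42 * \<eta>)" .
    have "b \<le> 43 * a" unfolding a_def b_def by (rule sqrt_D_compare(1))
    then show "\<bar>a + b\<bar> \<le> 44 * a" using ab(1,2) by simp
  qed (use r \<eta> in auto)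
  also have "\<dots> = 2 * r * (924 * \<eta> * a)" by simp
  finally have "\<bar>y \<theta> \<phi> l \<bullet> z - x l \<bullet> z\<bar> \<le> 924 * \<eta> * a" by (rule mult_left_le_imp_le) (use r in simp)
  then have "\<bar>y \<theta> \<phi> l \<bullet> z - x l \<bullet> z\<bar>\<^sup>2 \<le> (924 * \<eta> * a)\<^sup>2" by (intro power_mono) auto
  also have "\<dots> \<le> 10 ^ 6 * \<eta>\<^sup>2 * a\<^sup>2"
    by (simp add: power_mult_distrib mult_right_mono)
  finally show ?thesis by (simp add: ab(3))
qed

lemma K_compare: "K (x l) \<le> c\<^sup>2 * K (y \<theta> \<phi> l)"
  by (rule poisson_le_poisson[OF r_abs(1) _ _ _ D_compare(1)])
    (use abs_inner_sphere_le_1[OF _ z] x_sphere y_sphere in auto)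

text \<open>Of the two powers of D in the second derivative, one cancels against
  \<open>inner_difference_square\<close> and the other is at least \<open>\<delta>\<^sup>2\<close>.
  The outcome is an error relative to the kernel itself.\<close>

lemma taylor_remainder:
  "\<bar>K (y \<theta> \<phi> l) - K (x l) - poisson_deriv r (x l \<bullet> z) * (y \<theta> \<phi> l \<bullet> z - x l \<bullet> z)\<bar>
     \<le> 15 * c ^ 4 * 10 ^ 6 * \<eta>\<^sup>2 / \<delta>\<^sup>2 * K (x l)"
proof -
  have K0: "0 \<le> K (x l)" by (rule K_nonneg[OF x_sphere])
  have D0: "0 < D (x l)" by (rule D_pos[OF x_sphere])
  have "\<bar>K (y \<theta> \<phi> l) - K (x l) - poisson_deriv r (x l \<bullet> z) * (y \<theta> \<phi> l \<bullet> z - x l \<bullet> z)\<bar>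
      \<le> 15 * c ^ 4 * K (x l) / (D (x l))\<^sup>2 * (y \<theta> \<phi> l \<bullet> z - x l \<bullet> z)\<^sup>2"
    by (rule poisson_taylor[OF r_abs(2) r(2) _ _ _ D_compare(2)])
      (use abs_inner_sphere_le_1[OF _ z] x_sphere y_sphere in auto)
  also have "\<dots> \<le> 15 * c ^ 4 * K (x l) / (D (x l))\<^sup>2 * (10 ^ 6 * \<eta>\<^sup>2 * D (x l))"
    using K0 by (intro mult_left_mono inner_difference_square) simp
  also have "\<dots> = 15 * c ^ 4 * 10 ^ 6 * \<eta>\<^sup>2 * K (x l) / D (x l)"
    using D0 by (simp add: power2_eq_square)
  also have "\<dots> \<le> 15 * c ^ 4 * 10 ^ 6 * \<eta>\<^sup>2 * K (x l) / \<delta>\<^sup>2"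
    using K0 \<delta>_pos D0 D_ge[OF x_sphere, of l] by (intro divide_left_mono mult_pos_pos zero_less_power) auto
  finally show ?thesis by simp
qed

text \<open>The two subtracted linear terms are kept because they integrate to 0 over the cell.
  Everything else is of second order: the Taylor remainder and the curvature term
  \<open>R1 * u l\<close>, which needs \<open>ring_cancellation\<close> after summation over the
  parallel.\<close>

lemma cell_estimate:
  "\<bar>(\<Sum>l<n. K (y \<theta> \<phi> l)) - (\<Sum>l<n. K (x l))
      - v * (\<Sum>l<n. poisson_deriv r (x l \<bullet> z) * (z $ 3 - h / \<rho> * u l))
      - sin \<phi> * (R * (\<Sum>l<n. poisson_deriv r (x l \<bullet> z) * u' l))\<bar>
    \<le> 10 ^ 8 * c ^ 6 * \<eta>\<^sup>2 / \<delta>\<^sup>2 * (\<Sum>l<n. K (y \<theta> \<phi> l))"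
proof -
  define k where "k = (\<lambda>l. poisson_deriv r (x l \<bullet> z))"
  define R1 where "R1 = R * cos \<phi> - \<rho> + h * v / \<rho>"
  \<comment> \<open>The displacement is resolved into its tangential parts, in height and in
    longitude, and a residual \<open>R1\<close> along the outward direction.\<close>
  have diff: "y \<theta> \<phi> l \<bullet> z - x l \<bullet> z = R1 * u l + v * (z $ 3 - h / \<rho> * u l) + sin \<phi> * (R * u' l)" for l
    by (simp add: y_inner x_inner R1_def v_def algebra_simps)
  define E where "E = (\<lambda>l. K (y \<theta> \<phi> l) - K (x l) - k l * (y \<theta> \<phi> l \<bullet> z - x l \<bullet> z))"
  have split: "K (y \<theta> \<phi> l) - K (x l) - v * (k l * (z $ 3 - h / \<rho> * u l)) - sin \<phi> * (R * (k l * u' l)) = E l + R1 * (k l * u l)" for l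
    unfolding E_def diff by (simp add: algebra_simps)
  have K0: "0 \<le> (\<Sum>l<n. K (x l))" by (intro sum_nonneg K_nonneg x_sphere)
  have "(\<Sum>l<n. K (y \<theta> \<phi> l)) - (\<Sum>l<n. K (x l)) - v * (\<Sum>l<n. k l * (z $ 3 - h / \<rho> * u l)) - sin \<phi> * (R * (\<Sum>l<n. k l * u' l))
      = (\<Sum>l<n. E l + R1 * (k l * u l))"
    unfolding split[symmetric] by (simp add: sum_subtractf sum_distrib_left)
  also have "\<dots> = (\<Sum>l<n. E l) + R1 * (\<Sum>l<n. k l * u l)" by (simp add: sum.distrib sum_distrib_left)
  also have "\<bar>\<dots>\<bar> \<le> \<bar>\<Sum>l<n. E l\<bar> + \<bar>R1\<bar> * \<bar>\<Sum>l<n. k l * u l\<bar>"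
    by (metis abs_mult abs_triangle_ineq)
  also have "\<dots> \<le> 15 * c ^ 4 * 10 ^ 6 * \<eta>\<^sup>2 / \<delta>\<^sup>2 * (\<Sum>l<n. K (x l))
      + (1000 * \<eta>\<^sup>2 / \<rho>) * (30 * c ^ 4 * \<rho> / \<delta>\<^sup>2 * (\<Sum>l<n. K (x l)))"
  proof (intro add_mono mult_mono)
    have "\<bar>\<Sum>l<n. E l\<bar> \<le> (\<Sum>l<n. \<bar>E l\<bar>)" by (rule sum_abs)
    also have "\<dots> \<le> (\<Sum>l<n. 15 * c ^ 4 * 10 ^ 6 * \<eta>\<^sup>2 / \<delta>\<^sup>2 * K (x l))"
      unfolding E_def k_def by (intro sum_mono taylor_remainder)
    finally show "\<bar>\<Sum>l<n. E l\<bar> \<le> 15 * c ^ 4 * 10 ^ 6 * \<eta>\<^sup>2 / \<delta>\<^sup>2 * (\<Sum>l<n. K (x l))"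
      by (simp only: sum_distrib_left)
    show "\<bar>R1\<bar> \<le> 1000 * \<eta>\<^sup>2 / \<rho>" unfolding R1_def by (rule horizontal_difference)
    show "\<bar>\<Sum>l<n. k l * u l\<bar> \<le> 30 * c ^ 4 * \<rho> / \<delta>\<^sup>2 * (\<Sum>l<n. K (x l))" unfolding k_def by (rule ring_cancellation)
  qed (use \<rho> in auto)
  also have "\<dots> = (15 * 10 ^ 6 + 30000) * c ^ 4 * \<eta>\<^sup>2 / \<delta>\<^sup>2 * (\<Sum>l<n. K (x l))"
    using \<rho> by (simp add: field_simps)
  also have "\<dots> \<le> 10 ^ 8 * c ^ 4 * \<eta>\<^sup>2 / \<delta>\<^sup>2 * (\<Sum>l<n. K (x l))"
    using K0 by (intro mult_right_mono divide_right_mono) auto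
  \<comment> \<open>The error is moved from the nodes to the running point \<open>y\<close>, so that
    after integration it is a multiple of the kernel's mass on the band.\<close>
  also have "\<dots> \<le> 10 ^ 8 * c ^ 4 * \<eta>\<^sup>2 / \<delta>\<^sup>2 * (c\<^sup>2 * (\<Sum>l<n. K (y \<theta> \<phi> l)))"
  proof (intro mult_left_mono)
    have "(\<Sum>l<n. K (x l)) \<le> (\<Sum>l<n. c\<^sup>2 * K (y \<theta> \<phi> l))" by (intro sum_mono K_compare)
    then show "(\<Sum>l<n. K (x l)) \<le> c\<^sup>2 * (\<Sum>l<n. K (y \<theta> \<phi> l))" by (simp only: sum_distrib_left)
  qed simp
  also have "\<dots> = 10 ^ 8 * c ^ 6 * \<eta>\<^sup>2 / \<delta>\<^sup>2 * (\<Sum>l<n. K (y \<theta> \<phi> l))" by simp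
  finally show ?thesis unfolding k_def .
qed

end

section \<open>Integration of the cell estimate over circles and bands\<close>

lemma integral_abs_diff_le:
  fixes f g e :: "real \<Rightarrow> real"
  assumes "continuous_on {a..b} f" "continuous_on {a..b} g" "continuous_on {a..b} e"
    and "\<And>t. t \<in> {a..b} \<Longrightarrow> \<bar>f t - g t\<bar> \<le> e t"
  shows "\<bar>integral {a..b} f - integral {a..b} g\<bar> \<le> integral {a..b} e"
proof -
  have i: "f integrable_on {a..b}" "g integrable_on {a..b}" "e integrable_on {a..b}"
    using assms by (auto intro: integrable_continuous_real)
  have "norm (integral {a..b} (\<lambda>t. f t - g t)) \<le> integral {a..b} e"
    by (rule integral_norm_bound_integral) (use i assms(4) in \<open>auto intro: integrable_diff\<close>)
  then show ?thesis using i by (simp add: Henstock_Kurzweil_Integration.integral_diff)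
qed

lemma integral_periodic_split:
  fixes g :: "real \<Rightarrow> real"
  assumes cg: "continuous_on UNIV g" and per: "\<And>t. g (t + 2 * pi) = g t" and n: "0 < n"
  shows "integral {0..2 * pi} g = integral {- (pi / real n)..pi / real n} (\<lambda>\<phi>. \<Sum>l<n. g (2 * pi * real l / real n + \<phi>))"
proof -
  define a where "a = pi / real n"
  have a: "a > 0" "2 * a * real n = 2 * pi" using n by (auto simp: a_def)
  have gi: "g integrable_on {s..t}" for s t
    using cg by (intro integrable_continuous_real) (auto intro: continuous_on_subset)
  have m: "(\<Sum>l<m. integral {2 * a * real l - a..2 * a * real l + a} g) = integral {- a..2 * a * real m - a} g" for m
  proof (induction m)
    case (Suc m)
    have "integral {- a..2 * a * real m - a} g + integral {2 * a * real m - a..2 * a * real m + a} g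
        = integral {- a..2 * a * real m + a} g"
      by (rule Henstock_Kurzweil_Integration.integral_combine) (use a gi in auto)
    then show ?case using Suc by (simp add: algebra_simps)
  qed simp
  have sh: "integral {2 * a * real l - a..2 * a * real l + a} g = integral {- a..a} (\<lambda>\<phi>. g (2 * pi * real l / real n + \<phi>))" for l
  proof -
    have "integral {- a..a} (g \<circ> (+) (2 * a * real l)) = integral {- a + 2 * a * real l..a + 2 * a * real l} g"
      by (rule integral_shift_Icc_real)
    then show ?thesis by (simp add: o_def a_def add.commute)
  qed
  have "integral {0..2 * pi} g = integral {- a..- a + 2 * pi} g"
    by (rule integral_periodic_shift[symmetric, OF cg]) (use per in auto)
  also have "\<dots> = (\<Sum>l<n. integral {2 * a * real l - a..2 * a * real l + a} g)"
    using m[of n] a by simp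
  also have "\<dots> = (\<Sum>l<n. integral {- a..a} (\<lambda>\<phi>. g (2 * pi * real l / real n + \<phi>)))"
    by (simp only: sh)
  also have "\<dots> = integral {- a..a} (\<lambda>\<phi>. \<Sum>l<n. g (2 * pi * real l / real n + \<phi>))"
    by (rule integral_sum[symmetric])
      (auto intro!: integrable_continuous_real continuous_on_compose2[OF cg] continuous_intros)
  finally show ?thesis by (simp add: a_def)
qed

definition circle_integral :: "real \<Rightarrow> real^3 \<Rightarrow> real \<Rightarrow> real" where
  "circle_integral r z \<theta> = integral {0..2 * pi} (\<lambda>\<phi>. poisson r (sphere_param (\<theta>, \<phi>) \<bullet> z))"

lemma continuous_on_poisson_sphere_param:
  assumes r: "\<bar>r\<bar> < 1" and z: "z \<in> S2"
  shows "continuous_on A (\<lambda>p. poisson r (sphere_param p \<bullet> z))"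
proof (rule continuous_on_compose2[OF continuous_on_poisson[OF r]])
  show "continuous_on A (\<lambda>p. sphere_param p \<bullet> z)"
    by (intro continuous_intros continuous_on_sphere_param)
  show "(\<lambda>p. sphere_param p \<bullet> z) ` A \<subseteq> {- 1..1}"
    using abs_inner_sphere_le_1[OF sphere_param_in_sphere z] by (auto simp: abs_le_iff minus_le_iff)
qed

lemma continuous_on_circle_integral:
  assumes "\<bar>r\<bar> < 1" "z \<in> S2"
  shows "continuous_on A (circle_integral r z)"
proof -
  have "continuous_on A (\<lambda>\<theta>. integral (cbox 0 (2 * pi)) (\<lambda>\<phi>. poisson r (sphere_param (\<theta>, \<phi>) \<bullet> z)))"
    by (rule integral_continuous_on_param)
      (use continuous_on_poisson_sphere_param[OF assms] in \<open>simp add: case_prod_unfold\<close>)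
  then show ?thesis by (simp add: circle_integral_def[abs_def])
qed

lemma integral_circle_integral:
  assumes r: "0 < r" "r < 1" and z: "z \<in> S2"
  shows "integral {0..pi} (\<lambda>\<theta>. sin \<theta> * circle_integral r z \<theta>) = 4 * pi"
proof -
  have r1: "\<bar>r\<bar> < 1" using r by simp
  have "1 = (LINT y|\<sigma>. poisson r (z \<bullet> y))" by (rule sphere_integral_poisson[OF r z, symmetric])
  also have "\<dots> = integral {0..pi} (\<lambda>\<theta>. integral {0..2 * pi} (\<lambda>\<phi>. sin \<theta> / (4 * pi) * poisson r (z \<bullet> sphere_param (\<theta>, \<phi>))))"
    by (rule sphere_integral_continuous[OF continuous_on_poisson_inner[OF r1 z]])
  also have "\<dots> = integral {0..pi} (\<lambda>\<theta>. 1 / (4 * pi) * (sin \<theta> * circle_integral r z \<theta>))"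
    by (simp add: circle_integral_def inner_commute)
  also have "\<dots> = 1 / (4 * pi) * integral {0..pi} (\<lambda>\<theta>. sin \<theta> * circle_integral r z \<theta>)"
    by (rule integral_mult_right)
  finally show ?thesis by simp
qed

context parallel
begin

lemma cell_estimate:
  assumes "0 \<le> \<theta>" "\<theta> \<le> pi" "\<bar>cos \<theta> - h\<bar> \<le> real n * \<eta>\<^sup>2" "\<bar>\<phi>\<bar> \<le> pi / real n"
  shows "\<bar>(\<Sum>l<n. K (y \<theta> \<phi> l)) - (\<Sum>l<n. K (x l))
      - (cos \<theta> - h) * (\<Sum>l<n. poisson_deriv r (x l \<bullet> z) * (z $ 3 - h / \<rho> * u l))
      - sin \<phi> * (sin \<theta> * (\<Sum>l<n. poisson_deriv r (x l \<bullet> z) * u' l))\<bar>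
    \<le> 10 ^ 8 * c ^ 6 * \<eta>\<^sup>2 / \<delta>\<^sup>2 * (\<Sum>l<n. K (y \<theta> \<phi> l))"
proof -
  interpret parallel_cell \<eta> \<rho> h r n z \<theta> \<phi> by unfold_locales (use assms in auto)
  show ?thesis using cell_estimate unfolding v_def .
qed

lemma y_eq_sphere_param: "y \<theta> \<phi> l = sphere_param (\<theta>, angle l + \<phi>)"
  by (simp add: y_def circle_point_def sphere_param_eq)

lemma circle_integral_eq:
  "circle_integral r z \<theta> = integral {- (pi / real n)..pi / real n} (\<lambda>\<phi>. \<Sum>l<n. K (y \<theta> \<phi> l))"
proof -
  have c: "continuous_on UNIV (\<lambda>\<phi>. K (sphere_param (\<theta>, \<phi>)))"
    by (rule continuous_on_compose2[OF continuous_on_poisson_sphere_param[OF r_abs(1) z, of UNIV]])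
      (auto intro: continuous_intros)
  show ?thesis
    unfolding circle_integral_def y_eq_sphere_param angle_def
    by (rule integral_periodic_split[OF c]) (use n in \<open>auto simp: sphere_param_eq\<close>)
qed

text \<open>Integrating over the symmetric interval of half-width pi / n removes the longitude term,
  since sin \<phi> is odd.\<close>

lemma circle_estimate:
  assumes \<theta>: "0 \<le> \<theta>" "\<theta> \<le> pi" "\<bar>cos \<theta> - h\<bar> \<le> real n * \<eta>\<^sup>2"
  shows "\<bar>circle_integral r z \<theta> - 2 * pi / real n *
      ((\<Sum>l<n. K (x l)) + (cos \<theta> - h) * (\<Sum>l<n. poisson_deriv r (x l \<bullet> z) * (z $ 3 - h / \<rho> * u l)))\<bar>
    \<le> 10 ^ 8 * c ^ 6 * \<eta>\<^sup>2 / \<delta>\<^sup>2 * circle_integral r z \<theta>"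
proof -
  define X where "X = (\<Sum>l<n. K (x l)) + (cos \<theta> - h) * (\<Sum>l<n. poisson_deriv r (x l \<bullet> z) * (z $ 3 - h / \<rho> * u l))"
  define B where "B = sin \<theta> * (\<Sum>l<n. poisson_deriv r (x l \<bullet> z) * u' l)"
  define a where "a = pi / real n"
  have a: "a > 0" using n by (simp add: a_def)
  define f where "f = (\<lambda>\<phi>. \<Sum>l<n. K (y \<theta> \<phi> l))"
  have cf: "continuous_on {- a..a} f"
    unfolding f_def y_eq_sphere_param
    by (intro continuous_on_sum continuous_on_compose2[OF continuous_on_poisson_sphere_param[OF r_abs(1) z, of UNIV]] continuous_intros) auto
  have "\<bar>integral {- a..a} f - integral {- a..a} (\<lambda>\<phi>. X + sin \<phi> * B)\<bar> \<le> integral {- a..a} (\<lambda>\<phi>. 10 ^ 8 * c ^ 6 * \<eta>\<^sup>2 / \<delta>\<^sup>2 * f \<phi>)"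
  proof (rule integral_abs_diff_le[OF cf])
    show "continuous_on {- a..a} (\<lambda>\<phi>. X + sin \<phi> * B)" by (intro continuous_intros)
    show "continuous_on {- a..a} (\<lambda>\<phi>. 10 ^ 8 * c ^ 6 * \<eta>\<^sup>2 / \<delta>\<^sup>2 * f \<phi>)" by (intro continuous_on_mult continuous_on_const cf)
    fix \<phi> assume "\<phi> \<in> {- a..a}"
    then have "\<bar>\<phi>\<bar> \<le> pi / real n" by (auto simp: a_def abs_le_iff)
    from cell_estimate[OF \<theta> this]
    show "\<bar>f \<phi> - (X + sin \<phi> * B)\<bar> \<le> 10 ^ 8 * c ^ 6 * \<eta>\<^sup>2 / \<delta>\<^sup>2 * f \<phi>"
      unfolding f_def X_def B_def by (simp only: diff_diff_eq add.assoc)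
  qed
  moreover have "integral {- a..a} (\<lambda>\<phi>. X + sin \<phi> * B) = 2 * pi / real n * X"
  proof -
    have "((\<lambda>\<phi>. X + sin \<phi> * B) has_integral (X * a - cos a * B) - (X * (- a) - cos (- a) * B)) {- a..a}"
    proof (rule fundamental_theorem_of_calculus)
      fix \<phi> assume "\<phi> \<in> {- a..a}"
      have "((\<lambda>\<phi>. X * \<phi> - cos \<phi> * B) has_real_derivative X + sin \<phi> * B) (at \<phi> within {- a..a})"
        by (auto intro!: derivative_eq_intros)
      then show "((\<lambda>\<phi>. X * \<phi> - cos \<phi> * B) has_vector_derivative X + sin \<phi> * B) (at \<phi> within {- a..a})"
        by (simp add: has_real_derivative_iff_has_vector_derivative)
    qed (use a in simp)
    then show ?thesis by (simp add: integral_unique a_def)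
  qed
  moreover have "integral {- a..a} (\<lambda>\<phi>. 10 ^ 8 * c ^ 6 * \<eta>\<^sup>2 / \<delta>\<^sup>2 * f \<phi>) = 10 ^ 8 * c ^ 6 * \<eta>\<^sup>2 / \<delta>\<^sup>2 * integral {- a..a} f"
    by (rule integral_mult_right)
  moreover have "integral {- a..a} f = circle_integral r z \<theta>"
    unfolding circle_integral_eq f_def a_def ..
  ultimately show ?thesis by (simp only: X_def)
qed

text \<open>The heights cos \<alpha> and cos \<beta> lie symmetrically about \<open>h\<close> and
  sin \<theta> d\<theta> is uniform in height, so the linear height term integrates to 0. The weight
  \<open>4 * pi * \<eta>\<^sup>2\<close> is 2 pi / n times the height
  \<open>2 * n * \<eta>\<^sup>2\<close> of the band.\<close>

lemma band_estimate:
  assumes \<alpha>\<beta>: "0 \<le> \<alpha>" "\<alpha> \<le> \<beta>" "\<beta> \<le> pi"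
    and cos: "cos \<alpha> = h + real n * \<eta>\<^sup>2" "cos \<beta> = h - real n * \<eta>\<^sup>2"
  shows "\<bar>integral {\<alpha>..\<beta>} (\<lambda>\<theta>. sin \<theta> * circle_integral r z \<theta>) - 4 * pi * \<eta>\<^sup>2 * (\<Sum>l<n. K (x l))\<bar>
    \<le> 10 ^ 8 * c ^ 6 * \<eta>\<^sup>2 / \<delta>\<^sup>2 * integral {\<alpha>..\<beta>} (\<lambda>\<theta>. sin \<theta> * circle_integral r z \<theta>)"
proof -
  define X where "X = (\<Sum>l<n. K (x l))"
  define A where "A = (\<Sum>l<n. poisson_deriv r (x l \<bullet> z) * (z $ 3 - h / \<rho> * u l))"
  define k where "k = 2 * pi / real n"
  define \<kappa> where "\<kappa> = 10 ^ 8 * c ^ 6 * \<eta>\<^sup>2 / \<delta>\<^sup>2"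
  define F where "F = circle_integral r z"
  have cF: "continuous_on {\<alpha>..\<beta>} F" unfolding F_def by (rule continuous_on_circle_integral[OF r_abs(1) z])
  have "\<bar>integral {\<alpha>..\<beta>} (\<lambda>\<theta>. sin \<theta> * F \<theta>) - integral {\<alpha>..\<beta>} (\<lambda>\<theta>. sin \<theta> * (k * (X + (cos \<theta> - h) * A)))\<bar>
      \<le> integral {\<alpha>..\<beta>} (\<lambda>\<theta>. \<kappa> * (sin \<theta> * F \<theta>))"
  proof (rule integral_abs_diff_le)
    fix \<theta> assume t: "\<theta> \<in> {\<alpha>..\<beta>}"
    have \<theta>: "0 \<le> \<theta>" "\<theta> \<le> pi" using t \<alpha>\<beta> by auto
    have "cos \<theta> \<le> cos \<alpha>" "cos \<beta> \<le> cos \<theta>" using t \<alpha>\<beta> \<theta> by (auto intro!: cos_monotone_0_pi_le)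
    then have "\<bar>cos \<theta> - h\<bar> \<le> real n * \<eta>\<^sup>2" using cos by (simp add: abs_le_iff)
    from circle_estimate[OF \<theta> this]
    have e: "\<bar>F \<theta> - k * (X + (cos \<theta> - h) * A)\<bar> \<le> \<kappa> * F \<theta>"
      unfolding F_def k_def X_def A_def \<kappa>_def .
    have s: "0 \<le> sin \<theta>" using \<theta> by (rule sin_ge_zero)
    have "\<bar>sin \<theta> * F \<theta> - sin \<theta> * (k * (X + (cos \<theta> - h) * A))\<bar> = sin \<theta> * \<bar>F \<theta> - k * (X + (cos \<theta> - h) * A)\<bar>"
      using s by (simp only: right_diff_distrib[symmetric] abs_mult abs_of_nonneg)
    also have "\<dots> \<le> sin \<theta> * (\<kappa> * F \<theta>)" by (rule mult_left_mono[OF e s])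
    finally show "\<bar>sin \<theta> * F \<theta> - sin \<theta> * (k * (X + (cos \<theta> - h) * A))\<bar> \<le> \<kappa> * (sin \<theta> * F \<theta>)"
      by (simp only: mult.left_commute)
  qed (intro continuous_intros cF)+
  moreover have "integral {\<alpha>..\<beta>} (\<lambda>\<theta>. sin \<theta> * (k * (X + (cos \<theta> - h) * A))) = 4 * pi * \<eta>\<^sup>2 * X"
  proof -
    let ?G = "\<lambda>\<theta>. k * (- (X * cos \<theta>) - A * (cos \<theta> - h)\<^sup>2 / 2)"
    have "((\<lambda>\<theta>. sin \<theta> * (k * (X + (cos \<theta> - h) * A))) has_integral (?G \<beta> - ?G \<alpha>)) {\<alpha>..\<beta>}"
    proof (rule fundamental_theorem_of_calculus[OF \<alpha>\<beta>(2)])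
      fix \<theta> assume "\<theta> \<in> {\<alpha>..\<beta>}"
      have "(?G has_real_derivative sin \<theta> * (k * (X + (cos \<theta> - h) * A))) (at \<theta> within {\<alpha>..\<beta>})"
        by (auto intro!: derivative_eq_intros simp: field_simps power2_eq_square)
      then show "(?G has_vector_derivative sin \<theta> * (k * (X + (cos \<theta> - h) * A))) (at \<theta> within {\<alpha>..\<beta>})"
        by (simp add: has_real_derivative_iff_has_vector_derivative)
    qed
    moreover have "?G \<beta> - ?G \<alpha> = 4 * pi * \<eta>\<^sup>2 * X"
      unfolding cos using n by (simp add: k_def field_simps)
    ultimately show ?thesis by (simp add: integral_unique)
  qed
  moreover have "integral {\<alpha>..\<beta>} (\<lambda>\<theta>. \<kappa> * (sin \<theta> * F \<theta>)) = \<kappa> * integral {\<alpha>..\<beta>} (\<lambda>\<theta>. sin \<theta> * F \<theta>)"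
    by (rule integral_mult_right)
  ultimately show ?thesis by (simp only: X_def F_def \<kappa>_def)
qed

end

text \<open>The constant of \<open>cell_estimate\<close> with \<open>c\<close> = 2000, named outside
  the locale because it depends on no parameter.\<close>

definition discrepancy_const :: real where "discrepancy_const = 10 ^ 8 * 2000 ^ 6"

lemma discrepancy_const_nonneg: "0 \<le> discrepancy_const"
  by (simp add: discrepancy_const_def)

section \<open>The Diamond points\<close>

locale diamond_points =
  fixes N :: nat
  assumes N4: "4 \<le> N"
begin

abbreviation M :: nat where "M \<equiv> diamond_M N"
abbreviation d :: "nat \<Rightarrow> nat" where "d \<equiv> diamond_r N"
abbreviation parallels :: "nat set" where "parallels \<equiv> {1..2 * M - 1}"

definition S :: "nat \<Rightarrow> nat" where "S j = (\<Sum>k = 1..<j. d k)"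

lemma M_bounds: "1 \<le> M" "4 * M\<^sup>2 \<le> N" "N < 4 * (M + 1)\<^sup>2"
proof -
  have s1: "1 \<le> sqrt (real N / 4)" using N4 by simp
  have M: "real M \<le> sqrt (real N / 4)" "sqrt (real N / 4) < real M + 1"
    using s1 unfolding diamond_M_def by linarith+
  show "1 \<le> M" using s1 unfolding diamond_M_def by linarith
  have "(real M)\<^sup>2 \<le> (sqrt (real N / 4))\<^sup>2" using M by (intro power_mono) auto
  then have "real (4 * M\<^sup>2) \<le> real N" by simp
  then show "4 * M\<^sup>2 \<le> N" by (simp only: of_nat_le_iff)
  have "(sqrt (real N / 4))\<^sup>2 < (real M + 1)\<^sup>2" using M s1 by (intro power_strict_mono) auto
  then have "real N < real (4 * (M + 1)\<^sup>2)" by (simp add: add.commute mult.commute)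
  then show "N < 4 * (M + 1)\<^sup>2" by (simp only: of_nat_less_iff)
qed

lemma d_below: "j < M \<Longrightarrow> d j = 4 * j"
  and d_above: "M < j \<Longrightarrow> d j = 4 * (2 * M - j)"
  by (simp_all add: diamond_r_def Let_def)

lemma d_middle: "real (d M) = real N - 4 * real M * (real M - 1)"
proof -
  have "(\<Sum>i = 1..<Suc m. 4 * i) = 2 * Suc m * m" for m :: nat
    by (induction m) simp_all
  moreover have "Suc (M - 1) = M" using M_bounds(1) by simp
  ultimately have s: "(\<Sum>i = 1..<M. 4 * i) = 2 * M * (M - 1)" by metis
  have "2 * (2 * M * (M - 1)) \<le> N"
  proof -
    have "2 * (2 * M * (M - 1)) \<le> 4 * M\<^sup>2" by (simp add: power2_eq_square)
    then show ?thesis using M_bounds(2) by (rule order_trans)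
  qed
  then have "real (N - 2 * (2 * M * (M - 1))) = real N - real (2 * (2 * M * (M - 1)))" by (rule of_nat_diff)
  moreover have "d M = N - 2 * (\<Sum>i = 1..<M. 4 * i)" by (simp add: diamond_r_def Let_def)
  then have "d M = N - 2 * (2 * M * (M - 1))" unfolding s .
  ultimately show ?thesis using M_bounds(1) by (simp add: of_nat_diff)
qed

text \<open>\<open>S j\<close> counts the points on the parallels above the j-th. The range extends
  to \<open>2 * M\<close>, one past the last parallel, where the formula yields the total
  \<open>N\<close>.\<close>

lemma S_closed:
  assumes "1 \<le> j" "j \<le> 2 * M"
  shows "real (S j) = (if j \<le> M then 2 * real j * (real j - 1)
      else real N - 2 * (2 * real M - real j) * (2 * real M - real j + 1))"
  using assms
proof (induction j rule: dec_induct)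
  case base
  then show ?case using M_bounds(1) by (simp add: S_def)
next
  case (step j)
  have Sj: "real (S (Suc j)) = real (S j) + real (d j)" using step(1) by (simp add: S_def)
  have IH: "real (S j) = (if j \<le> M then 2 * real j * (real j - 1)
      else real N - 2 * (2 * real M - real j) * (2 * real M - real j + 1))" using step by simp
  consider "j < M" | "j = M" | "M < j" by linarith
  then show ?case
  proof cases
    case 1
    then show ?thesis using Sj IH d_below by (simp add: algebra_simps)
  next
    case 2
    then show ?thesis using Sj IH d_middle by (simp add: algebra_simps)
  next
    case 3
    then have "real (d j) = 4 * (2 * real M - real j)" using d_above step by (simp add: of_nat_diff)
    then show ?thesis using Sj IH 3 by (simp add: algebra_simps)
  qed
qed

lemma S_Suc: "1 \<le> j \<Longrightarrow> S (Suc j) = S j + d j"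
  by (simp add: S_def)

lemma S_end: "S (2 * M) = N"
proof -
  have "real (S (2 * M)) = real N" using S_closed[of "2 * M"] M_bounds(1) by simp
  then show ?thesis by (simp only: of_nat_eq_iff)
qed

lemma diamond_h_eq: "diamond_h N j = 1 - (2 * real (S j) + real (d j)) / real N"
  by (simp add: diamond_h_def S_def add_divide_distrib)

lemma diamond_h_closed:
  assumes "j \<in> parallels"
  shows "diamond_h N j = (if j < M then 1 - 4 * (real j)\<^sup>2 / real N
      else if j = M then 0 else 4 * (real (2 * M - j))\<^sup>2 / real N - 1)"
proof -
  have N0: "real N > 0" using N4 by simp
  have j: "1 \<le> j" "j \<le> 2 * M" using assms by auto
  consider "j < M" | "j = M" | "M < j" by linarith
  then show ?thesis
  proof cases
    case 1
    then show ?thesis using S_closed[OF j] d_below by (simp add: diamond_h_eq power2_eq_square algebra_simps)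
  next
    case 2
    have "2 * real (S M) + real (d M) = real N" using S_closed[of M] d_middle M_bounds(1) by (simp add: algebra_simps)
    then show ?thesis using 2 N0 by (simp add: diamond_h_eq)
  next
    case 3
    define i where "i = real (2 * M - j)"
    have i: "2 * real M - real j = i" using j by (simp add: i_def of_nat_diff)
    have dj: "real (d j) = 4 * i" using d_above[OF 3] by (simp add: i_def)
    have "2 * real (S j) + real (d j) = 2 * real N - 4 * i\<^sup>2"
    proof -
      have "real (S j) = real N - 2 * i * (i + 1)" using S_closed[OF j] 3 by (simp add: i)
      then show ?thesis unfolding dj by (simp add: power2_eq_square algebra_simps)
    qed
    then show ?thesis using 3 N0 unfolding diamond_h_eq i_def[symmetric] by (simp add: diff_divide_distrib)
  qed
qed

text \<open>Supplies the hypotheses of \<open>parallel\<close> with \<eta> = 1 / sqrt N, in squared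
  form with q = \<open>\<rho>\<^sup>2\<close>. Off the equator \<open>q = e * (2 - e)\<close> lies
  between e and 2 e while \<open>d\<^sup>2 / N\<close> is 4 e. The constant 8 is dictated by the
  equator, which takes up the points left over by rounding.\<close>

lemma parallel_bounds:
  assumes j: "j \<in> parallels"
  shows "2 \<le> d j" "0 < diamond_rho N j" "(diamond_rho N j)\<^sup>2 + (diamond_h N j)\<^sup>2 = 1"
    "diamond_rho N j \<le> real (d j) * (1 / sqrt (real N))"
    "real (d j) * (1 / sqrt (real N)) \<le> 8 * diamond_rho N j"
proof -
  have N0: "real N > 0" using N4 by simp
  define q where "q = 1 - (diamond_h N j)\<^sup>2"
  have *: "2 \<le> d j \<and> 0 < q \<and> q \<le> (real (d j))\<^sup>2 / real N \<and> (real (d j))\<^sup>2 / real N \<le> 64 * q"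
  proof (cases "j = M")
    case True
    have q: "q = 1" using diamond_h_closed[OF j] True by (simp add: q_def)
    define m where "m = real M"
    have m: "1 \<le> m" "4 * m\<^sup>2 \<le> real N" "real N < 4 * (m + 1)\<^sup>2"
    proof -
      show "1 \<le> m" using M_bounds(1) by (simp add: m_def)
      have "real (4 * M\<^sup>2) \<le> real N" using M_bounds(2) by (simp only: of_nat_le_iff)
      then show "4 * m\<^sup>2 \<le> real N" by (simp add: m_def)
      have "real N < real (4 * (M + 1)\<^sup>2)" using M_bounds(3) by (simp only: of_nat_less_iff)
      then show "real N < 4 * (m + 1)\<^sup>2" by (simp add: m_def add.commute)
    qed
    have dM: "real (d M) = real N - 4 * m\<^sup>2 + 4 * m" using d_middle by (simp add: m_def power2_eq_square algebra_simps)
    have lo: "4 * m \<le> real (d M)" using dM m by linarith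
    \<comment> \<open>From N < 4 (m + 1)^2 the equator carries fewer than 12 m + 4 points.\<close>
    have hi: "real (d M) \<le> 16 * m"
    proof -
      have "4 * (m + 1)\<^sup>2 = 4 * m\<^sup>2 + 8 * m + 4" by (simp add: power2_eq_square algebra_simps)
      then show ?thesis using dM m by linarith
    qed
    have "(4 * m)\<^sup>2 \<le> (real (d M))\<^sup>2" using lo m by (intro power_mono) auto
    moreover have "(2 * (m + 1))\<^sup>2 \<le> (4 * m)\<^sup>2" using m by (intro power_mono) auto
    moreover have "(2 * (m + 1))\<^sup>2 = 4 * (m + 1)\<^sup>2" unfolding power_mult_distrib by simp
    ultimately have 1: "real N \<le> (real (d M))\<^sup>2" using m(3) by linarith
    have "(real (d M))\<^sup>2 \<le> (16 * m)\<^sup>2" using hi by (intro power_mono) auto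
    also have "\<dots> = 64 * (4 * m\<^sup>2)" by (simp add: power_mult_distrib)
    also have "\<dots> \<le> 64 * real N" using m by simp
    finally have 2: "(real (d M))\<^sup>2 \<le> 64 * real N" .
    have "2 \<le> real (d M)" using lo m by linarith
    then show ?thesis using 1 2 N0 True by (simp add: q field_simps)
  next
    case False
    define i where "i = (if j < M then j else 2 * M - j)"
    have i: "1 \<le> i" "i < M" "d j = 4 * i" using False j d_below d_above by (auto simp: i_def)
    define e where "e = 4 * (real i)\<^sup>2 / real N"
    have h: "(diamond_h N j)\<^sup>2 = (1 - e)\<^sup>2"
      using diamond_h_closed[OF j] False by (auto simp: i_def e_def power2_commute)
    have e0: "0 < e" using i N0 by (simp add: e_def)
    have e1: "e \<le> 1"
    proof -
      have "i\<^sup>2 \<le> M\<^sup>2" using i by (intro power_mono) auto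
      then have "4 * i\<^sup>2 \<le> N" using M_bounds(2) by linarith
      then have "real (4 * i\<^sup>2) \<le> real N" by (simp only: of_nat_le_iff)
      then show ?thesis using N0 by (simp add: e_def)
    qed
    have q: "q = e * (2 - e)" unfolding q_def h by (simp add: power2_eq_square algebra_simps)
    have q1: "e \<le> q" "q \<le> 2 * e" unfolding q using e0 e1 mult_left_mono[of 1 "2 - e" e] mult_left_mono[of "2 - e" 2 e] by auto
    have "(real (d j))\<^sup>2 / real N = 4 * e" by (simp add: i e_def power_mult_distrib)
    then show ?thesis using i q1 e0 by auto
  qed
  have rho: "diamond_rho N j = sqrt q" by (simp add: diamond_rho_def q_def)
  show "2 \<le> d j" "0 < diamond_rho N j" using * by (auto simp: rho)
  have sq: "(diamond_rho N j)\<^sup>2 = q" using * by (simp add: rho)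
  then show "(diamond_rho N j)\<^sup>2 + (diamond_h N j)\<^sup>2 = 1" by (simp add: q_def)
  have dd: "(real (d j) * (1 / sqrt (real N)))\<^sup>2 = (real (d j))\<^sup>2 / real N" using N0 by (simp add: power_divide)
  have r8: "(8 * diamond_rho N j)\<^sup>2 = 64 * q" by (simp add: power_mult_distrib sq)
  show "diamond_rho N j \<le> real (d j) * (1 / sqrt (real N))"
    by (rule power2_le_imp_le, unfold sq dd) (use * in auto)
  show "real (d j) * (1 / sqrt (real N)) \<le> 8 * diamond_rho N j"
    by (rule power2_le_imp_le, unfold r8 dd) (use * \<open>0 < diamond_rho N j\<close> in auto)
qed

lemma diamond_point_eq:
  "diamond_point N j l = circle_point (diamond_rho N j) (2 * pi * real l / real (d j)) (diamond_h N j)"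
  by (simp add: diamond_point_def circle_point_def)

lemma S_mono: "j \<le> k \<Longrightarrow> S j \<le> S k"
  unfolding S_def by (rule sum_mono2) auto

lemma diamond_h_strict_decreasing:
  assumes "j \<in> parallels" "k \<in> parallels" "j < k"
  shows "diamond_h N k < diamond_h N j"
proof -
  have N0: "real N > 0" using N4 by simp
  have "S j + d j \<le> S k" using S_Suc[of j] S_mono[of "Suc j" k] assms by simp
  moreover have "2 \<le> d j" "2 \<le> d k" using parallel_bounds(1) assms by auto
  ultimately have "2 * S j + d j < 2 * S k + d k" by linarith
  then have "real (2 * S j + d j) < real (2 * S k + d k)" by (simp only: of_nat_less_iff)
  then show ?thesis using N0 by (simp add: diamond_h_eq divide_strict_right_mono)
qed

lemma diamond_eq_image: "diamond N = (\<lambda>(j, l). diamond_point N j l) ` (SIGMA j:parallels. {..<d j})"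
  by (force simp: diamond_def)

text \<open>\<open>diamond N\<close> is a set, so only injectivity turns sums over it into double
  sums and gives it cardinality \<open>N\<close>. Heights separate the parallels, and the angle
  modulo 2 pi separates points of one parallel.\<close>

lemma inj_diamond_point: "inj_on (\<lambda>(j, l). diamond_point N j l) (SIGMA j:parallels. {..<d j})"
proof (rule inj_onI, clarify)
  fix j l k m
  assume j: "j \<in> parallels" and k: "k \<in> parallels" and l: "l < d j" and m: "m < d k"
    and eq: "diamond_point N j l = diamond_point N k m"
  have "diamond_h N j = diamond_h N k"
    using arg_cong[OF eq, of "\<lambda>p. p $ 3"] by (simp add: diamond_point_def)
  then have jk: "j = k" using diamond_h_strict_decreasing[OF j k] diamond_h_strict_decreasing[OF k j] by (metis less_irrefl linorder_neqE_nat)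
  have rho: "diamond_rho N j > 0" by (rule parallel_bounds(2)[OF j])
  have "cos (2 * pi * real l / real (d j)) = cos (2 * pi * real m / real (d j))"
    "sin (2 * pi * real l / real (d j)) = sin (2 * pi * real m / real (d j))"
    using arg_cong[OF eq, of "\<lambda>p. p $ 1"] arg_cong[OF eq, of "\<lambda>p. p $ 2"] rho jk by (simp_all add: diamond_point_def)
  then obtain i :: int where i: "2 * pi * real l / real (d j) = 2 * pi * real m / real (d j) + 2 * pi * of_int i"
    using sin_cos_eq_iff[of "2 * pi * real l / real (d j)" "2 * pi * real m / real (d j)"] by (auto simp: mult_ac)
  have dj: "real (d j) > 0" using parallel_bounds(1)[OF j] by simp
  have "2 * pi * real l = 2 * pi * (real m + of_int i * real (d j))"
    using i dj by (simp add: field_simps)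
  then have "real l = real m + of_int i * real (d j)" by simp
  then have "real_of_int (int l) = real_of_int (int m + i * int (d j))" by simp
  then have li: "int l = int m + i * int (d j)" by (simp only: of_int_eq_iff)
  \<comment> \<open>Two indices below \<open>d j\<close> differ by less than \<open>d j\<close>, so
    no full turn lies between them.\<close>
  have "i = 0"
  proof (rule ccontr)
    assume "i \<noteq> 0"
    then have "1 \<le> \<bar>i\<bar>" by simp
    then have "1 * int (d j) \<le> \<bar>i\<bar> * int (d j)" by (intro mult_right_mono) auto
    also have "\<dots> = \<bar>int l - int m\<bar>" using li by (simp add: abs_mult)
    also have "\<dots> < int (d j)" using l m jk by simp
    finally show False by simp
  qed
  then show "j = k \<and> l = m" using li jk by simp
qed

lemma sum_diamond: "(\<Sum>x\<in>diamond N. f x) = (\<Sum>j\<in>parallels. \<Sum>l<d j. f (diamond_point N j l))"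
  unfolding diamond_eq_image sum.reindex[OF inj_diamond_point]
  by (subst sum.Sigma) (auto simp: case_prod_unfold)

lemma card_diamond: "card (diamond N) = N"
proof -
  have "card (diamond N) = (\<Sum>j\<in>parallels. \<Sum>l<d j. 1)"
    unfolding card_eq_sum by (rule sum_diamond)
  also have "\<dots> = (\<Sum>j\<in>parallels. d j)" by simp
  also have "parallels = {1..<2 * M}" using M_bounds(1) by auto
  finally show ?thesis using S_end by (simp add: S_def)
qed

lemma finite_diamond: "finite (diamond N)"
  unfolding diamond_eq_image by auto

lemma diamond_subset_sphere: "diamond N \<subseteq> S2"
  unfolding diamond_eq_image
  using circle_point_in_sphere[OF parallel_bounds(3)] by (auto simp: diamond_point_eq simp del: mem_sphere_0)

lemma diamond_nonempty: "diamond N \<noteq> {}"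
  using card_diamond N4 by auto

text \<open>Colatitude of the lower edge of the j-th band: the polar cap above it has normalized
  area \<open>S (Suc j) / N\<close>. The value at 0 is the north pole and the value at
  \<open>2 * M - 1\<close> is pi.\<close>

definition band_angle :: "nat \<Rightarrow> real" where
  "band_angle j = arccos (1 - 2 * real (S (Suc j)) / real N)"

lemma cos_band_angle:
  assumes "Suc j \<le> 2 * M"
  shows "cos (band_angle j) = 1 - 2 * real (S (Suc j)) / real N" "0 \<le> band_angle j" "band_angle j \<le> pi"
proof -
  have "S (Suc j) \<le> N" using S_mono[OF assms] unfolding S_end .
  then have "real (S (Suc j)) \<le> real N" by (simp only: of_nat_le_iff)
  then have "2 * real (S (Suc j)) / real N \<le> 2" using N4 by (simp add: field_simps)
  moreover have "0 \<le> 2 * real (S (Suc j)) / real N" by simp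
  ultimately have "\<bar>1 - 2 * real (S (Suc j)) / real N\<bar> \<le> 1" by (simp add: abs_le_iff)
  then show "cos (band_angle j) = 1 - 2 * real (S (Suc j)) / real N" "0 \<le> band_angle j" "band_angle j \<le> pi"
    unfolding band_angle_def by (auto simp: cos_arccos_abs arccos_lbound arccos_ubound abs_le_iff)
qed

text \<open>Each band has error at most \<kappa> times its own kernel mass. The bands fill [0, pi]
  and the masses add up to 4 pi, so the relative error \<kappa> survives the summation whatever the
  number of bands.\<close>

lemma discrepancy_large_scale:
  assumes r: "1 / 2 \<le> r" "r < 1" "1 / sqrt (real N) \<le> 1 - r" and z: "z \<in> S2"
  shows "\<bar>poisson_discrepancy (diamond N) r z\<bar> \<le> discrepancy_const / (real N * (1 - r)\<^sup>2)"
proof -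
  define \<eta> where "\<eta> = 1 / sqrt (real N)"
  have N0: "real N > 0" using N4 by simp
  have \<eta>: "\<eta> > 0" "\<eta>\<^sup>2 = 1 / real N" using N0 by (auto simp: \<eta>_def power_divide)
  define \<kappa> where "\<kappa> = 10 ^ 8 * 2000 ^ 6 * \<eta>\<^sup>2 / (1 - r)\<^sup>2"
  define I where "I = (\<lambda>j. integral {band_angle (j - 1)..band_angle j} (\<lambda>\<theta>. sin \<theta> * circle_integral r z \<theta>))"
  define X where "X = (\<lambda>j. \<Sum>l<d j. poisson r (diamond_point N j l \<bullet> z))"
  have band: "\<bar>I j - 4 * pi * \<eta>\<^sup>2 * X j\<bar> \<le> \<kappa> * I j" if j: "j \<in> parallels" for j
  proof -
    note eta = \<eta>(2)
    interpret parallel \<eta> "diamond_rho N j" "diamond_h N j" r "d j" z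
      by unfold_locales (use parallel_bounds[OF j] r z \<eta> in \<open>auto simp: \<eta>_def\<close>)
    have j1: "Suc (j - 1) = j" "j - 1 < j" using j by auto
    note c1 = cos_band_angle[of "j - 1", unfolded j1] and c2 = cos_band_angle[of j]
    have jM: "j \<le> 2 * M" "Suc j \<le> 2 * M" using j by auto
    have "cos (band_angle j) \<le> cos (band_angle (j - 1))"
      using c1(1) c2(1) jM S_mono[of j "Suc j"] N0 by (simp add: divide_right_mono)
    then have le: "band_angle (j - 1) \<le> band_angle j"
      using c1 c2 jM cos_mono_le_eq by blast
    have h1: "cos (band_angle (j - 1)) = diamond_h N j + real (d j) * \<eta>\<^sup>2"
      using c1(1) jM N0 by (simp add: eta diamond_h_eq add_divide_distrib)
    have h2: "cos (band_angle j) = diamond_h N j - real (d j) * \<eta>\<^sup>2"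
      using c2(1) jM N0 S_Suc[of j] j by (simp add: eta diamond_h_eq add_divide_distrib)
    have xl: "x l = diamond_point N j l" for l
      by (simp add: x_def angle_def diamond_point_eq)
    show ?thesis
      using band_estimate[OF _ le _ h1 h2] c1 c2 jM
      unfolding I_def X_def \<kappa>_def xl by simp
  qed
  have sumI: "(\<Sum>j\<in>{1..m}. I j) = integral {0..band_angle m} (\<lambda>\<theta>. sin \<theta> * circle_integral r z \<theta>)" if "m \<le> 2 * M - 1" for m
    using that
  proof (induction m)
    case 0
    have "band_angle 0 = 0" by (simp add: band_angle_def S_def)
    then show ?case by simp
  next
    case (Suc m)
    have m: "Suc m \<le> 2 * M" "Suc (Suc m) \<le> 2 * M" using Suc(2) M_bounds(1) by auto
    note c1 = cos_band_angle[OF m(1)] and c2 = cos_band_angle[OF m(2)]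
    have "cos (band_angle (Suc m)) \<le> cos (band_angle m)"
      using c1(1) c2(1) S_mono[of "Suc m" "Suc (Suc m)"] N0 by (simp add: divide_right_mono)
    then have le: "band_angle m \<le> band_angle (Suc m)" using c1 c2 cos_mono_le_eq by blast
    have "integral {0..band_angle m} (\<lambda>\<theta>. sin \<theta> * circle_integral r z \<theta>) + I (Suc m) = integral {0..band_angle (Suc m)} (\<lambda>\<theta>. sin \<theta> * circle_integral r z \<theta>)"
      unfolding I_def
      using c1 c2 le r z
      by (simp, intro Henstock_Kurzweil_Integration.integral_combine)
        (auto intro!: integrable_continuous_real continuous_intros continuous_on_circle_integral)
    then show ?case using Suc by simp
  qed
  have "band_angle (2 * M - 1) = pi"
  proof -
    have "Suc (2 * M - 1) = 2 * M" using M_bounds(1) by simp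
    then show ?thesis using S_end N0 by (simp add: band_angle_def)
  qed
  then have total: "(\<Sum>j\<in>parallels. I j) = 4 * pi"
    using sumI[of "2 * M - 1"] integral_circle_integral[of r z] r z by simp
  have "\<bar>(\<Sum>j\<in>parallels. I j) - 4 * pi * \<eta>\<^sup>2 * (\<Sum>j\<in>parallels. X j)\<bar> = \<bar>\<Sum>j\<in>parallels. I j - 4 * pi * \<eta>\<^sup>2 * X j\<bar>"
    by (simp add: sum_subtractf sum_distrib_left)
  also have "\<dots> \<le> (\<Sum>j\<in>parallels. \<bar>I j - 4 * pi * \<eta>\<^sup>2 * X j\<bar>)" by (rule sum_abs)
  also have "\<dots> \<le> (\<Sum>j\<in>parallels. \<kappa> * I j)" by (intro sum_mono band)
  also have "\<dots> = 4 * pi * \<kappa>" by (simp only: sum_distrib_left[symmetric] total) simp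
  finally have "\<bar>4 * pi - 4 * pi * (\<eta>\<^sup>2 * (\<Sum>j\<in>parallels. X j))\<bar> \<le> 4 * pi * \<kappa>"
    unfolding total by (simp only: mult.assoc)
  then have "4 * pi * \<bar>1 - \<eta>\<^sup>2 * (\<Sum>j\<in>parallels. X j)\<bar> \<le> 4 * pi * \<kappa>"
    by (simp add: abs_mult flip: right_diff_distrib[of "4 * pi" 1, simplified])
  then have "\<bar>1 - \<eta>\<^sup>2 * (\<Sum>j\<in>parallels. X j)\<bar> \<le> \<kappa>" by (rule mult_left_le_imp_le) simp
  moreover have "poisson_discrepancy (diamond N) r z = \<eta>\<^sup>2 * (\<Sum>j\<in>parallels. X j) - 1"
    by (simp add: poisson_discrepancy_def card_diamond sum_diamond X_def \<eta>)
  ultimately show ?thesis by (simp add: abs_minus_commute \<kappa>_def \<eta> discrepancy_const_def)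
qed

text \<open>Removes the restriction on 1 - r. Beyond the resolution of the points the claimed bound
  exceeds 1, so it suffices to bound the mean of the nonnegative kernel from above, by comparison
  with the last admissible radius.\<close>

lemma discrepancy:
  assumes r: "1 / 2 \<le> r" "r < 1" and z: "z \<in> S2"
  shows "\<bar>poisson_discrepancy (diamond N) r z\<bar> \<le> 2 * (1 + discrepancy_const) / (real N * (1 - r)\<^sup>2)"
proof (cases "1 / sqrt (real N) \<le> 1 - r")
  case True
  have "discrepancy_const / (real N * (1 - r)\<^sup>2) \<le> 2 * (1 + discrepancy_const) / (real N * (1 - r)\<^sup>2)"
    using discrepancy_const_nonneg by (intro divide_right_mono) auto
  with discrepancy_large_scale[OF r True z] show ?thesis by (rule order_trans)
next
  case False
  have N0: "real N > 0" using N4 by simp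
  \<comment> \<open>The largest admissible radius: there N (1 - r0)^2 = 1, so the discrepancy is at
    most a constant. It is at least 1 / 2 because N >= 4.\<close>
  define r0 where "r0 = 1 - 1 / sqrt (real N)"
  have s2: "2 \<le> sqrt (real N)" using N4 real_le_rsqrt[of 2 "real N"] by simp
  have r0: "1 / 2 \<le> r0" "r0 < 1" "1 / sqrt (real N) \<le> 1 - r0" "r0 \<le> r"
  proof -
    have "1 / sqrt (real N) \<le> 1 / 2" using s2 N0 by (intro divide_left_mono) auto
    moreover have "0 < 1 / sqrt (real N)" using N0 by simp
    ultimately show "1 / 2 \<le> r0" "r0 < 1" "1 / sqrt (real N) \<le> 1 - r0" "r0 \<le> r"
      using False by (simp_all add: r0_def)
  qed
  have d0: "(1 - r0)\<^sup>2 = 1 / real N" using N0 by (simp add: r0_def power_divide)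
  define P where "P = (\<lambda>r. 1 / real N * (\<Sum>x\<in>diamond N. poisson r (x \<bullet> z)))"
  have G: "poisson_discrepancy (diamond N) r z = P r - 1" for r
    by (simp add: poisson_discrepancy_def P_def card_diamond)
  have in1: "\<bar>x \<bullet> z\<bar> \<le> 1" if "x \<in> diamond N" for x
    using that diamond_subset_sphere z by (intro abs_inner_sphere_le_1) auto
  have P0: "0 \<le> P r"
    unfolding P_def by (intro mult_nonneg_nonneg sum_nonneg poisson_nonneg in1) (use r in auto)
  have "P r0 - 1 \<le> discrepancy_const"
    using discrepancy_large_scale[OF r0(1,2,3) z] N0 unfolding G by (simp add: d0)
  then have P1: "P r0 \<le> 1 + discrepancy_const" by simp
  have q: "((1 - r0) / (1 - r))\<^sup>2 = 1 / (real N * (1 - r)\<^sup>2)" by (simp add: power_divide d0)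
  have "P r \<le> 1 / real N * (\<Sum>x\<in>diamond N. 2 * ((1 - r0) / (1 - r))\<^sup>2 * poisson r0 (x \<bullet> z))"
    unfolding P_def using r0 r in1 by (intro mult_left_mono sum_mono poisson_le_smaller_radius) auto
  also have "\<dots> = 2 * ((1 - r0) / (1 - r))\<^sup>2 * P r0"
    unfolding P_def sum_distrib_left[symmetric] by simp
  also have "\<dots> \<le> 2 * ((1 - r0) / (1 - r))\<^sup>2 * (1 + discrepancy_const)"
    using P1 by (intro mult_left_mono) simp_all
  also have "\<dots> = 2 * (1 + discrepancy_const) / (real N * (1 - r)\<^sup>2)" unfolding q by simp
  finally have up: "P r \<le> 2 * (1 + discrepancy_const) / (real N * (1 - r)\<^sup>2)" .
  \<comment> \<open>Needed for the lower side: the discrepancy is never below - 1.\<close>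
  have "1 \<le> 2 * (1 + discrepancy_const) / (real N * (1 - r)\<^sup>2)"
  proof -
    have "(1 - r)\<^sup>2 \<le> (1 - r0)\<^sup>2" using r r0 by (intro power_mono) auto
    then have "real N * (1 - r)\<^sup>2 \<le> real N * (1 / real N)" unfolding d0 using N0 by (intro mult_left_mono) auto
    then have "real N * (1 - r)\<^sup>2 \<le> 1" using N0 by simp
    moreover have "0 < real N * (1 - r)\<^sup>2" using N0 r by simp
    ultimately show ?thesis using discrepancy_const_nonneg by (subst le_divide_eq_1_pos) auto
  qed
  then show ?thesis unfolding G using up P0 by (simp add: abs_le_iff)
qed

end

theorem corollary2:
  fixes s :: real
  assumes "1 < s" and "s < 2"
  shows "\<exists>C>0. \<forall>Y. harmonic_basis Y \<longrightarrow>
           (\<forall>N::nat. 4 \<le> N \<longrightarrow>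
              (SUP f\<in>{f \<in> sobolev_space Y s. sobolev_norm Y s f \<le> 1}.
                 ereal \<bar>1 / real N * (\<Sum>x\<in>diamond N. continuous_rep f x) - (LINT x|sphere_measure. f x)\<bar>)
              \<le> ereal (C * real N powr (- s / 2)))"
proof -
  define D :: real where "D = 2 * (1 + discrepancy_const)"
  have D: "1 \<le> D" using discrepancy_const_nonneg by (simp add: D_def)
  obtain C where C: "C > 0"
    "\<And>N J. 1 \<le> N \<Longrightarrow> (\<Sum>j<J. (4 ^ j / N) powr (- s) * (4 ^ j / N) * min (4 ^ j / N) 1) \<le> C"
    by (rule dyadic_sum_le[OF assms]) (rule that; blast)
  show ?thesis
  \<comment> \<open>\<open>D\<close> is absolute and \<open>C\<close> depends on \<open>s\<close>
    alone, so the constant can be fixed before the basis; 16 D is the root of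
    \<open>256 * D\<^sup>2\<close>.\<close>
  proof (intro exI[of _ "16 * D * sqrt C"] conjI allI impI SUP_least)
    show "0 < 16 * D * sqrt C" using D C(1) by simp
    fix Y and N :: nat and f
    assume Y: "harmonic_basis Y" and N: "4 \<le> N" and "f \<in> {f \<in> sobolev_space Y s. sobolev_norm Y s f \<le> 1}"
    then have f: "f \<in> sobolev_space Y s" "sobolev_norm Y s f \<le> 1" by auto
    interpret spherical_harmonic_basis Y by standard (rule Y)
    interpret diamond_points N by standard (rule N)
    have "\<bar>1 / real (card (diamond N)) * (\<Sum>x\<in>diamond N. continuous_rep f x) - (LINT x|\<sigma>. f x)\<bar>
        \<le> sqrt (256 * D\<^sup>2 * C * real N powr (- s))"
    proof (rule sobolev_quadrature_error[OF assms(1) f finite_diamond diamond_subset_sphere diamond_nonempty])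
      fix L
      show "(\<Sum>l\<in>{1..<L}. (\<Sum>k\<in>orders l. (quadrature_mean (diamond N) l k)\<^sup>2) / (1 + eigenvalue l) powr s)
          \<le> 256 * D\<^sup>2 * C * real N powr (- s)"
      proof (rule quadrature_energy_dyadic[OF assms D finite_diamond diamond_subset_sphere diamond_nonempty])
        show "real N = real (card (diamond N))" by (simp add: card_diamond)
        show "\<bar>poisson_discrepancy (diamond N) r z\<bar> \<le> D / (real N * (1 - r)\<^sup>2)"
          if "1 / 2 \<le> r" "r < 1" "z \<in> S2" for r z
          unfolding D_def by (rule discrepancy[OF that])
        show "(\<Sum>j<J. (4 ^ j / real N) powr (- s) * (4 ^ j / real N) * min (4 ^ j / real N) 1) \<le> C" for J
          using C(2)[of "real N" J] N by simp
      qed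
    qed
    also have "sqrt (256 * D\<^sup>2 * C * real N powr (- s)) = 16 * D * sqrt C * real N powr (- s / 2)"
    proof -
      have "sqrt (real N powr (- s)) = real N powr (- s / 2)"
        by (simp add: powr_half_sqrt[symmetric] powr_powr)
      moreover have "sqrt 256 = (16 :: real)" by (rule real_sqrt_unique) auto
      ultimately show ?thesis using D by (simp add: real_sqrt_mult)
    qed
    finally show "ereal \<bar>1 / real N * (\<Sum>x\<in>diamond N. continuous_rep f x) - (LINT x|\<sigma>. f x)\<bar>
        \<le> ereal (16 * D * sqrt C * real N powr (- s / 2))"
      by (simp add: card_diamond)
  qed
qed

end
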